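(* The universal minimal flow for all normal subgroups of $T_\omega^*$ and of $\mathrm{Aut}(\mathcal{P}(\omega)/\mathrm{fin})$ is $\mathrm{NO}(\mathcal{P}(\omega)/\mathrm{fin})$.
   Context: $\mathcal{P}(\omega)/\mathrm{fin}$ is the quotient of the Boolean algebra of all subsets of $\omega$ by the ideal of finite sets. $T_\omega$ is the set of all bijections $f:A\to B$ between cofinite subsets $A,B$ of $\omega$. Each $f\in T_\omega$ induces an automorphism $f^*$ of $\mathcal{P}(\omega)/\mathrm{fin}$ by $f^*([X])=[f[X]]$ (meaning $[f[X\cap A]]$), and $T_\omega^*=\{f^*:f\in T_\omega\}\le\mathrm{Aut}(\mathcal{P}(\omega)/\mathrm{fin})$. The group $\mathrm{Aut}(\mathcal{P}(\omega)/\mathrm{fin})$ carries the topology of pointwise convergence on the discrete set $\mathcal{P}(\omega)/\mathrm{fin}$, and its subgroups carry the subspace topology. A linear ordering on a finite Boolean algebra is natural if it is induced antilexicographically by a linear ordering $a_1<\dots<a_n$ of its atoms: for $x\neq y$, $x<y$ iff $a_i\le y$ (and $a_i\not\le x$), where $i$ is the largest index such that exactly one of $x,y$ is above $a_i$. For a Boolean algebra $\mathcal{B}$, $\mathrm{NO}(\mathcal{B})$ is the set of all linear orderings on $\mathcal{B}$ whose restriction to each finite subalgebra is natural, with the subspace topology from $2^{\mathcal{B}\times\mathcal{B}}$; a group $G$ of automorphisms of $\mathcal{B}$ acts on it by $a\,(g\prec)\,b\iff g^{-1}a\prec g^{-1}b$. A $G$-flow is a compact Hausdorff space with a continuous action of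 the topological group $G$; it is minimal if it has no proper non-empty closed invariant subset. The universal minimal flow of $G$ is the (unique up to isomorphism) minimal $G$-flow that maps onto every minimal $G$-flow by a continuous equivariant map.
   Formalization: The trivial normal subgroup is excluded: its universal minimal flow is a single point, whereas NO(P(ω)/fin) has more than one point, so "all normal subgroups" is read as "all non-trivial normal subgroups". *)

theory Defs
  imports "HOL-Analysis.Analysis" "HOL-Algebra.Group_Action"
begin

section \<open>The Boolean algebra of subsets of the natural numbers modulo finite sets\<close>

definition eq_mod_fin :: "nat set \<Rightarrow> nat set \<Rightarrow> bool" where
  "eq_mod_fin X Y \<longleftrightarrow> finite (X - Y) \<and> finite (Y - X)"

lemma eq_mod_fin_equivp: "equivp eq_mod_fin"
proof (rule equivpI)
  show "reflp eq_mod_fin" by (auto simp: reflp_def eq_mod_fin_def)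
  show "symp eq_mod_fin" by (auto simp: symp_def eq_mod_fin_def)
  show "transp eq_mod_fin"
  proof (rule transpI)
    fix X Y Z assume a: "eq_mod_fin X Y" "eq_mod_fin Y Z"
    have "X - Z \<subseteq> (X - Y) \<union> (Y - Z)" "Z - X \<subseteq> (Z - Y) \<union> (Y - X)" by auto
    with a show "eq_mod_fin X Z" unfolding eq_mod_fin_def
      by (meson finite_UnI finite_subset)
  qed
qed

quotient_type pow_mod_fin = "nat set" / eq_mod_fin
  by (rule eq_mod_fin_equivp)

instantiation pow_mod_fin :: boolean_algebra
begin

lift_definition bot_pow_mod_fin :: pow_mod_fin is "{}" .

lift_definition top_pow_mod_fin :: pow_mod_fin is UNIV .

lift_definition inf_pow_mod_fin :: "pow_mod_fin \<Rightarrow> pow_mod_fin \<Rightarrow> pow_mod_fin" is "(\<inter>)"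
  unfolding eq_mod_fin_def
  by (elim conjE, rule conjI; rule finite_subset[rotated], erule (1) finite_UnI, blast)

lift_definition sup_pow_mod_fin :: "pow_mod_fin \<Rightarrow> pow_mod_fin \<Rightarrow> pow_mod_fin" is "(\<union>)"
  unfolding eq_mod_fin_def
  by (auto simp: Un_Diff intro: finite_subset[rotated])

lift_definition uminus_pow_mod_fin :: "pow_mod_fin \<Rightarrow> pow_mod_fin" is "uminus"
  unfolding eq_mod_fin_def by (simp add: Diff_eq Int_commute)

lift_definition less_eq_pow_mod_fin :: "pow_mod_fin \<Rightarrow> pow_mod_fin \<Rightarrow> bool"
  is "\<lambda>X Y. finite (X - Y)"
proof -
  fix X X' Y Y' assume a: "eq_mod_fin X X'" "eq_mod_fin Y Y'"
  have "X - Y \<subseteq> (X - X') \<union> ((X' - Y') \<union> (Y' - Y))"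
    "X' - Y' \<subseteq> (X' - X) \<union> ((X - Y) \<union> (Y - Y'))" by auto
  with a show "finite (X - Y) = finite (X' - Y')" unfolding eq_mod_fin_def
    by (meson finite_UnI finite_subset)
qed

definition minus_pow_mod_fin :: "pow_mod_fin \<Rightarrow> pow_mod_fin \<Rightarrow> pow_mod_fin" where
  "minus_pow_mod_fin x y = inf x (- y)"

definition less_pow_mod_fin :: "pow_mod_fin \<Rightarrow> pow_mod_fin \<Rightarrow> bool" where
  "less_pow_mod_fin x y \<longleftrightarrow> x \<le> y \<and> \<not> y \<le> x"

instance
proof
  fix x y z :: pow_mod_fin
  show "x < y \<longleftrightarrow> x \<le> y \<and> \<not> y \<le> x" by (rule less_pow_mod_fin_def)
  show "x - y = inf x (- y)" by (rule minus_pow_mod_fin_def)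
  show "x \<le> x" by transfer simp
  show "x \<le> z" if "x \<le> y" "y \<le> z"
    using that
  proof transfer
    fix X Y Z :: "nat set" assume "finite (X - Y)" "finite (Y - Z)"
    then have "finite ((X - Y) \<union> (Y - Z))" by (rule finite_UnI)
    then show "finite (X - Z)" by (rule finite_subset[rotated]) blast
  qed
  show "x = y" if "x \<le> y" "y \<le> x"
    using that by transfer (simp only: eq_mod_fin_def simp_thms)
  show "inf x y \<le> x" by transfer (simp add: Diff_eq)
  show "inf x y \<le> y" by transfer (simp add: Diff_eq)
  show "x \<le> sup x y" by transfer (simp add: Diff_eq)
  show "y \<le> sup x y" by transfer (simp add: Diff_eq)
  show "bot \<le> x" by transfer simp
  show "x \<le> top_class.top" by transfer simp
  show "x \<le> inf y z" if "x \<le> y" "x \<le> z"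
    using that by transfer (simp only: Diff_Int finite_Un simp_thms)
  show "sup y z \<le> x" if "y \<le> x" "z \<le> x"
    using that by transfer (simp only: Un_Diff finite_Un simp_thms)
  show "sup x (inf y z) = inf (sup x y) (sup x z)"
    by transfer (simp only: eq_mod_fin_def Un_Int_distrib Diff_cancel finite.emptyI simp_thms)
  show "inf x (- x) = bot"
    by transfer (simp only: eq_mod_fin_def Compl_disjoint Diff_cancel finite.emptyI simp_thms)
  show "sup x (- x) = top_class.top"
    by transfer (simp only: eq_mod_fin_def Compl_partition Diff_cancel finite.emptyI simp_thms)
qed

end


section \<open>Automorphisms\<close>

definition boolean_automorphisms :: "('b::boolean_algebra \<Rightarrow> 'b) set" where
  "boolean_automorphisms = {f. bij f \<and>
     (\<forall>x y. f (inf x y) = inf (f x) (f y)) \<and> (\<forall>x y. f (sup x y) = sup (f x) (f y)) \<and>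
     (\<forall>x. f (- x) = - f x) \<and> f bot = bot \<and> f top_class.top = top_class.top}"

definition aut_group :: "('b::boolean_algebra \<Rightarrow> 'b) monoid" where
  "aut_group = \<lparr>carrier = boolean_automorphisms, mult = (\<circ>), one = id\<rparr>"

definition pointwise_topology :: "('b \<Rightarrow> 'b) topology" where
  "pointwise_topology = product_topology (\<lambda>_. discrete_topology UNIV) UNIV"

lemma group_aut_group: "group (aut_group :: ('b::boolean_algebra \<Rightarrow> 'b) monoid)"
proof (rule groupI)
  fix f :: "'b \<Rightarrow> 'b" assume "f \<in> carrier aut_group"
  then have f: "bij f" "\<And>x y. f (inf x y) = inf (f x) (f y)"
    "\<And>x y. f (sup x y) = sup (f x) (f y)" "\<And>x. f (- x) = - f x" "f bot = bot" "f top_class.top = top_class.top"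
    by (auto simp: aut_group_def boolean_automorphisms_def)
  let ?g = "inv_into UNIV f"
  have g: "f (?g x) = x" for x using f(1) by (simp add: bij_is_surj surj_f_inv_f)
  have e: "?g x = y" if "x = f y" for x y using f(1) that by (simp add: bij_is_inj)
  have "?g \<in> boolean_automorphisms" unfolding boolean_automorphisms_def
    using f(1) by (auto simp: bij_imp_bij_inv f g intro!: e)
  moreover have "?g \<circ> f = id" using f(1) by (simp add: bij_is_inj)
  ultimately show "\<exists>g\<in>carrier aut_group. g \<otimes>\<^bsub>aut_group\<^esub> f = \<one>\<^bsub>aut_group\<^esub>"
    by (auto simp: aut_group_def)
qed (auto simp: aut_group_def boolean_automorphisms_def bij_comp)

text \<open>
  A bijection \<open>f\<close> from \<open>A\<close> onto a cofinite set is given by its domain \<open>A\<close> and a total function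
  of which only the restriction to \<open>A\<close> matters.
\<close>

definition T_omega :: "(nat set \<times> (nat \<Rightarrow> nat)) set" where
  "T_omega = {(A, f). finite (- A) \<and> (\<exists>B. finite (- B) \<and> bij_betw f A B)}"

lift_definition induced_map :: "nat set \<times> (nat \<Rightarrow> nat) \<Rightarrow> pow_mod_fin \<Rightarrow> pow_mod_fin"
  is "\<lambda>(A, f) X. f ` (X \<inter> A)"
proof -
  fix p :: "nat set \<times> (nat \<Rightarrow> nat)" and X Y :: "nat set"
  obtain A f where p: "p = (A, f)" by fastforce
  assume "eq_mod_fin X Y"
  then have "finite (f ` (X - Y))" "finite (f ` (Y - X))" by (auto simp: eq_mod_fin_def)
  moreover have "f ` (X \<inter> A) - f ` (Y \<inter> A) \<subseteq> f ` (X - Y)"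
    "f ` (Y \<inter> A) - f ` (X \<inter> A) \<subseteq> f ` (Y - X)" by auto
  ultimately show "eq_mod_fin ((case p of (A, f) \<Rightarrow> \<lambda>X. f ` (X \<inter> A)) X)
      ((case p of (A, f) \<Rightarrow> \<lambda>X. f ` (X \<inter> A)) Y)"
    by (auto simp: p eq_mod_fin_def intro: finite_subset)
qed

lemma induced_map_abs:
  "induced_map (A, f) (abs_pow_mod_fin X) = abs_pow_mod_fin (f ` (X \<inter> A))"
  by (simp add: induced_map.abs_eq)

definition T_omega_star :: "(pow_mod_fin \<Rightarrow> pow_mod_fin) set" where
  "T_omega_star = induced_map ` T_omega"

lemma T_omegaE:
  assumes "p \<in> T_omega"
  obtains A f B where "p = (A, f)" "finite (- A)" "finite (- B)" "bij_betw f A B"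
  using assms by (auto simp: T_omega_def)

lemma induced_map_comp:
  "induced_map (A, f) \<circ> induced_map (A', f') = induced_map ({x \<in> A'. f' x \<in> A}, f \<circ> f')"
proof
  fix x
  show "(induced_map (A, f) \<circ> induced_map (A', f')) x
      = induced_map ({x \<in> A'. f' x \<in> A}, f \<circ> f') x"
  proof (induction x rule: pow_mod_fin.abs_induct)
    case (1 X)
    have "f ` (f' ` (X \<inter> A') \<inter> A) = (f \<circ> f') ` (X \<inter> {x \<in> A'. f' x \<in> A})" by auto
    then show ?case by (simp only: comp_apply[of "induced_map (A, f)"] induced_map_abs)
  qed
qed

lemma induced_map_id:
  assumes "finite (- A)" "\<And>n. n \<in> A \<Longrightarrow> f n = n"
  shows "induced_map (A, f) = id"
proof
  fix x
  show "induced_map (A, f) x = id x"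
  proof (induction x rule: pow_mod_fin.abs_induct)
    case (1 X)
    have "f ` (X \<inter> A) = X \<inter> A" using assms(2) by force
    moreover have "finite (X - A)"
      by (rule finite_subset[OF _ assms(1)]) auto
    moreover have "X \<inter> A - X = {}" "X - X \<inter> A = X - A" by auto
    ultimately show ?case
      by (simp only: induced_map_abs pow_mod_fin.abs_eq_iff eq_mod_fin_def finite.emptyI id_apply
          simp_thms)
  qed
qed

lemma T_omega_comp:
  assumes "(A, f) \<in> T_omega" "(A', f') \<in> T_omega"
  shows "({x \<in> A'. f' x \<in> A}, f \<circ> f') \<in> T_omega"
proof -
  obtain B B' where B: "finite (- A)" "finite (- B)" "bij_betw f A B"
      and B': "finite (- A')" "finite (- B')" "bij_betw f' A' B'"
    using assms by (auto simp: T_omega_def)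
  let ?D = "{x \<in> A'. f' x \<in> A}"
  have "- ?D \<subseteq> - A' \<union> (f' -` (- A) \<inter> A')" by auto
  moreover have "finite (f' -` (- A) \<inter> A')"
    using B(1) B'(3) by (intro finite_vimage_IntI) (auto simp: bij_betw_def)
  ultimately have fD: "finite (- ?D)" using B'(1) by (meson finite_UnI finite_subset)
  have "- (f ` (A \<inter> B')) \<subseteq> - B \<union> f ` (- B')"
    using B(3) by (auto simp: bij_betw_def)
  then have fR: "finite (- (f ` (A \<inter> B')))"
    using B(2) B'(2) by (meson finite_UnI finite_imageI finite_subset)
  have "bij_betw f' ?D (A \<inter> B')" "bij_betw f (A \<inter> B') (f ` (A \<inter> B'))"
    using B(3) B'(3) by (auto simp: bij_betw_def inj_on_def)
  then have "bij_betw (f \<circ> f') ?D (f ` (A \<inter> B'))" by (rule bij_betw_trans)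
  then show ?thesis using fD fR by (auto simp: T_omega_def)
qed

lemma T_omega_inverse:
  assumes "p \<in> T_omega"
  obtains q where "q \<in> T_omega" "induced_map q \<circ> induced_map p = id"
    "induced_map p \<circ> induced_map q = id"
proof -
  obtain A f B where p: "p = (A, f)" and fin: "finite (- A)" "finite (- B)" and b: "bij_betw f A B"
    using assms by (rule T_omegaE)
  let ?g = "inv_into A f"
  have bg: "bij_betw ?g B A" using b by (rule bij_betw_inv_into)
  have sets: "{x \<in> A. f x \<in> B} = A" "{x \<in> B. ?g x \<in> A} = B"
    using b bg by (auto simp: bij_betw_def)
  have "induced_map (B, ?g) \<circ> induced_map p = id"
    unfolding p induced_map_comp sets
    using b by (intro induced_map_id fin) (simp add: bij_betw_inv_into_left)
  moreover have "induced_map p \<circ> induced_map (B, ?g) = id"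
    unfolding p induced_map_comp sets
    using b by (intro induced_map_id fin) (simp add: bij_betw_inv_into_right)
  moreover have "(B, ?g) \<in> T_omega" using fin bg by (auto simp: T_omega_def)
  ultimately show thesis by (rule that[rotated])
qed

lemma T_omega_star_automorphism:
  assumes "p \<in> T_omega"
  shows "induced_map p \<in> boolean_automorphisms"
proof -
  obtain A f B where p: "p = (A, f)" and fin: "finite (- A)" "finite (- B)"
      and b: "inj_on f A" "f ` A = B"
    using assms by (rule T_omegaE) (auto simp: bij_betw_def)
  obtain q where "induced_map q \<circ> induced_map p = id" "induced_map p \<circ> induced_map q = id"
    using assms by (rule T_omega_inverse)
  then have "bij (induced_map p)" by (rule o_bij)
  moreover have "induced_map p (inf x y) = inf (induced_map p x) (induced_map p y)" for x y
  proof (induction x rule: pow_mod_fin.abs_induct, induction y rule: pow_mod_fin.abs_induct)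
    case (1 Y X)
    have "f ` (X \<inter> Y \<inter> A) = f ` (X \<inter> A) \<inter> f ` (Y \<inter> A)"
      using b(1) by (auto simp: inj_on_def)
    then show ?case by (simp only: p inf_pow_mod_fin.abs_eq induced_map_abs)
  qed
  moreover have "induced_map p (sup x y) = sup (induced_map p x) (induced_map p y)" for x y
  proof (induction x rule: pow_mod_fin.abs_induct, induction y rule: pow_mod_fin.abs_induct)
    case (1 Y X)
    have "f ` ((X \<union> Y) \<inter> A) = f ` (X \<inter> A) \<union> f ` (Y \<inter> A)" by auto
    then show ?case by (simp only: p sup_pow_mod_fin.abs_eq induced_map_abs)
  qed
  moreover have "induced_map p (- x) = - induced_map p x" for x
  proof (induction x rule: pow_mod_fin.abs_induct)
    case (1 X)
    have "f ` (- X \<inter> A) - - f ` (X \<inter> A) = {}"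
      using b(1) by (auto simp: inj_on_def)
    moreover have "finite (- f ` (X \<inter> A) - f ` (- X \<inter> A))"
      by (rule finite_subset[OF _ fin(2)]) (use b(2) in auto)
    ultimately have "eq_mod_fin (f ` (- X \<inter> A)) (- f ` (X \<inter> A))"
      by (simp only: eq_mod_fin_def finite.emptyI simp_thms)
    then show ?case
      by (simp only: p uminus_pow_mod_fin.abs_eq induced_map_abs pow_mod_fin.abs_eq_iff)
  qed
  moreover have "induced_map p bot = bot"
    by (simp add: p bot_pow_mod_fin_def induced_map_abs)
  moreover have "induced_map p top_class.top = top_class.top"
    using b(2) fin(2)
    by (simp add: p top_pow_mod_fin_def induced_map_abs pow_mod_fin.abs_eq_iff eq_mod_fin_def
        Compl_eq_Diff_UNIV)
  ultimately show ?thesis by (simp add: boolean_automorphisms_def)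
qed

lemma subgroup_T_omega_star: "subgroup T_omega_star aut_group"
proof (rule group.subgroupI[OF group_aut_group])
  show "T_omega_star \<subseteq> carrier aut_group"
    by (auto simp: T_omega_star_def aut_group_def T_omega_star_automorphism)
  have "(UNIV, id) \<in> T_omega"
    using bij_betw_id[of UNIV] unfolding T_omega_def by (auto intro!: exI[of _ UNIV])
  then show "T_omega_star \<noteq> {}" by (auto simp: T_omega_star_def)
next
  fix a assume "a \<in> T_omega_star"
  then obtain p where p: "p \<in> T_omega" "a = induced_map p" by (auto simp: T_omega_star_def)
  obtain q where q: "q \<in> T_omega" "induced_map q \<circ> induced_map p = id"
    using p(1) by (rule T_omega_inverse)
  have "inv\<^bsub>aut_group\<^esub> a = induced_map q"
    by (rule group.inv_equality[OF group_aut_group])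
      (use p q in \<open>simp_all add: aut_group_def T_omega_star_automorphism\<close>)
  then show "inv\<^bsub>aut_group\<^esub> a \<in> T_omega_star" using q(1) by (simp add: T_omega_star_def)
next
  fix a b assume "a \<in> T_omega_star" "b \<in> T_omega_star"
  then obtain A f A' f' where a: "(A, f) \<in> T_omega" "a = induced_map (A, f)"
      and b: "(A', f') \<in> T_omega" "b = induced_map (A', f')"
    unfolding T_omega_star_def by fast
  have "a \<otimes>\<^bsub>aut_group\<^esub> b = induced_map ({x \<in> A'. f' x \<in> A}, f \<circ> f')"
    unfolding a(2) b(2) induced_map_comp[symmetric] by (simp only: aut_group_def monoid.simps)
  moreover have "induced_map ({x \<in> A'. f' x \<in> A}, f \<circ> f') \<in> T_omega_star"
    unfolding T_omega_star_def by (rule imageI) (rule T_omega_comp[OF a(1) b(1)])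
  ultimately show "a \<otimes>\<^bsub>aut_group\<^esub> b \<in> T_omega_star" by (simp only:)
qed


section \<open>Flows\<close>

definition is_flow ::
  "('g, 'm) monoid_scheme \<Rightarrow> 'g topology \<Rightarrow> 'x topology \<Rightarrow> ('g \<Rightarrow> 'x \<Rightarrow> 'x) \<Rightarrow> bool" where
  "is_flow G T X \<phi> \<longleftrightarrow>
     compact_space X \<and> Hausdorff_space X \<and> group_action G (topspace X) \<phi> \<and>
     continuous_map (prod_topology T X) X (\<lambda>(g, x). \<phi> g x)"

text \<open>The empty space is excluded: it would otherwise be a minimal flow onto which no non-empty
  flow can be mapped.\<close>

definition minimal_flow ::
  "('g, 'm) monoid_scheme \<Rightarrow> 'g topology \<Rightarrow> 'x topology \<Rightarrow> ('g \<Rightarrow> 'x \<Rightarrow> 'x) \<Rightarrow> bool" where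
  "minimal_flow G T X \<phi> \<longleftrightarrow>
     is_flow G T X \<phi> \<and> topspace X \<noteq> {} \<and>
     (\<forall>C. closedin X C \<and> C \<noteq> {} \<and> (\<forall>g\<in>carrier G. \<phi> g ` C \<subseteq> C) \<longrightarrow> C = topspace X)"

text \<open>HOL cannot quantify over types inside a formula. The argument of type \<open>'y itself\<close> names the
  type carrying the competing minimal flows; a theorem in which \<open>'y\<close> is a free type variable
  speaks about all minimal flows.\<close>

definition universal_minimal_flow ::
  "'y itself \<Rightarrow> ('g, 'm) monoid_scheme \<Rightarrow> 'g topology \<Rightarrow> 'x topology \<Rightarrow> ('g \<Rightarrow> 'x \<Rightarrow> 'x) \<Rightarrow> bool"
  where
  "universal_minimal_flow (_ :: 'y itself) G T X \<phi> \<longleftrightarrow>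
     minimal_flow G T X \<phi> \<and>
     (\<forall>(Y :: 'y topology) \<psi>. minimal_flow G T Y \<psi> \<longrightarrow>
        (\<exists>h. continuous_map X Y h \<and> h ` topspace X = topspace Y \<and>
             (\<forall>g\<in>carrier G. \<forall>x\<in>topspace X. h (\<phi> g x) = \<psi> g (h x))))"


section \<open>Natural orderings\<close>

definition boolean_subalgebra :: "'b::boolean_algebra set \<Rightarrow> bool" where
  "boolean_subalgebra S \<longleftrightarrow> bot \<in> S \<and> top_class.top \<in> S \<and>
     (\<forall>x\<in>S. \<forall>y\<in>S. inf x y \<in> S \<and> sup x y \<in> S) \<and> (\<forall>x\<in>S. - x \<in> S)"

definition atoms_of :: "'b::boolean_algebra set \<Rightarrow> 'b set" where
  "atoms_of S = {a \<in> S. a \<noteq> bot \<and> (\<forall>x\<in>S. x \<le> a \<longrightarrow> x = bot \<or> x = a)}"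

definition antilex_less :: "'b::boolean_algebra list \<Rightarrow> 'b \<Rightarrow> 'b \<Rightarrow> bool" where
  "antilex_less as x y \<longleftrightarrow>
     (\<exists>i<length as. as ! i \<le> y \<and> \<not> as ! i \<le> x \<and>
        (\<forall>j<length as. i < j \<longrightarrow> (as ! j \<le> x \<longleftrightarrow> as ! j \<le> y)))"

text \<open>Linear orderings are taken to be strict; the list \<open>as\<close> enumerates the atoms increasingly.\<close>

definition natural_on :: "'b::boolean_algebra set \<Rightarrow> ('b \<times> 'b \<Rightarrow> bool) \<Rightarrow> bool" where
  "natural_on S r \<longleftrightarrow>
     (\<exists>as. distinct as \<and> set as = atoms_of S \<and>
        (\<forall>x\<in>S. \<forall>y\<in>S. r (x, y) \<longleftrightarrow> antilex_less as x y))"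

definition natural_orderings :: "('b::boolean_algebra \<times> 'b \<Rightarrow> bool) set" where
  "natural_orderings = {r. strict_linear_order_on UNIV (Collect r) \<and>
     (\<forall>S. finite S \<and> boolean_subalgebra S \<longrightarrow> natural_on S r)}"

definition NO_topology :: "('b::boolean_algebra \<times> 'b \<Rightarrow> bool) topology" where
  "NO_topology = subtopology (product_topology (\<lambda>_. discrete_topology UNIV) UNIV) natural_orderings"

text \<open>The action is restricted to the space of natural orderings because \<^const>\<open>group_action\<close>
  requires extensional functions.\<close>

definition NO_action ::
  "('b::boolean_algebra \<Rightarrow> 'b) \<Rightarrow> ('b \<times> 'b \<Rightarrow> bool) \<Rightarrow> ('b \<times> 'b \<Rightarrow> bool)" where
  "NO_action g = (\<lambda>r\<in>natural_orderings. \<lambda>(a, b). r (inv_into UNIV g a, inv_into UNIV g b))"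

end

theory Submission
  imports Defs
begin

text \<open>
  Let \<open>N\<close> be the normal subgroup. Commuting a non-trivial element of \<open>N\<close> with elements of
  \<open>T_omega_star\<close>, and the result once more, gives elements of \<open>N\<close> that carry any finite partition
  to any other of the same size. This density makes every orbit in the space of natural orderings
  dense, so that space is a minimal flow.

  For universality fix a natural ordering \<open>r0\<close> and a minimal flow \<open>Y\<close>. Up to a small error,
  \<open>g \<mapsto> f (g y)\<close> depends only on the preimage under \<open>g\<close> of a finite partition, so it is a
  colouring of finite partitions. The Graham-Rothschild theorem and compactness give a point \<open>y\<close>
  for which \<open>f (g y)\<close> depends, up to \<open>1/2\<close>, only on the ordering \<open>g r0\<close> of that partition, for all
  \<open>f\<close> simultaneously. Then \<open>g r0 \<mapsto> g y\<close> extends to a continuous equivariant map onto \<open>Y\<close>.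
\<close>

section \<open>Parameter words\<close>

text \<open>The obstacle to density is that \<open>N\<close> may lack the maps in
  \<open>T_omega_star\<close> that carry one partition to another. Commutators imitate such a map on
  only a part of the algebra, and the imitation can be repaired when the first pieces of the two
  partitions overlap; disjoint ones are joined through an intermediate partition. Universality then
  uses nothing but transitivity on lists of pieces and is carried out for any nontrivial atomless
  Boolean algebra.

  The role of the ordering is to make partitions rigid. A group element can permute the pieces of a
  partition, so \<open>f (g y)\<close> is attached to a list of pieces, while the Ramsey theorem
  speaks of unlabelled classes. An ordering selects one list, and the descending one is the listing
  by first occurrence that parameter words use.

  The Ramsey theorem is applied over the empty alphabet only, but its proof has to admit constants:
  past its first parameter, a word is one over a larger alphabet with fewer parameters.\<close>

text \<open>
  In \<open>param_word a k w\<close> the letters below \<open>a\<close> are constants and \<open>a, \<dots>, a + k - 1\<close> are parameters, all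
  of which occur, ordered by their first occurrence. For \<open>a = 0\<close> this is a partition of the
  positions into \<open>k\<close> classes.
\<close>

fun param_word :: "nat \<Rightarrow> nat \<Rightarrow> nat list \<Rightarrow> bool" where
  "param_word a k [] \<longleftrightarrow> k = 0"
| "param_word a k (x # w) \<longleftrightarrow>
     x < a \<and> param_word a k w \<or> x = a \<and> 0 < k \<and> param_word (Suc a) (k - 1) w"

text \<open>Substitution: the lookup table fixes the constants below \<open>a\<close> and sends the
  parameter \<open>a + i\<close> to \<open>s ! i\<close>. For \<open>a = 0\<close>, where words are
  partitions, it merges the classes of \<open>t\<close> according to \<open>s\<close>.\<close>

definition plug :: "nat \<Rightarrow> nat list \<Rightarrow> nat list \<Rightarrow> nat list" where
  "plug a s t = map ((!) ([0..<a] @ s)) t"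

lemma length_plug [simp]: "length (plug a s t) = length t"
  by (simp add: plug_def)

lemma param_word_set: "param_word a k w \<Longrightarrow> set w \<subseteq> {..<a + k}"
  by (induction a k w rule: param_word.induct) fastforce+

lemma param_word_0_iff [simp]: "param_word a 0 w \<longleftrightarrow> set w \<subseteq> {..<a}"
  by (induction w) auto

lemma param_word_append:
  "param_word a j u \<Longrightarrow> param_word (a + j) m v \<Longrightarrow> param_word a (j + m) (u @ v)"
  by (induction a j u rule: param_word.induct) auto

lemma param_word_upt: "param_word a k [a..<a + k]"
proof (induction k arbitrary: a)
  case (Suc k)
  then show ?case using Suc[of "Suc a"] by (simp add: upt_conv_Cons del: upt_Suc)
qed simp

text \<open>Once the first parameter of \<open>t\<close> has occurred, it counts as a constant for
  the rest of the word, so the induction carries a table \<open>e\<close> of constants and shifts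
  the head of \<open>s\<close> to its end. If that value is a new letter, the target alphabet
  \<open>b\<close> grows as well.\<close>

lemma param_word_map:
  "param_word a m t \<Longrightarrow> length e = a \<Longrightarrow> set e \<subseteq> {..<b} \<Longrightarrow> param_word b k s \<Longrightarrow> length s = m
    \<Longrightarrow> param_word b k (map ((!) (e @ s)) t)"
proof (induction t arbitrary: a m e b k s)
  case (Cons x t)
  show ?case
  proof (cases "x < a \<and> param_word a m t")
    case True
    then have "e ! x < b" using Cons.prems by (metis lessThan_iff nth_mem subset_iff)
    with True show ?thesis using Cons.IH[of a m e b k s] Cons.prems by (simp add: nth_append)
  next
    case False
    then have x: "x = a" "0 < m" "param_word (Suc a) (m - 1) t" using Cons.prems(1) by auto
    then obtain y s' where s: "s = y # s'" using Cons.prems by (cases s) auto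
    have e: "e @ s = (e @ [y]) @ s'" by (simp add: s)
    have y: "(e @ s) ! x = y" using x Cons.prems(2) s by (simp add: nth_append)
    consider "y < b" "param_word b k s'" | "y = b" "0 < k" "param_word (Suc b) (k - 1) s'"
      using Cons.prems(4) s by auto
    then show ?thesis
    proof cases
      case 1
      then have "param_word b k (map ((!) (e @ s)) t)"
        unfolding e using x Cons.prems s by (intro Cons.IH[of "Suc a" "m - 1"]) auto
      with 1 y show ?thesis by simp
    next
      case 2
      have "param_word (Suc b) (k - 1) (map ((!) (e @ s)) t)"
        unfolding e using x 2 Cons.prems s by (intro Cons.IH[of "Suc a" "m - 1"]) fastforce+
      with 2 y show ?thesis by simp
    qed
  qed
qed simp

lemma param_word_plug:
  "param_word a m t \<Longrightarrow> param_word a k s \<Longrightarrow> length s = m \<Longrightarrow> param_word a k (plug a s t)"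
  unfolding plug_def by (rule param_word_map) auto

lemma map_nth_map_nth:
  "set t \<subseteq> {..<length e'} \<Longrightarrow> map ((!) e) (map ((!) e') t) = map ((!) (map ((!) e) e')) t"
  by auto

lemma map_nth_append_upt [simp]: "a \<le> length e \<Longrightarrow> map ((!) (e @ s)) [0..<a] = take a e"
  by (auto intro!: nth_equalityI simp: nth_append)

lemma plug_plug:
  assumes "param_word a m u" "length t = m"
  shows "plug a s (plug a t u) = plug a (plug a s t) u"
proof -
  have "set u \<subseteq> {..<length ([0..<a] @ t)}" using param_word_set[OF assms(1)] assms(2) by simp
  then show ?thesis unfolding plug_def by (subst map_nth_map_nth) simp_all
qed

lemma plug_shift: "length s = m \<Longrightarrow> plug a (x # s) [Suc a..<Suc a + m] = s"
  by (rule nth_equalityI) (auto simp: plug_def nth_append simp del: upt_Suc)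

lemma plug_cons_shift:
  assumes "param_word a m t" "length s = m"
  shows "plug a (x # s) (plug a [Suc a..<Suc a + m] t) = plug a s t"
proof -
  have "length ([0..<a] @ [Suc a..<Suc a + m]) = a + m" by simp
  then have "set t \<subseteq> {..<length ([0..<a] @ [Suc a..<Suc a + m])}"
    using param_word_set[OF assms(1)] by (simp only:)
  then show ?thesis
    using plug_shift[OF assms(2), of a x] unfolding plug_def
    by (subst map_nth_map_nth) (simp_all del: upt_Suc)
qed

text \<open>The step from \<open>m\<close> to \<open>m + 1\<close> dimensions in the inductions
  below: the line \<open>l\<close> supplies the first parameter and the shifted \<open>t\<close> the
  others, so the two halves of the word vary independently.\<close>

lemma joined_word:
  assumes l: "param_word a 1 l" and t: "param_word a m t"
  shows "\<exists>T. length T = length l + length t \<and> param_word a (Suc m) T \<and>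
    (\<forall>x s. length s = m \<longrightarrow> plug a (x # s) T = plug a [x] l @ plug a s t)"
proof (intro exI conjI allI impI)
  let ?T = "l @ plug a [Suc a..<Suc a + m] t"
  show "length ?T = length l + length t" by simp
  have "param_word (Suc a) m (plug a [Suc a..<Suc a + m] t)"
    unfolding plug_def by (rule param_word_map[OF t _ _ param_word_upt]) auto
  then show "param_word a (Suc m) ?T" using param_word_append[OF l, of m] by simp
  fix x and s :: "nat list" assume s: "length s = m"
  have "plug a (x # s) l = plug a [x] l"
    unfolding plug_def using param_word_set[OF l]
    by (intro map_cong refl) (auto simp: nth_append less_Suc_eq)
  then show "plug a (x # s) ?T = plug a [x] l @ plug a s t"
    using plug_cons_shift[OF t s] by (simp add: plug_def del: upt_Suc)
qed

section \<open>The Graham-Rothschild theorem\<close>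

text \<open>The colours of \<open>x\<close> under all \<open>i \<in> I\<close> form one of
  \<open>r ^ card I\<close> functions, which a bijection turns into a number. One Ramsey statement
  thus serves finitely many colourings or contexts at once.\<close>

lemma joint_coloring:
  fixes c :: "'i \<Rightarrow> 'a \<Rightarrow> nat"
  assumes "finite I" "\<And>i x. c i x < r"
  shows "\<exists>d. (\<forall>x. d x < r ^ card I) \<and> (\<forall>x y. \<forall>i\<in>I. d x = d y \<longrightarrow> c i x = c i y)"
proof -
  let ?S = "I \<rightarrow>\<^sub>E {..<r}"
  have "finite ?S" using assms(1) by (simp add: finite_PiE)
  then obtain f where f: "bij_betw f ?S {0..<card ?S}" using ex_bij_betw_finite_nat by blast
  have card: "card ?S = r ^ card I" using assms(1) by (simp add: card_PiE)
  define d where "d x = f (\<lambda>i\<in>I. c i x)" for x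
  have S: "(\<lambda>i\<in>I. c i x) \<in> ?S" for x using assms(2) by auto
  have "d x \<in> {0..<card ?S}" for x
    unfolding d_def by (rule bij_betw_apply[OF f S])
  then have bound: "d x < r ^ card I" for x unfolding card by simp
  have "c i x = c i y" if "d x = d y" "i \<in> I" for x y i
    using inj_onD[OF bij_betw_imp_inj_on[OF f] _ S S] that unfolding d_def
    by (metis restrict_apply')
  with bound show ?thesis by blast
qed

definition joint_color :: "'i set \<Rightarrow> nat \<Rightarrow> ('i \<Rightarrow> 'a \<Rightarrow> nat) \<Rightarrow> 'a \<Rightarrow> nat" where
  "joint_color I r c =
     (SOME d. (\<forall>x. d x < r ^ card I) \<and> (\<forall>x y. \<forall>i\<in>I. d x = d y \<longrightarrow> c i x = c i y))"

lemma joint_color: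
  assumes "finite I" "\<And>i x. c i x < r"
  shows "(\<forall>x. joint_color I r c x < r ^ card I) \<and>
    (\<forall>x y. \<forall>i\<in>I. joint_color I r c x = joint_color I r c y \<longrightarrow> c i x = c i y)"
  unfolding joint_color_def by (rule someI_ex[OF joint_coloring[OF assms]])

lemma joint_color_less:
  assumes "finite I" "\<And>i x. c i x < r"
  shows "joint_color I r c x < r ^ card I"
  by (rule joint_color[OF assms, THEN conjunct1, rule_format])

lemma joint_color_eq:
  assumes "finite I" "\<And>i x. c i x < r" "joint_color I r c x = joint_color I r c y" "i \<in> I"
  shows "c i x = c i y"
  by (rule joint_color[OF assms(1,2), THEN conjunct2, rule_format, OF assms(4,3)])

section \<open>The Hales-Jewett theorem\<close>

lemma finite_words: "finite {w. length w = n \<and> set w \<subseteq> {..<a::nat}}"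
  using finite_lists_length_eq[of "{..<a}" n] by (simp add: conj_commute)

text \<open>Among the words \<open>(a - 1)^i a^(h - i)\<close> two must have the same colours in all contexts; the line
  through them does not distinguish the letters \<open>a\<close> and \<open>a - 1\<close> (Shelah).\<close>

lemma shelah_insensitive:
  assumes "0 < a"
  shows "\<exists>N. \<forall>c. (\<forall>w. c w < r) \<longrightarrow> (\<exists>t. length t = N \<and> param_word (Suc a) n t \<and>
    (\<forall>s. length s = n \<and> set s \<subseteq> {..a} \<longrightarrow>
      c (plug (Suc a) s t) = (c (plug (Suc a) (map (\<lambda>x. if x = a then a - 1 else x) s) t) :: nat)))"
proof (induction n arbitrary: r)
  case 0
  show ?case by (rule exI[of _ 0]) (auto intro!: exI[of _ "[]"])
next
  case (Suc n)
  let ?A = "Suc a" and ?f = "\<lambda>x. if x = a then a - 1 else x"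
  obtain N where N: "\<And>c. (\<forall>w. c w < r ^ card {..a}) \<Longrightarrow>
    (\<exists>t. length t = N \<and> param_word ?A n t \<and>
    (\<forall>s. length s = n \<and> set s \<subseteq> {..a} \<longrightarrow>
      c (plug ?A s t) = (c (plug ?A (map ?f s) t) :: nat)))"
    using Suc[of "r ^ card {..a}"] by blast
  let ?W = "{w. length w = N \<and> set w \<subseteq> {..<?A}}"
  \<comment> \<open>There is one more word \<open>w 0, ..., w h\<close> than there are colour
    patterns on the contexts \<open>?W\<close>. The length \<open>N\<close> of the contexts enters
    \<open>h\<close> and so has to be fixed before it.\<close>
  define h where "h = r ^ card ?W"
  show ?case
  proof (rule exI[of _ "h + N"], intro allI impI)
    fix c :: "nat list \<Rightarrow> nat" assume c: "\<forall>w. c w < r"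
    define w where "w i = replicate i (a - 1) @ replicate (h - i) a" for i
    define d where "d = joint_color ?W r (\<lambda>v i. c (w i @ v))"
    have d1: "d x < h" for x
      unfolding d_def h_def by (rule joint_color_less[OF finite_words[of N ?A] c[rule_format]])
    have d2: "c (w i @ v) = c (w j @ v)" if "d i = d j" "v \<in> ?W" for i j v
      using joint_color_eq[OF finite_words[of N ?A] c[rule_format] that[unfolded d_def]] .
    have "\<not> inj_on d {..h}"
    proof
      assume "inj_on d {..h}"
      then have "card {..h} \<le> card {..<h}" using d1 by (intro card_inj_on_le[of d]) auto
      then show False by simp
    qed
    then obtain i j where ij: "i < j" "j \<le> h" "d i = d j"
      unfolding inj_on_def by (metis atMost_iff linorder_neqE_nat)
    \<comment> \<open>The letter \<open>?A\<close> is the parameter: its value \<open>a\<close>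
      turns \<open>l\<close> into \<open>w i\<close>, its value \<open>a - 1\<close> turns it into
      \<open>w j\<close>.\<close>
    define l where "l = replicate i (a - 1) @ replicate (j - i) ?A @ replicate (h - j) a"
    have "param_word ?A 1 (replicate (j - i) ?A)"
      using ij(1) by (cases "j - i") auto
    then have "param_word ?A 1 (replicate (j - i) ?A @ replicate (h - j) a)"
      using param_word_append[of ?A 1 "replicate (j - i) ?A" 0 "replicate (h - j) a"]
      by (simp add: set_replicate_conv_if)
    moreover have "param_word ?A 0 (replicate i (a - 1))" by auto
    ultimately have l: "param_word ?A 1 l" "length l = h"
      using param_word_append[of ?A 0 "replicate i (a - 1)" 1
          "replicate (j - i) ?A @ replicate (h - j) a"] ij
      by (simp_all add: l_def)
    have nth0: "([0..<?A] @ [x]) ! (a - 1) = a - 1" "([0..<?A] @ [x]) ! a = a"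
      "([0..<?A] @ [x]) ! ?A = x" for x
      using assms by (auto simp: nth_append)
    have rep: "replicate (j - i) a @ replicate (h - j) a = replicate (h - i) a"
      "replicate i (a - 1) @ replicate (j - i) (a - 1) = replicate j (a - 1)"
      using ij by (simp_all add: replicate_add[symmetric])
    have la: "plug ?A [a] l = w i"
      unfolding plug_def l_def w_def map_append map_replicate nth0 rep(1) ..
    have la': "plug ?A [a - 1] l = w j"
      unfolding plug_def l_def w_def map_append map_replicate nth0 append_assoc[symmetric] rep(2) ..
    define d' where "d' = joint_color {..a} r (\<lambda>x v. c (plug ?A [x] l @ v))"
    have d'1: "d' v < r ^ card {..a}" for v
      unfolding d'_def by (rule joint_color_less[OF finite_atMost[of a] c[rule_format]])
    have d'2: "c (plug ?A [x] l @ v) = c (plug ?A [x] l @ v')" if "d' v = d' v'" "x \<in> {..a}" for v v' x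
      using joint_color_eq[OF finite_atMost[of a] c[rule_format] that[unfolded d'_def]] .
    obtain t where t: "length t = N" "param_word ?A n t"
      "\<And>s. length s = n \<Longrightarrow> set s \<subseteq> {..a} \<Longrightarrow> d' (plug ?A s t) = d' (plug ?A (map ?f s) t)"
      using N[of d'] d'1 by blast
    obtain T where T: "length T = h + N" "param_word ?A (Suc n) T"
      "\<And>x s. length s = n \<Longrightarrow> plug ?A (x # s) T = plug ?A [x] l @ plug ?A s t"
      using joined_word[OF l(1) t(2)] unfolding l(2) t(1) by blast
    have "c (plug ?A s T) = c (plug ?A (map ?f s) T)"
      if s: "length s = Suc n" "set s \<subseteq> {..a}" for s
    proof -
      obtain x s' where x: "s = x # s'" "length s' = n" "x \<le> a" "set s' \<subseteq> {..a}"
        using s by (cases s) auto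
      have W: "plug ?A (map ?f s') t \<in> ?W"
      proof -
        have "param_word ?A 0 (map ?f s')" using x(4) by (auto)
        then have "param_word ?A 0 (plug ?A (map ?f s') t)"
          by (rule param_word_plug[OF t(2)]) (use x in simp)
        then show ?thesis using t(1) by simp
      qed
      have "c (plug ?A s T) = c (plug ?A [x] l @ plug ?A s' t)" using x T(3) by simp
      also have "\<dots> = c (plug ?A [x] l @ plug ?A (map ?f s') t)"
        using x by (intro d'2 t(3)) auto
      also have "\<dots> = c (plug ?A [?f x] l @ plug ?A (map ?f s') t)"
        using d2[OF ij(3) W] by (cases "x = a") (simp_all only: la la' if_True if_False simp_thms)
      also have "\<dots> = c (plug ?A (map ?f s) T)" using x T(3) by simp
      finally show ?thesis .
    qed
    then show "\<exists>t. length t = h + N \<and> param_word ?A (Suc n) t \<and>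
      (\<forall>s. length s = Suc n \<and> set s \<subseteq> {..a} \<longrightarrow> c (plug ?A s t) = c (plug ?A (map ?f s) t))"
      using T by blast
  qed
qed

text \<open>With one more letter \<open>a\<close>, \<open>shelah_insensitive\<close> passes to a
  subspace in which \<open>a\<close> and \<open>a - 1\<close> are interchangeable; a line that works
  there for the letters below \<open>a\<close> then also works for \<open>a\<close>.\<close>

lemma hales_jewett:
  "\<exists>h. \<forall>c. (\<forall>w. c w < r) \<longrightarrow> (\<exists>l. length l = h \<and> param_word a 1 l \<and>
    (\<forall>x<a. \<forall>y<a. c (plug a [x] l) = (c (plug a [y] l) :: nat)))"
proof (induction a)
  case 0
  show ?case by (rule exI[of _ 1]) (auto intro!: exI[of _ "[0]"])
next
  case (Suc a)
  show ?case
  proof (cases "a = 0")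
    case True
    then show ?thesis by (intro exI[of _ 1]) (auto intro!: exI[of _ "[1]"])
  next
    case False
    let ?A = "Suc a" and ?f = "\<lambda>x. if x = a then a - 1 else x"
    obtain h where h: "\<And>c. (\<forall>w. c w < r) \<Longrightarrow> (\<exists>l. length l = h \<and> param_word a 1 l \<and>
      (\<forall>x<a. \<forall>y<a. c (plug a [x] l) = (c (plug a [y] l) :: nat)))"
      using Suc by blast
    obtain N where N: "\<And>c. (\<forall>w. c w < r) \<Longrightarrow>
      (\<exists>t. length t = N \<and> param_word ?A h t \<and>
      (\<forall>s. length s = h \<and> set s \<subseteq> {..a} \<longrightarrow>
        c (plug ?A s t) = (c (plug ?A (map ?f s) t) :: nat)))"
      using shelah_insensitive[of a r h] False by blast
    show ?thesis
    proof (rule exI[of _ N], intro allI impI)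
      fix c :: "nat list \<Rightarrow> nat" assume c: "\<forall>w. c w < r"
      obtain t where t: "length t = N" "param_word ?A h t"
        "\<And>s. length s = h \<Longrightarrow> set s \<subseteq> {..a} \<Longrightarrow> c (plug ?A s t) = c (plug ?A (map ?f s) t)"
        using N[OF c] by blast
      obtain l where l: "length l = h" "param_word a 1 l"
        "\<And>x y. x < a \<Longrightarrow> y < a \<Longrightarrow> c (plug ?A (plug a [x] l) t) = c (plug ?A (plug a [y] l) t)"
        using h[of "\<lambda>w. c (plug ?A w t)"] c by blast
      \<comment> \<open>In \<open>l\<close> the letter \<open>a\<close> is the parameter, but over
        the larger alphabet it is a constant, so the parameter is renamed to
        \<open>?A\<close>.\<close>
      define l' where "l' = map (\<lambda>x. if x = a then ?A else x) l"
      have l_set: "set l \<subseteq> {..a}" using param_word_set[OF l(2)] by auto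
      have l': "param_word ?A 1 l'"
      proof -
        have eq: "l' = map ((!) ([0..<a] @ [?A])) l"
          unfolding l'_def using l_set by (fastforce simp: nth_append)
        show ?thesis unfolding eq
          by (rule param_word_map[OF l(2)]) (auto)
      qed
      have plug_l': "plug ?A [x] l' = map (\<lambda>z. if z = a then x else z) l" for x
        unfolding l'_def plug_def using l_set by (fastforce simp: nth_append)
      have plug_l: "plug a [x] l = map (\<lambda>z. if z = a then x else z) l" for x
        unfolding plug_def using l_set by (fastforce simp: nth_append)
      have eq: "c (plug ?A [x] (plug ?A l' t)) = c (plug ?A (plug a [?f x] l) t)" if "x < ?A" for x
      proof -
        have "map ?f (map (\<lambda>z. if z = a then x else z) l) = map (\<lambda>z. if z = a then ?f x else z) l"
          by auto
        moreover have "set (map (\<lambda>z. if z = a then x else z) l) \<subseteq> {..a}"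
          using l_set that by auto
        moreover have "plug ?A [x] (plug ?A l' t) = plug ?A (plug ?A [x] l') t"
          using plug_plug[OF t(2)] l(1) by (simp add: l'_def)
        ultimately show ?thesis using t(3)[of "map (\<lambda>z. if z = a then x else z) l"] l(1)
          by (simp only: plug_l plug_l' length_map)
      qed
      have "c (plug ?A [x] (plug ?A l' t)) = c (plug ?A [y] (plug ?A l' t))" if "x < ?A" "y < ?A" for x y
        unfolding eq[OF that(1)] eq[OF that(2)] by (rule l(3)) (use that False in auto)
      moreover have "param_word ?A 1 (plug ?A l' t)"
        by (rule param_word_plug[OF t(2) l']) (simp add: l'_def l(1))
      moreover have "length (plug ?A l' t) = N" using t(1) by simp
      ultimately show "\<exists>l. length l = N \<and> param_word ?A 1 l \<and>
        (\<forall>x<?A. \<forall>y<?A. c (plug ?A [x] l) = c (plug ?A [y] l))"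
        by blast
    qed
  qed
qed

section \<open>Induction on the number of parameters\<close>

text \<open>The Graham-Rothschild statement for \<open>k\<close>-parameter subwords of an
  \<open>m\<close>-parameter word. For \<open>k = 0\<close> it is the multidimensional Hales-Jewett
  theorem, for \<open>a = 0\<close> the finite dual Ramsey theorem on partitions.\<close>

definition ramsey_for :: "nat \<Rightarrow> nat \<Rightarrow> nat \<Rightarrow> nat \<Rightarrow> bool" where
  "ramsey_for a k m r \<longleftrightarrow> (\<exists>n. \<forall>c. (\<forall>w. c w < r) \<longrightarrow> (\<exists>t. length t = n \<and> param_word a m t \<and>
    (\<forall>s s'. length s = m \<and> length s' = m \<and> param_word a k s \<and> param_word a k s' \<longrightarrow>
      c (plug a s t) = (c (plug a s' t) :: nat))))"

text \<open>One Hales-Jewett line is put in front for each dimension. On the line \<open>l\<close>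
  the first letter does not affect the colour in any context of length \<open>n\<close>, so
  \<open>t\<close> need only be chosen with that letter equal to 0, and two words are compared
  through 0.\<close>

lemma ramsey_for_0: "ramsey_for a 0 m r"
proof (induction m)
  case 0
  show ?case unfolding ramsey_for_def by (rule exI[of _ 0]) (auto intro!: exI[of _ "[]"])
next
  case (Suc m)
  obtain n where n: "\<And>c. (\<forall>w. c w < r) \<Longrightarrow> (\<exists>t. length t = n \<and> param_word a m t \<and>
    (\<forall>s s'. length s = m \<and> length s' = m \<and> param_word a 0 s \<and> param_word a 0 s' \<longrightarrow>
      c (plug a s t) = (c (plug a s' t) :: nat)))"
    using Suc unfolding ramsey_for_def by blast
  let ?W = "{w. length w = n \<and> set w \<subseteq> {..<a}}"
  obtain h where h: "\<And>c. (\<forall>w. c w < r ^ card ?W) \<Longrightarrow> (\<exists>l. length l = h \<and> param_word a 1 l \<and>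
    (\<forall>x<a. \<forall>y<a. c (plug a [x] l) = (c (plug a [y] l) :: nat)))"
    using hales_jewett[of "r ^ card ?W" a] by blast
  show ?case unfolding ramsey_for_def
  proof (rule exI[of _ "h + n"], intro allI impI)
    fix c :: "nat list \<Rightarrow> nat" assume c: "\<forall>w. c w < r"
    define d where "d = joint_color ?W r (\<lambda>w v. c (v @ w))"
    have d1: "d v < r ^ card ?W" for v
      unfolding d_def by (rule joint_color_less[OF finite_words[of n a] c[rule_format]])
    have d2: "c (v @ w) = c (v' @ w)" if "d v = d v'" "w \<in> ?W" for v v' w
      using joint_color_eq[OF finite_words[of n a] c[rule_format] that[unfolded d_def]] .
    obtain l where l: "length l = h" "param_word a 1 l"
      "\<And>x y. x < a \<Longrightarrow> y < a \<Longrightarrow> d (plug a [x] l) = d (plug a [y] l)"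
      using h[of d] d1 by blast
    obtain t where t: "length t = n" "param_word a m t"
      "\<And>s s'. length s = m \<Longrightarrow> length s' = m \<Longrightarrow> param_word a 0 s \<Longrightarrow> param_word a 0 s' \<Longrightarrow>
        c (plug a [0] l @ plug a s t) = c (plug a [0] l @ plug a s' t)"
      using n[of "\<lambda>w. c (plug a [0] l @ w)"] c by blast
    obtain T where T: "length T = h + n" "param_word a (Suc m) T"
      "\<And>x s. length s = m \<Longrightarrow> plug a (x # s) T = plug a [x] l @ plug a s t"
      using joined_word[OF l(2) t(2)] unfolding l(1) t(1) by blast
    have "c (plug a s T) = c (plug a s' T)"
      if s: "length s = Suc m" "length s' = Suc m" "param_word a 0 s" "param_word a 0 s'" for s s'
    proof -
      obtain x s1 x' s1' where x: "s = x # s1" "s' = x' # s1'" "x < a" "x' < a"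
        "length s1 = m" "length s1' = m" "param_word a 0 s1" "param_word a 0 s1'"
        using s by (cases s; cases s') auto
      have W: "plug a s1 t \<in> ?W" "plug a s1' t \<in> ?W"
        using param_word_plug[OF t(2), of 0 s1] param_word_plug[OF t(2), of 0 s1'] x t(1) by auto
      have "c (plug a [x] l @ plug a s1 t) = c (plug a [0] l @ plug a s1 t)"
        using x by (intro d2[OF l(3) W(1)]) auto
      also have "\<dots> = c (plug a [0] l @ plug a s1' t)" using x by (intro t(3))
      also have "\<dots> = c (plug a [x'] l @ plug a s1' t)"
        using x by (intro d2[OF l(3) W(2)]) auto
      finally show ?thesis using x T(3) by simp
    qed
    then show "\<exists>t. length t = h + n \<and> param_word a (Suc m) t \<and>
      (\<forall>s s'. length s = Suc m \<and> length s' = Suc m \<and> param_word a 0 s \<and> param_word a 0 s' \<longrightarrow>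
        c (plug a s t) = c (plug a s' t))"
      using T by blast
  qed
qed

text \<open>After its first parameter a word continues over an alphabet with one more letter, so the
  colour can be made to depend only on the constants before the first parameter.\<close>

lemma ramsey_for_prefix:
  assumes IH: "\<And>m r. ramsey_for (Suc a) k m r"
  shows "\<exists>n. \<forall>c. (\<forall>w. c w < r) \<longrightarrow> (\<exists>t. length t = n \<and> param_word a m t \<and>
    (\<forall>s s'. length s = m \<and> length s' = m \<and> param_word a (Suc k) s \<and> param_word a (Suc k) s' \<and>
      takeWhile (\<lambda>x. x < a) s = takeWhile (\<lambda>x. x < a) s' \<longrightarrow>
      c (plug a s t) = (c (plug a s' t) :: nat)))"
proof (induction m arbitrary: r)
  case 0
  show ?case by (rule exI[of _ 0]) (auto intro!: exI[of _ "[]"])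
next
  case (Suc m)
  obtain m' where m': "\<And>c. (\<forall>w. c w < r ^ card {..<a}) \<Longrightarrow>
    (\<exists>t. length t = m' \<and> param_word a m t \<and>
    (\<forall>s s'. length s = m \<and> length s' = m \<and> param_word a (Suc k) s \<and> param_word a (Suc k) s' \<and>
      takeWhile (\<lambda>x. x < a) s = takeWhile (\<lambda>x. x < a) s' \<longrightarrow>
      c (plug a s t) = (c (plug a s' t) :: nat)))"
    using Suc[of "r ^ card {..<a}"] by blast
  obtain n where n: "\<And>c. (\<forall>w. c w < r) \<Longrightarrow> (\<exists>t. length t = n \<and> param_word (Suc a) m' t \<and>
    (\<forall>s s'. length s = m' \<and> length s' = m' \<and> param_word (Suc a) k s \<and> param_word (Suc a) k s' \<longrightarrow>
      c (plug (Suc a) s t) = (c (plug (Suc a) s' t) :: nat)))"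
    using IH[of m' r] unfolding ramsey_for_def by blast
  show ?case
  proof (rule exI[of _ "Suc n"], intro allI impI)
    fix c :: "nat list \<Rightarrow> nat" assume c: "\<forall>w. c w < r"
    obtain u where u: "length u = n" "param_word (Suc a) m' u"
      "\<And>s s'. length s = m' \<Longrightarrow> length s' = m' \<Longrightarrow> param_word (Suc a) k s \<Longrightarrow>
        param_word (Suc a) k s' \<Longrightarrow> c (a # plug (Suc a) s u) = c (a # plug (Suc a) s' u)"
      using n[of "\<lambda>w. c (a # w)"] c by blast
    \<comment> \<open>\<open>g x z\<close> will be the result of plugging \<open>x # s\<close> into
      \<open>T\<close>, with \<open>z = plug a s t\<close>. For \<open>x = a\<close> the first
      parameter stands in front and the choice of \<open>u\<close> settles the colour; for
      \<open>x < a\<close> the colouring \<open>d\<close> hands the rest to the induction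
      hypothesis.\<close>
    define g where "g x z = x # map ((!) ([0..<a] @ x # z)) u" for x z
    define d where "d = joint_color {..<a} r (\<lambda>x v. c (g x v))"
    have d1: "d v < r ^ card {..<a}" for v
      unfolding d_def by (rule joint_color_less[OF finite_lessThan[of a] c[rule_format]])
    have d2: "c (g x v) = c (g x v')" if "d v = d v'" "x \<in> {..<a}" for v v' x
      using joint_color_eq[OF finite_lessThan[of a] c[rule_format] that[unfolded d_def]] .
    obtain t where t: "length t = m'" "param_word a m t"
      "\<And>s s'. length s = m \<Longrightarrow> length s' = m \<Longrightarrow> param_word a (Suc k) s \<Longrightarrow> param_word a (Suc k) s' \<Longrightarrow>
        takeWhile (\<lambda>x. x < a) s = takeWhile (\<lambda>x. x < a) s' \<Longrightarrow>
        d (plug a s t) = d (plug a s' t)"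
      using m'[of d] d1 by blast
    define t1 where "t1 = plug a [Suc a..<Suc a + m] t"
    have t1: "param_word (Suc a) m t1" "length t1 = m'"
      unfolding t1_def plug_def length_map
      by (rule param_word_map[OF t(2) _ _ param_word_upt]) (auto simp: t(1))
    define T where "T = a # plug (Suc a) t1 u"
    have T: "param_word a (Suc m) T" "length T = Suc n"
      using param_word_plug[OF u(2) t1] u(1) by (simp_all add: T_def)
    have eval: "plug a (x # s) T = g x (plug a s t)" if "length s = m" for x s
    proof -
      have "set u \<subseteq> {..<length ([0..<Suc a] @ t1)}"
        using param_word_set[OF u(2)] t1(2) by simp
      then have "map ((!) ([0..<a] @ x # s)) (map ((!) ([0..<Suc a] @ t1)) u)
          = map ((!) (map ((!) ([0..<a] @ x # s)) ([0..<Suc a] @ t1))) u"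
        by (rule map_nth_map_nth)
      also have "map ((!) ([0..<a] @ x # s)) ([0..<Suc a] @ t1) = [0..<a] @ x # plug a s t"
        using plug_cons_shift[OF t(2) that, of x]
        by (simp add: t1_def plug_def del: upt_Suc) (simp add: nth_append)
      finally show ?thesis by (simp add: T_def g_def plug_def nth_append del: upt_Suc)
    qed
    have "c (plug a s T) = c (plug a s' T)"
      if s: "length s = Suc m" "length s' = Suc m" "param_word a (Suc k) s" "param_word a (Suc k) s'"
        "takeWhile (\<lambda>x. x < a) s = takeWhile (\<lambda>x. x < a) s'" for s s'
    proof -
      obtain x v x' v' where x: "s = x # v" "s' = x' # v'" "length v = m" "length v' = m"
        using s(1,2) by (cases s; cases s') auto
      show ?thesis
      proof (cases "x < a")
        case True
        then have x': "x' = x" "takeWhile (\<lambda>x. x < a) v = takeWhile (\<lambda>x. x < a) v'"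
          using s(5) x by (auto split: if_splits)
        have "param_word a (Suc k) v" "param_word a (Suc k) v'" using s x x' True by auto
        then show ?thesis using x x' True by (auto simp: eval intro!: d2 t(3))
      next
        case False
        then have "\<not> x' < a" using s(5) x by (auto split: if_splits)
        with False have x': "x = a" "x' = a" "param_word (Suc a) k v" "param_word (Suc a) k v'"
          using s x by auto
        have pw: "param_word (Suc a) k (plug a z t)" if "param_word (Suc a) k z" "length z = m" for z
          unfolding plug_def by (rule param_word_map[OF t(2) _ _ that]) auto
        have "g a z = a # plug (Suc a) z u" for z by (simp add: g_def plug_def)
        then show ?thesis
          using x x' t(1) by (auto simp: eval intro!: u(3) pw)
      qed
    qed
    then show "\<exists>t. length t = Suc n \<and> param_word a (Suc m) t \<and>
      (\<forall>s s'. length s = Suc m \<and> length s' = Suc m \<and> param_word a (Suc k) s \<and>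
        param_word a (Suc k) s' \<and> takeWhile (\<lambda>x. x < a) s = takeWhile (\<lambda>x. x < a) s' \<longrightarrow>
        c (plug a s t) = c (plug a s' t))"
      using T by blast
  qed
qed

definition prefix_len :: "nat \<Rightarrow> nat list \<Rightarrow> nat" where
  "prefix_len b w = length (takeWhile (\<lambda>x. x < b) w)"

text \<open>The parameter of \<open>l\<close> is certain to occur, and a value not below
  \<open>a\<close> ends the constant prefix inside \<open>l\<close>, so neither this value nor the
  continuation can be seen.\<close>

lemma takeWhile_plug_param:
  assumes "param_word a (Suc k) l" "a \<le> x" "a \<le> y"
  shows "takeWhile (\<lambda>x. x < a) (plug a [x] l @ u) = takeWhile (\<lambda>x. x < a) (plug a [y] l @ v)"
proof -
  have "takeWhile (\<lambda>x. x < a) (plug a [x] l @ u) = takeWhile (\<lambda>x. x < a) l" if "a \<le> x" for x u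
    using assms(1)
  proof (induction l)
    case (Cons z l)
    then show ?case using that by (auto simp: plug_def nth_append)
  qed simp
  with assms show ?thesis by simp
qed

text \<open>The scheme of \<open>ramsey_for_0\<close> for colourings of constant prefixes: as long
  as the prefix lasts, each of its letters can be replaced by 0 along a line. It may end anywhere in
  the later part, so the contexts are words of every length up to \<open>n\<close>.\<close>

lemma prefix_insensitive:
  "\<exists>n. \<forall>d. (\<forall>w. d w < r) \<longrightarrow> (\<exists>t. length t = n \<and> param_word a m t \<and>
    (\<forall>s s'. length s = m \<and> length s' = m \<and> prefix_len a s = prefix_len a s' \<and> prefix_len a s < m \<longrightarrow>
      d (takeWhile (\<lambda>x. x < a) (plug a s t)) = (d (takeWhile (\<lambda>x. x < a) (plug a s' t)) :: nat)))"
proof (induction m)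
  case 0
  show ?case by (rule exI[of _ 0]) (auto intro!: exI[of _ "[]"])
next
  case (Suc m)
  let ?tw = "takeWhile (\<lambda>x. x < a)"
  obtain n where n: "\<And>d. (\<forall>w. d w < r) \<Longrightarrow> (\<exists>t. length t = n \<and> param_word a m t \<and>
    (\<forall>s s'. length s = m \<and> length s' = m \<and> prefix_len a s = prefix_len a s' \<and> prefix_len a s < m \<longrightarrow>
      d (?tw (plug a s t)) = (d (?tw (plug a s' t)) :: nat)))"
    using Suc by blast
  let ?W = "{w. set w \<subseteq> {..<a} \<and> length w \<le> n}"
  have fin: "finite ?W" by (rule finite_lists_length_le) simp
  obtain h where h: "\<And>c. (\<forall>w. c w < r ^ card ?W) \<Longrightarrow> (\<exists>l. length l = h \<and> param_word a 1 l \<and>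
    (\<forall>x<a. \<forall>y<a. c (plug a [x] l) = (c (plug a [y] l) :: nat)))"
    using hales_jewett[of "r ^ card ?W" a] by blast
  show ?case
  proof (rule exI[of _ "h + n"], intro allI impI)
    fix d :: "nat list \<Rightarrow> nat" assume d: "\<forall>w. d w < r"
    define c where "c = joint_color ?W r (\<lambda>w v. d (v @ w))"
    have c1: "c v < r ^ card ?W" for v
      unfolding c_def by (rule joint_color_less[OF fin d[rule_format]])
    have c2: "d (v @ w) = d (v' @ w)" if "c v = c v'" "w \<in> ?W" for v v' w
      using joint_color_eq[OF fin d[rule_format] that[unfolded c_def]] .
    obtain l where l: "length l = h" "param_word a 1 l"
      "\<And>x y. x < a \<Longrightarrow> y < a \<Longrightarrow> c (plug a [x] l) = c (plug a [y] l)"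
      using h[of c] c1 by blast
    obtain t where t: "length t = n" "param_word a m t"
      "\<And>s s'. length s = m \<Longrightarrow> length s' = m \<Longrightarrow> prefix_len a s = prefix_len a s' \<Longrightarrow>
        prefix_len a s < m \<Longrightarrow>
        d (plug a [0] l @ ?tw (plug a s t)) = d (plug a [0] l @ ?tw (plug a s' t))"
      using n[of "\<lambda>w. d (plug a [0] l @ w)"] d by blast
    obtain T where T: "length T = h + n" "param_word a (Suc m) T"
      "\<And>x s. length s = m \<Longrightarrow> plug a (x # s) T = plug a [x] l @ plug a s t"
      using joined_word[OF l(2) t(2)] unfolding l(1) t(1) by blast
    have "d (?tw (plug a s T)) = d (?tw (plug a s' T))"
      if s: "length s = Suc m" "length s' = Suc m" "prefix_len a s = prefix_len a s'"
        "prefix_len a s < Suc m" for s s'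
    proof -
      obtain x v x' v' where x: "s = x # v" "s' = x' # v'" "length v = m" "length v' = m"
        using s(1,2) by (cases s; cases s') auto
      show ?thesis
      proof (cases "x < a")
        case True
        then have x': "x' < a" "prefix_len a v = prefix_len a v'" "prefix_len a v < m"
          using s x by (auto simp: prefix_len_def split: if_splits)
        have tw: "?tw (plug a [y] l @ z) = plug a [y] l @ ?tw z" if "y < a" for y z
        proof -
          have "param_word a 0 (plug a [y] l)" using that by (intro param_word_plug[OF l(2)]) auto
          then show ?thesis by (intro takeWhile_append2) auto
        qed
        have W: "?tw (plug a z t) \<in> ?W" for z
          using t(1) length_takeWhile_le[of "\<lambda>x. x < a" "plug a z t"] by (auto dest: set_takeWhileD)
        have "d (plug a [x] l @ ?tw (plug a v t)) = d (plug a [0] l @ ?tw (plug a v t))"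
          using True by (intro c2[OF l(3) W]) auto
        also have "\<dots> = d (plug a [0] l @ ?tw (plug a v' t))" using x x' by (intro t(3)) auto
        also have "\<dots> = d (plug a [x'] l @ ?tw (plug a v' t))"
          using x' by (intro c2[OF l(3) W]) auto
        finally show ?thesis using x x' True by (simp add: T(3) tw)
      next
        case False
        then have "\<not> x' < a" using s x by (auto simp: prefix_len_def split: if_splits)
        with False show ?thesis
          using takeWhile_plug_param[of a 0 l x x' "plug a v t" "plug a v' t"] l(2) x
          by (simp add: T(3))
      qed
    qed
    then show "\<exists>t. length t = h + n \<and> param_word a (Suc m) t \<and>
      (\<forall>s s'. length s = Suc m \<and> length s' = Suc m \<and> prefix_len a s = prefix_len a s' \<and>
        prefix_len a s < Suc m \<longrightarrow> d (?tw (plug a s t)) = d (?tw (plug a s' t)))"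
      using T by blast
  qed
qed

lemma param_word_has_param: "param_word a (Suc k) w \<Longrightarrow> a \<in> set w"
  by (induction w) auto

lemma prefix_len_less:
  assumes "param_word a (Suc k) w"
  shows "prefix_len a w < length w"
proof (rule ccontr)
  assume "\<not> ?thesis"
  then have "takeWhile (\<lambda>x. x < a) w = w"
    unfolding prefix_len_def by (metis not_less take_all_iff takeWhile_eq_take)
  then show False using param_word_has_param[OF assms] by (metis less_irrefl set_takeWhileD)
qed

text \<open>Two reductions composed: inside \<open>t\<close> the colour is a function
  \<open>d\<close> of the constant prefix, and inside the subword given by \<open>u\<close> this
  function sees only the length of the prefix.\<close>

lemma ramsey_for_position:
  assumes IH: "\<And>m r. ramsey_for (Suc a) k m r"
  shows "\<exists>n. \<forall>c. (\<forall>w. c w < r) \<longrightarrow> (\<exists>t. length t = n \<and> param_word a m t \<and>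
    (\<forall>s s'. length s = m \<and> length s' = m \<and> param_word a (Suc k) s \<and> param_word a (Suc k) s' \<and>
      prefix_len a s = prefix_len a s' \<longrightarrow> c (plug a s t) = (c (plug a s' t) :: nat)))"
proof -
  let ?tw = "takeWhile (\<lambda>x. x < a)"
  obtain m' where m': "\<And>d. (\<forall>w. d w < r) \<Longrightarrow> (\<exists>t. length t = m' \<and> param_word a m t \<and>
    (\<forall>s s'. length s = m \<and> length s' = m \<and> prefix_len a s = prefix_len a s' \<and> prefix_len a s < m \<longrightarrow>
      d (?tw (plug a s t)) = (d (?tw (plug a s' t)) :: nat)))"
    using prefix_insensitive[of r a m] by blast
  obtain n where n: "\<And>c. (\<forall>w. c w < r) \<Longrightarrow> (\<exists>t. length t = n \<and> param_word a m' t \<and>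
    (\<forall>s s'. length s = m' \<and> length s' = m' \<and> param_word a (Suc k) s \<and> param_word a (Suc k) s' \<and>
      ?tw s = ?tw s' \<longrightarrow> c (plug a s t) = (c (plug a s' t) :: nat)))"
    using ramsey_for_prefix[OF IH, of r m'] by blast
  show ?thesis
  proof (rule exI[of _ n], intro allI impI)
    fix c :: "nat list \<Rightarrow> nat" assume c: "\<forall>w. c w < r"
    obtain t where t: "length t = n" "param_word a m' t"
      "\<And>s s'. length s = m' \<Longrightarrow> length s' = m' \<Longrightarrow> param_word a (Suc k) s \<Longrightarrow>
        param_word a (Suc k) s' \<Longrightarrow> ?tw s = ?tw s' \<Longrightarrow> c (plug a s t) = c (plug a s' t)"
      using n[OF c] by blast
    \<comment> \<open>By the choice of \<open>t\<close> any representative will do. If no word has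
      the prefix \<open>w\<close>, the value is arbitrary but still below \<open>r\<close>.\<close>
    define d where
      "d w = c (plug a (SOME s. length s = m' \<and> param_word a (Suc k) s \<and> ?tw s = w) t)" for w
    have d: "d (?tw s) = c (plug a s t)" if "length s = m'" "param_word a (Suc k) s" for s
      unfolding d_def
      by (rule someI2[of "\<lambda>s'. length s' = m' \<and> param_word a (Suc k) s' \<and> ?tw s' = ?tw s" s])
        (use that in \<open>auto intro: t(3)\<close>)
    have d_less: "\<forall>w. d w < r" using c by (simp add: d_def)
    obtain u where u: "length u = m'" "param_word a m u"
      "\<And>s s'. length s = m \<Longrightarrow> length s' = m \<Longrightarrow> prefix_len a s = prefix_len a s' \<Longrightarrow>
        prefix_len a s < m \<Longrightarrow> d (?tw (plug a s u)) = d (?tw (plug a s' u))"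
      using m'[of d] d_less by blast
    have "c (plug a s (plug a u t)) = c (plug a s' (plug a u t))"
      if s: "length s = m" "length s' = m" "param_word a (Suc k) s" "param_word a (Suc k) s'"
        "prefix_len a s = prefix_len a s'" for s s'
    proof -
      have eq: "c (plug a z (plug a u t)) = d (?tw (plug a z u))"
        if "length z = m" "param_word a (Suc k) z" for z
        using d[of "plug a z u"] param_word_plug[OF u(2) that(2,1)] u(1)
        by (simp add: plug_plug[OF t(2)])
      have "d (?tw (plug a s u)) = d (?tw (plug a s' u))"
        using s prefix_len_less[OF s(3)] by (intro u(3)) auto
      then show ?thesis using s by (simp add: eq)
    qed
    then show "\<exists>t. length t = n \<and> param_word a m t \<and>
      (\<forall>s s'. length s = m \<and> length s' = m \<and> param_word a (Suc k) s \<and> param_word a (Suc k) s' \<and>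
        prefix_len a s = prefix_len a s' \<longrightarrow> c (plug a s t) = c (plug a s' t))"
      using param_word_plug[OF t(2) u(2,1)] t(1) by (intro exI[of _ "plug a u t"]) simp
  qed
qed

text \<open>New parameters are introduced exactly at the positions marked in \<open>bs\<close>;
  every other position carries the constant 0, available because of \<open>0 < a\<close>. After any
  substitution the first letter not below \<open>b\<close> can only stand at a marked position. The
  table \<open>e\<close> absorbs the parameters already passed, all with values below
  \<open>b\<close>.\<close>

lemma word_with_positions:
  "0 < a \<Longrightarrow> \<exists>t. length t = length bs \<and> param_word a (length (filter id bs)) t \<and>
    (\<forall>e s b. length e = a \<and> set e \<subseteq> {..<b} \<and> length s = length (filter id bs) \<and> (\<exists>y\<in>set s. b \<le> y) \<longrightarrow>
      prefix_len b (map ((!) (e @ s)) t) < length bs \<and> bs ! prefix_len b (map ((!) (e @ s)) t))"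
proof (induction bs arbitrary: a)
  case (Cons v bs)
  show ?case
  proof (cases v)
    case True
    obtain t where t: "length t = length bs" "param_word (Suc a) (length (filter id bs)) t"
      "\<And>e s b. length e = Suc a \<Longrightarrow> set e \<subseteq> {..<b} \<Longrightarrow> length s = length (filter id bs) \<Longrightarrow>
        \<exists>y\<in>set s. b \<le> y \<Longrightarrow>
        prefix_len b (map ((!) (e @ s)) t) < length bs \<and> bs ! prefix_len b (map ((!) (e @ s)) t)"
      using Cons.IH[of "Suc a"] by blast
    have "prefix_len b (map ((!) (e @ s)) (a # t)) < length (v # bs) \<and>
        (v # bs) ! prefix_len b (map ((!) (e @ s)) (a # t))"
      if e: "length e = a" "set e \<subseteq> {..<b}" "length s = length (filter id (v # bs))"
        "\<exists>y\<in>set s. b \<le> y" for e s b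
    proof -
      obtain y s' where s: "s = y # s'" using e(3) True by (cases s) auto
      show ?thesis
      proof (cases "y < b")
        case yb: True
        have "prefix_len b (map ((!) ((e @ [y]) @ s')) t) < length bs \<and>
            bs ! prefix_len b (map ((!) ((e @ [y]) @ s')) t)"
          using e s yb True by (intro t(3)) auto
        then show ?thesis using yb e(1) by (simp add: s prefix_len_def nth_append)
      next
        case False
        then show ?thesis using True e(1) by (simp add: s prefix_len_def nth_append)
      qed
    qed
    moreover have "length (a # t) = length (v # bs)"
      "param_word a (length (filter id (v # bs))) (a # t)"
      using t True by simp_all
    ultimately show ?thesis by blast
  next
    case False
    obtain t where t: "length t = length bs" "param_word a (length (filter id bs)) t"
      "\<And>e s b. length e = a \<Longrightarrow> set e \<subseteq> {..<b} \<Longrightarrow> length s = length (filter id bs) \<Longrightarrow>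
        \<exists>y\<in>set s. b \<le> y \<Longrightarrow>
        prefix_len b (map ((!) (e @ s)) t) < length bs \<and> bs ! prefix_len b (map ((!) (e @ s)) t)"
      using Cons.IH[OF Cons.prems] by blast
    have "prefix_len b (map ((!) (e @ s)) (0 # t)) < length (v # bs) \<and>
        (v # bs) ! prefix_len b (map ((!) (e @ s)) (0 # t))"
      if e: "length e = a" "set e \<subseteq> {..<b}" "length s = length (filter id (v # bs))"
        "\<exists>y\<in>set s. b \<le> y" for e s b
    proof -
      have "0 < length e" using e(1) Cons.prems by simp
      then have "(e @ s) ! 0 \<in> set e" by (simp add: nth_append)
      then have "(e @ s) ! 0 < b" using e(2) by auto
      then have "prefix_len b (map ((!) (e @ s)) (0 # t)) = Suc (prefix_len b (map ((!) (e @ s)) t))"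
        by (simp add: prefix_len_def)
      then show ?thesis using t(3)[of e b s] e False by simp
    qed
    moreover have "length (0 # t) = length (v # bs)"
      "param_word a (length (filter id (v # bs))) (0 # t)"
      using t False Cons.prems by simp_all
    ultimately show ?thesis by blast
  qed
qed simp

text \<open>Only the position of the first parameter still matters. Pigeonhole finds
  \<open>m\<close> positions of one colour, and \<open>word_with_positions\<close> confines the
  first parameter to them. If \<open>a = 0\<close>, there are no constants and the position is
  always 0.\<close>

lemma ramsey_for_Suc:
  assumes IH: "\<And>m r. ramsey_for (Suc a) k m r"
  shows "ramsey_for a (Suc k) m r"
proof (cases "a = 0")
  case True
  have p: "prefix_len 0 s = 0" for s by (cases s) (simp_all add: prefix_len_def)
  show ?thesis
    using ramsey_for_position[OF IH, of r m] unfolding ramsey_for_def True p by (simp only: simp_thms)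
next
  case False
  \<comment> \<open>Among \<open>r * m + 1\<close> positions in \<open>r\<close> colours, some
    colour occurs at least \<open>m\<close> times.\<close>
  define M where "M = Suc (r * m)"
  obtain n where n: "\<And>c. (\<forall>w. c w < r) \<Longrightarrow> (\<exists>t. length t = n \<and> param_word a M t \<and>
    (\<forall>s s'. length s = M \<and> length s' = M \<and> param_word a (Suc k) s \<and> param_word a (Suc k) s' \<and>
      prefix_len a s = prefix_len a s' \<longrightarrow> c (plug a s t) = (c (plug a s' t) :: nat)))"
    using ramsey_for_position[OF IH, of r M] by blast
  show ?thesis unfolding ramsey_for_def
  proof (rule exI[of _ n], intro allI impI)
    fix c :: "nat list \<Rightarrow> nat" assume c: "\<forall>w. c w < r"
    obtain t where t: "length t = n" "param_word a M t"
      "\<And>s s'. length s = M \<Longrightarrow> length s' = M \<Longrightarrow> param_word a (Suc k) s \<Longrightarrow>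
        param_word a (Suc k) s' \<Longrightarrow> prefix_len a s = prefix_len a s' \<Longrightarrow>
        c (plug a s t) = c (plug a s' t)"
      using n[OF c] by blast
    define d where
      "d p = c (plug a (SOME s. length s = M \<and> param_word a (Suc k) s \<and> prefix_len a s = p) t)" for p
    have d: "d (prefix_len a s) = c (plug a s t)" if "length s = M" "param_word a (Suc k) s" for s
      unfolding d_def
      by (rule someI2[of "\<lambda>s'. length s' = M \<and> param_word a (Suc k) s' \<and> prefix_len a s' = prefix_len a s" s])
        (use that in \<open>auto intro: t(3)\<close>)
    have "\<exists>q<r. m \<le> card {p \<in> {..<M}. d p = q}"
    proof (rule ccontr)
      assume "\<not> ?thesis"
      then have *: "card {p \<in> {..<M}. d p = q} \<le> m" if "q < r" for q
        using that by (meson linorder_le_cases)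
      have "{..<M} = (\<Union>q<r. {p \<in> {..<M}. d p = q})" using c by (auto simp: d_def)
      then have "M = card (\<Union>q<r. {p \<in> {..<M}. d p = q})" by (metis card_lessThan)
      also have "\<dots> \<le> (\<Sum>q<r. card {p \<in> {..<M}. d p = q})" by (rule card_UN_le) simp
      also have "\<dots> \<le> (\<Sum>q<r. m)" by (intro sum_mono *) simp
      finally show False by (simp add: M_def)
    qed
    then obtain q Q where Q: "Q \<subseteq> {p \<in> {..<M}. d p = q}" "card Q = m"
      by (meson obtain_subset_with_card_n)
    define bs where "bs = map (\<lambda>p. p \<in> Q) [0..<M]"
    have "length (filter id bs) = card (Q \<inter> set [0..<M])"
      unfolding bs_def filter_map length_map comp_def id_def by (simp only: distinct_length_filter distinct_upt Int_commute Collect_mem_eq)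
    also have "Q \<inter> set [0..<M] = Q" using Q(1) by auto
    finally have bs: "length (filter id bs) = m" "length bs = M"
      unfolding Q(2) by (simp_all only: bs_def length_map length_upt diff_zero)
    have bs_nth: "bs ! p \<longleftrightarrow> p \<in> Q" if "p < M" for p
      using nth_map[of p "[0..<M]" "\<lambda>p. p \<in> Q"] nth_upt[of 0 p M] that
      by (simp only: bs_def length_upt add_0 diff_zero)
    obtain u where u: "length u = M" "param_word a m u"
      "\<And>e s b. length e = a \<Longrightarrow> set e \<subseteq> {..<b} \<Longrightarrow> length s = m \<Longrightarrow> \<exists>y\<in>set s. b \<le> y \<Longrightarrow>
        prefix_len b (map ((!) (e @ s)) u) < M \<and> bs ! prefix_len b (map ((!) (e @ s)) u)"
      using word_with_positions[of a bs] False bs by auto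
    have "c (plug a s (plug a u t)) = q" if s: "length s = m" "param_word a (Suc k) s" for s
    proof -
      let ?p = "prefix_len a (plug a s u)"
      have "?p < M \<and> bs ! ?p"
        unfolding plug_def using s param_word_has_param[OF s(2)] by (intro u(3)) auto
      then have "?p \<in> Q" using bs_nth by blast
      then have "d ?p = q" using Q(1) by auto
      then show ?thesis
        using d[of "plug a s u"] param_word_plug[OF u(2) s(2,1)] u(1) by (simp add: plug_plug[OF t(2)])
    qed
    then show "\<exists>t. length t = n \<and> param_word a m t \<and>
      (\<forall>s s'. length s = m \<and> length s' = m \<and> param_word a (Suc k) s \<and> param_word a (Suc k) s' \<longrightarrow>
        c (plug a s t) = c (plug a s' t))"
      using param_word_plug[OF t(2) u(2,1)] t(1) by (intro exI[of _ "plug a u t"]) simp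
  qed
qed

lemma graham_rothschild: "ramsey_for a k m r"
  by (induction k arbitrary: a m r) (rule ramsey_for_0, rule ramsey_for_Suc)

lemma plug_0: "plug 0 s t = map ((!) s) t"
  by (simp add: plug_def)

text \<open>Tests with lists of different lengths will be handled together, so one \<open>t\<close>
  has to serve all \<open>k \<le> K\<close>. Since subwords of a good word are good, the values of
  \<open>k\<close> can be treated one at a time.\<close>

lemma graham_rothschild_upto:
  "\<exists>n. \<forall>c. (\<forall>w. c w < r) \<longrightarrow> (\<exists>t. length t = n \<and> param_word 0 m t \<and>
    (\<forall>k\<le>K. \<forall>s s'. length s = m \<and> length s' = m \<and> param_word 0 k s \<and> param_word 0 k s' \<longrightarrow>
      c (plug 0 s t) = (c (plug 0 s' t) :: nat)))"
proof (induction K)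
  case 0
  then show ?case using graham_rothschild[of 0 0 m r] unfolding ramsey_for_def by (simp only: le_zero_eq simp_thms all_simps)
next
  case (Suc K)
  obtain n where n: "\<And>c. (\<forall>w. c w < r) \<Longrightarrow> (\<exists>t. length t = n \<and> param_word 0 m t \<and>
    (\<forall>k\<le>K. \<forall>s s'. length s = m \<and> length s' = m \<and> param_word 0 k s \<and> param_word 0 k s' \<longrightarrow>
      c (plug 0 s t) = (c (plug 0 s' t) :: nat)))"
    using Suc by blast
  obtain n' where n': "\<And>c. (\<forall>w. c w < r) \<Longrightarrow> (\<exists>t. length t = n' \<and> param_word 0 n t \<and>
    (\<forall>s s'. length s = n \<and> length s' = n \<and> param_word 0 (Suc K) s \<and> param_word 0 (Suc K) s' \<longrightarrow>
      c (plug 0 s t) = (c (plug 0 s' t) :: nat)))"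
    using graham_rothschild[of 0 "Suc K" n r] unfolding ramsey_for_def by blast
  show ?case
  proof (rule exI[of _ n'], intro allI impI)
    fix c :: "nat list \<Rightarrow> nat" assume c: "\<forall>w. c w < r"
    obtain t where t: "length t = n'" "param_word 0 n t"
      "\<And>s s'. length s = n \<Longrightarrow> length s' = n \<Longrightarrow> param_word 0 (Suc K) s \<Longrightarrow>
        param_word 0 (Suc K) s' \<Longrightarrow> c (plug 0 s t) = c (plug 0 s' t)"
      using n'[OF c] by blast
    obtain u where u: "length u = n" "param_word 0 m u"
      "\<And>k s s'. k \<le> K \<Longrightarrow> length s = m \<Longrightarrow> length s' = m \<Longrightarrow> param_word 0 k s \<Longrightarrow>
        param_word 0 k s' \<Longrightarrow> c (plug 0 (plug 0 s u) t) = c (plug 0 (plug 0 s' u) t)"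
      using n[of "\<lambda>w. c (plug 0 w t)"] c by blast
    have "c (plug 0 s (plug 0 u t)) = c (plug 0 s' (plug 0 u t))"
      if s: "k \<le> Suc K" "length s = m" "length s' = m" "param_word 0 k s" "param_word 0 k s'" for k s s'
    proof (cases "k \<le> K")
      case True
      then show ?thesis unfolding plug_plug[OF t(2) u(1)] using s by (intro u(3))
    next
      case False
      then have "k = Suc K" using s(1) by simp
      then show ?thesis unfolding plug_plug[OF t(2) u(1)] using s u(1)
        by (intro t(3) param_word_plug[OF u(2)]) simp_all
    qed
    then show "\<exists>t. length t = n' \<and> param_word 0 m t \<and>
      (\<forall>k\<le>Suc K. \<forall>s s'. length s = m \<and> length s' = m \<and> param_word 0 k s \<and> param_word 0 k s' \<longrightarrow>
        c (plug 0 s t) = c (plug 0 s' t))"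
      using param_word_plug[OF t(2) u(2,1)] t(1) by (intro exI[of _ "plug 0 u t"]) simp
  qed
qed

section \<open>Finite partitions and natural orderings\<close>

definition fsup :: "'b::boolean_algebra set \<Rightarrow> 'b" where
  "fsup A = Sup_fin (insert bot A)"

lemma fsup_empty [simp]: "fsup {} = bot"
  by (simp add: fsup_def)

lemma fsup_insert: "finite A \<Longrightarrow> fsup (insert a A) = sup a (fsup A)"
  by (simp add: fsup_def insert_commute[of bot a])

lemma fsup_le_iff: "finite A \<Longrightarrow> fsup A \<le> z \<longleftrightarrow> (\<forall>a\<in>A. a \<le> z)"
  by (induction A rule: finite_induct) (auto simp: fsup_insert)

text \<open>The last clause says, without using a join, that the pieces join to
  \<open>top\<close>.\<close>

definition bpartition :: "'b::boolean_algebra set \<Rightarrow> bool" where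
  "bpartition P \<longleftrightarrow> finite P \<and> bot \<notin> P \<and> (\<forall>p\<in>P. \<forall>q\<in>P. p \<noteq> q \<longrightarrow> inf p q = bot) \<and>
     (\<forall>x. (\<forall>p\<in>P. inf p x = bot) \<longrightarrow> x = bot)"

text \<open>The elements that split no piece; for a partition they form the finite subalgebra with
  atoms \<open>P\<close>.\<close>

definition spanned :: "'b::boolean_algebra set \<Rightarrow> 'b set" where
  "spanned P = {x. \<forall>p\<in>P. p \<le> x \<or> inf p x = bot}"

lemma bpartitionD:
  assumes "bpartition P"
  shows "finite P" "p \<in> P \<Longrightarrow> p \<noteq> bot" "p \<in> P \<Longrightarrow> q \<in> P \<Longrightarrow> p \<noteq> q \<Longrightarrow> inf p q = bot"
    "(\<And>p. p \<in> P \<Longrightarrow> inf p x = bot) \<Longrightarrow> x = bot"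
  using assms unfolding bpartition_def by blast+

lemma le_inf_bot: "p \<le> x \<Longrightarrow> inf p x = bot \<Longrightarrow> p = (bot :: 'b::boolean_algebra)"
  by (simp add: inf_absorb1)

lemma spanned_le_iff:
  assumes "bpartition P" "x \<in> spanned P"
  shows "x \<le> y \<longleftrightarrow> (\<forall>p\<in>P. p \<le> x \<longrightarrow> p \<le> y)"
proof (intro iffI ballI impI)
  assume r: "\<forall>p\<in>P. p \<le> x \<longrightarrow> p \<le> y"
  have "inf p (inf x (- y)) = bot" if "p \<in> P" for p
  proof (cases "p \<le> x")
    case True
    then have "p \<le> y" using r that by blast
    then have "inf p (- y) = bot" by (simp add: inf_shunt)
    then show ?thesis by (metis inf_bot_right inf_left_commute)
  next
    case False
    then have "inf p x = bot" using assms(2) that by (auto simp: spanned_def)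
    then show ?thesis by (metis inf_assoc inf_bot_left)
  qed
  then have "inf x (- y) = bot" by (rule bpartitionD(4)[OF assms(1)])
  then show "x \<le> y" by (simp add: inf_shunt)
qed auto

lemma spanned_eqI:
  assumes "bpartition P" "x \<in> spanned P" "y \<in> spanned P" "\<And>p. p \<in> P \<Longrightarrow> p \<le> x \<longleftrightarrow> p \<le> y"
  shows "x = y"
  using assms spanned_le_iff by (metis order_antisym)

text \<open>On \<open>spanned P\<close> the predicate \<open>p \<le> x\<close> is a homomorphism to
  truth values, so Boolean identities there can be verified one piece at a time.\<close>

lemma partition_le_simps:
  assumes P: "bpartition P" "p \<in> P"
  shows "\<not> p \<le> bot" "p \<le> top_class.top"
    "x \<in> spanned P \<Longrightarrow> p \<le> - x \<longleftrightarrow> \<not> p \<le> x"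
    "x \<in> spanned P \<Longrightarrow> p \<le> sup x y \<longleftrightarrow> p \<le> x \<or> p \<le> y"
    "y \<in> spanned P \<Longrightarrow> p \<le> x - y \<longleftrightarrow> p \<le> x \<and> \<not> p \<le> y"
    "q \<in> P \<Longrightarrow> p \<le> q \<longleftrightarrow> p = q"
proof -
  have ne: "p \<noteq> bot" using bpartitionD[OF P(1)] P(2) by blast
  then show "\<not> p \<le> bot" by (simp add: bot_unique)
  show "p \<le> top_class.top" by simp
  show compl: "p \<le> - x \<longleftrightarrow> \<not> p \<le> x" if "x \<in> spanned P" for x
  proof
    assume "p \<le> - x"
    then have "inf p x = bot" by (simp add: inf_shunt)
    then show "\<not> p \<le> x" using ne le_inf_bot by blast
  next
    assume "\<not> p \<le> x"
    then have "inf p x = bot" using that P(2) by (auto simp: spanned_def)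
    then show "p \<le> - x" by (simp add: inf_shunt)
  qed
  show "p \<le> sup x y \<longleftrightarrow> p \<le> x \<or> p \<le> y" if "x \<in> spanned P" for x y
  proof
    assume le: "p \<le> sup x y"
    show "p \<le> x \<or> p \<le> y"
    proof (cases "p \<le> x")
      case False
      then have "p \<le> - x" using compl[OF that] by blast
      with le have "p \<le> inf (- x) (sup x y)" by simp
      also have "\<dots> \<le> y" by (simp add: inf_sup_distrib1)
      finally show ?thesis ..
    qed simp
  qed (auto intro: le_supI1 le_supI2)
  show "p \<le> x - y \<longleftrightarrow> p \<le> x \<and> \<not> p \<le> y" if "y \<in> spanned P" for x y
    using compl[OF that] by (simp add: diff_eq)
  show "p \<le> q \<longleftrightarrow> p = q" if "q \<in> P"
    using bpartitionD(3)[OF P that] ne le_inf_bot by blast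
qed

lemma spanned_closed:
  "bot \<in> spanned P" "top_class.top \<in> spanned P"
  "x \<in> spanned P \<Longrightarrow> - x \<in> spanned P"
  "x \<in> spanned P \<Longrightarrow> y \<in> spanned P \<Longrightarrow> inf x y \<in> spanned P"
  "x \<in> spanned P \<Longrightarrow> y \<in> spanned P \<Longrightarrow> sup x y \<in> spanned P"
  "x \<in> spanned P \<Longrightarrow> y \<in> spanned P \<Longrightarrow> x - y \<in> spanned P"
proof -
  show "bot \<in> spanned P" "top_class.top \<in> spanned P" by (auto simp: spanned_def)
  show compl: "- x \<in> spanned P" if "x \<in> spanned P" for x
    using that by (auto simp: spanned_def inf_shunt)
  show inf: "inf x y \<in> spanned P" if "x \<in> spanned P" "y \<in> spanned P" for x y
    using that unfolding spanned_def
    by (auto simp: inf_shunt) (metis inf_shunt le_supI1 le_supI2)+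
  then show "x - y \<in> spanned P" if "x \<in> spanned P" "y \<in> spanned P" for x y
    using that compl by (simp add: diff_eq)
  have "sup x y = - (inf (- x) (- y))" for x y :: 'a by simp
  then show "sup x y \<in> spanned P" if "x \<in> spanned P" "y \<in> spanned P" for x y
    using that compl inf by metis
qed

lemma partition_in_spanned: "bpartition P \<Longrightarrow> p \<in> P \<Longrightarrow> p \<in> spanned P"
  unfolding spanned_def using bpartitionD(3) by blast

lemma fsup_spanned: "finite A \<Longrightarrow> A \<subseteq> spanned P \<Longrightarrow> fsup A \<in> spanned P"
  by (induction A rule: finite_induct) (auto simp: fsup_insert spanned_closed)

lemma partition_le_fsup:
  assumes "bpartition P" "p \<in> P" "finite A" "A \<subseteq> spanned P"
  shows "p \<le> fsup A \<longleftrightarrow> (\<exists>a\<in>A. p \<le> a)"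
  using assms(3,4)
  by (induction A rule: finite_induct) (auto simp: fsup_insert partition_le_simps[OF assms(1,2)])

lemma boolean_subalgebra_spanned: "boolean_subalgebra (spanned P)"
  by (simp add: boolean_subalgebra_def spanned_closed)

lemma finite_spanned:
  assumes "bpartition P"
  shows "finite (spanned P)"
proof (rule inj_on_finite)
  show "inj_on (\<lambda>x. {p \<in> P. p \<le> x}) (spanned P)"
    by (rule inj_onI) (rule spanned_eqI[OF assms], auto)
  show "(\<lambda>x. {p \<in> P. p \<le> x}) ` spanned P \<subseteq> Pow P" by auto
  show "finite (Pow P)" using bpartitionD(1)[OF assms] by simp
qed

lemma atoms_of_spanned:
  assumes "bpartition P"
  shows "atoms_of (spanned P) = P"
proof
  show "P \<subseteq> atoms_of (spanned P)"
  proof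
    fix p assume p: "p \<in> P"
    have "x = bot \<or> x = p" if "x \<in> spanned P" "x \<le> p" for x
    proof -
      have "p \<le> x \<or> inf p x = bot" using that p by (auto simp: spanned_def)
      then show ?thesis using that(2) by (auto simp: inf_absorb2)
    qed
    then show "p \<in> atoms_of (spanned P)"
      using p bpartitionD(2)[OF assms] partition_in_spanned[OF assms]
      by (auto simp: atoms_of_def)
  qed
  show "atoms_of (spanned P) \<subseteq> P"
  proof
    fix a assume a: "a \<in> atoms_of (spanned P)"
    then have "a \<noteq> bot" "a \<in> spanned P" by (auto simp: atoms_of_def)
    then obtain p where p: "p \<in> P" "p \<le> a"
      using spanned_le_iff[OF assms, of a bot] by (auto simp: bot_unique)
    then have "p = bot \<or> p = a" using a partition_in_spanned[OF assms] by (auto simp: atoms_of_def)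
    then show "a \<in> P" using p bpartitionD(2)[OF assms] by blast
  qed
qed

lemma partition_refine:
  assumes "finite F"
  shows "\<exists>P. bpartition P \<and> F \<subseteq> spanned P"
  using assms
proof (induction F rule: finite_induct)
  case empty
  \<comment> \<open>In the one-element algebra, where \<open>top = bot\<close>, the only partition
    is the empty set.\<close>
  have "bpartition ({top_class.top} - {bot :: 'a})"
    unfolding bpartition_def by (auto simp: bot_unique) (metis bot_unique top_greatest)
  then show ?case by blast
next
  case (insert x F)
  then obtain P where P: "bpartition P" "F \<subseteq> spanned P" by blast
  let ?P = "(\<lambda>p. inf p x) ` P \<union> (\<lambda>p. inf p (- x)) ` P - {bot}"
  have sub: "\<exists>p\<in>P. q \<le> p \<and> (q \<le> x \<and> q = inf p x \<or> q \<le> - x \<and> q = inf p (- x))" if q: "q \<in> ?P" for q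
  proof -
    obtain p where "p \<in> P" "q = inf p x \<or> q = inf p (- x)" using q by blast
    then show ?thesis by (intro bexI[of _ p]) auto
  qed
  have disj: "inf q q' = bot" if q: "q \<in> ?P" "q' \<in> ?P" "q \<noteq> q'" for q q'
  proof -
    obtain p p' where p: "p \<in> P" "q \<le> p" "q \<le> x \<and> q = inf p x \<or> q \<le> - x \<and> q = inf p (- x)"
      "p' \<in> P" "q' \<le> p'" "q' \<le> x \<and> q' = inf p' x \<or> q' \<le> - x \<and> q' = inf p' (- x)"
      using sub q by meson
    have *: "inf q q' = bot" if "q \<le> u" "q' \<le> v" "inf u v = bot" for u v
      using inf_mono[OF that(1,2)] that(3) by (simp add: bot_unique)
    show ?thesis
    proof (cases "p = p'")
      case True
      then have "q \<le> x \<and> q' \<le> - x \<or> q \<le> - x \<and> q' \<le> x" using p q(3) by auto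
      then show ?thesis using *[of x "- x"] *[of "- x" x] by auto
    next
      case False
      then show ?thesis using * p bpartitionD(3)[OF P(1)] by blast
    qed
  qed
  have cover: "y = bot" if y: "\<And>q. q \<in> ?P \<Longrightarrow> inf q y = bot" for y
  proof (rule bpartitionD(4)[OF P(1)])
    fix p assume p: "p \<in> P"
    have "inf (inf p x) y = bot" "inf (inf p (- x)) y = bot"
      using y[of "inf p x"] y[of "inf p (- x)"] p by (metis DiffI UnCI imageI inf_bot_left singletonD)+
    then have "sup (inf (inf p x) y) (inf (inf p (- x)) y) = bot" by simp
    also have "sup (inf (inf p x) y) (inf (inf p (- x)) y) = inf (sup (inf p x) (inf p (- x))) y"
      by (simp add: inf_sup_distrib2)
    also have "sup (inf p x) (inf p (- x)) = p" by (simp flip: inf_sup_distrib1)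
    finally show "inf p y = bot" .
  qed
  have "bpartition ?P"
    unfolding bpartition_def
  proof (intro conjI ballI impI allI)
    show "finite ?P" using bpartitionD(1)[OF P(1)] by simp
    show "inf q q' = bot" if "q \<in> ?P" "q' \<in> ?P" "q \<noteq> q'" for q q' using disj that .
    show "y = bot" if "\<forall>q\<in>?P. inf q y = bot" for y by (rule cover) (rule bspec[OF that])
  qed simp
  moreover have "x \<in> spanned ?P"
    unfolding spanned_def using sub by (auto simp: inf_assoc)
  moreover have "z \<in> spanned ?P" if "z \<in> spanned P" for z
    unfolding spanned_def
  proof (intro CollectI ballI)
    fix q assume "q \<in> ?P"
    then obtain p where p: "p \<in> P" "q \<le> p" using sub by blast
    then consider "p \<le> z" | "inf p z = bot" using \<open>z \<in> spanned P\<close> by (auto simp: spanned_def)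
    then show "q \<le> z \<or> inf q z = bot"
      using p(2) by cases (auto intro: order_trans simp: inf_shunt)
  qed
  ultimately show ?case using P(2) by blast
qed

text \<open>The complement of the join of all atoms lies in \<open>S\<close> as well; if it were not
  \<open>bot\<close>, it would have an atom below it.\<close>

lemma bpartition_atoms_of:
  fixes S :: "'b::boolean_algebra set"
  assumes "finite S" "boolean_subalgebra S"
  shows "bpartition (atoms_of S)" "S \<subseteq> spanned (atoms_of S)"
proof -
  have S: "bot \<in> S" "\<And>x y. x \<in> S \<Longrightarrow> y \<in> S \<Longrightarrow> inf x y \<in> S" "\<And>x y. x \<in> S \<Longrightarrow> y \<in> S \<Longrightarrow> sup x y \<in> S"
    "\<And>x. x \<in> S \<Longrightarrow> - x \<in> S"
    using assms(2) by (auto simp: boolean_subalgebra_def)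
  have dich: "p \<le> x \<or> inf p x = bot" if "p \<in> atoms_of S" "x \<in> S" for p x
  proof -
    have "inf p x \<in> S" using that S(2) by (auto simp: atoms_of_def)
    then have "inf p x = bot \<or> inf p x = p" using that(1) by (auto simp: atoms_of_def)
    then show ?thesis by (metis inf.cobounded2)
  qed
  then show "S \<subseteq> spanned (atoms_of S)" by (auto simp: spanned_def)
  have fin: "finite (atoms_of S)" by (rule finite_subset[OF _ assms(1)]) (auto simp: atoms_of_def)
  have below: "\<exists>p\<in>atoms_of S. p \<le> x" if x: "x \<in> S" "x \<noteq> bot" for x
  proof -
    obtain m where m: "m \<in> S - {bot}" "m \<le> x" "\<forall>b\<in>S - {bot}. b \<le> m \<longrightarrow> m = b"
      using finite_has_minimal2[of "S - {bot}" x] assms(1) x by auto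
    then show ?thesis by (intro bexI[of _ m]) (auto simp: atoms_of_def)
  qed
  have "fsup A \<in> S" if "finite A" "A \<subseteq> S" for A
    using that by (induction A rule: finite_induct) (auto simp: fsup_insert S)
  then have "fsup (atoms_of S) \<in> S" using fin by (auto simp: atoms_of_def)
  then have sS: "- fsup (atoms_of S) \<in> S" by (rule S(4))
  have "- fsup (atoms_of S) = bot"
  proof (rule ccontr)
    assume "- fsup (atoms_of S) \<noteq> bot"
    then obtain p where p: "p \<in> atoms_of S" "p \<le> - fsup (atoms_of S)" using below sS by blast
    moreover have "p \<le> fsup (atoms_of S)" using p(1) fsup_le_iff[OF fin] by blast
    ultimately have "p \<le> inf (fsup (atoms_of S)) (- fsup (atoms_of S))" by (intro inf_greatest)
    then have "p = bot" by (simp add: bot_unique)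
    then show False using p(1) by (simp add: atoms_of_def)
  qed
  then have top: "fsup (atoms_of S) = top_class.top" by (metis compl_bot_eq double_compl)
  have cover: "x = bot" if "\<forall>p\<in>atoms_of S. inf p x = bot" for x
  proof -
    have "fsup (atoms_of S) \<le> - x" unfolding fsup_le_iff[OF fin] using that by (simp add: inf_shunt)
    then have "- x = top_class.top" using top by (simp add: top_unique)
    then show ?thesis by (metis compl_top_eq double_compl)
  qed
  have disj: "inf p q = bot" if "p \<in> atoms_of S" "q \<in> atoms_of S" "p \<noteq> q" for p q
  proof -
    have "q \<in> S" "p \<in> S" "p \<noteq> bot" using that by (auto simp: atoms_of_def)
    then have "p \<le> q \<Longrightarrow> p = q" using that(2) by (auto simp: atoms_of_def)
    then show ?thesis using dich[OF that(1) \<open>q \<in> S\<close>] that(3) by blast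
  qed
  show "bpartition (atoms_of S)"
    unfolding bpartition_def
  proof (intro conjI ballI impI allI)
    show "bot \<notin> atoms_of S" by (simp add: atoms_of_def)
  qed (fact fin, rule disj, assumption+, rule cover, assumption)
qed

text \<open>A first-order description of natural orderings: each instance concerns finitely many
  coordinates of \<open>r\<close>, so it is a clopen condition.\<close>

definition natural_at :: "('b::boolean_algebra \<times> 'b \<Rightarrow> bool) \<Rightarrow> 'b \<Rightarrow> 'b \<Rightarrow> 'b \<Rightarrow> bool" where
  "natural_at r x y z \<longleftrightarrow>
     \<not> r (x, x) \<and> (x \<noteq> y \<longrightarrow> r (x, y) \<or> r (y, x)) \<and> (r (x, y) \<longrightarrow> r (y, z) \<longrightarrow> r (x, z)) \<and>
     (x \<noteq> bot \<longrightarrow> r (bot, x)) \<and> (r (x, y) \<longleftrightarrow> r (x - y, y - x)) \<and>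
     (inf x y = bot \<longrightarrow> inf z y = bot \<longrightarrow> r (x, y) \<longrightarrow> r (z, y) \<longrightarrow> r (sup x z, y))"

lemma antilex_less_trans:
  assumes "antilex_less as x y" "antilex_less as y z"
  shows "antilex_less as x z"
proof -
  obtain i where i: "i < length as" "as ! i \<le> y" "\<not> as ! i \<le> x"
    "\<And>j. j < length as \<Longrightarrow> i < j \<Longrightarrow> as ! j \<le> x \<longleftrightarrow> as ! j \<le> y"
    using assms(1) unfolding antilex_less_def by blast
  obtain i' where i': "i' < length as" "as ! i' \<le> z" "\<not> as ! i' \<le> y"
    "\<And>j. j < length as \<Longrightarrow> i' < j \<Longrightarrow> as ! j \<le> y \<longleftrightarrow> as ! j \<le> z"
    using assms(2) unfolding antilex_less_def by blast
  consider "i < i'" | "i' < i" | "i = i'" by linarith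
  then show ?thesis
  proof cases
    case 1
    then show ?thesis unfolding antilex_less_def
      using i(4) i' by (intro exI[of _ i']) auto
  next
    case 2
    then show ?thesis unfolding antilex_less_def
      using i i'(4) by (intro exI[of _ i]) auto
  qed (use i i' in simp)
qed

lemma antilex_less_total:
  assumes "bpartition (set as)" "x \<in> spanned (set as)" "y \<in> spanned (set as)" "x \<noteq> y"
  shows "antilex_less as x y \<or> antilex_less as y x"
proof -
  define D where "D = {i. i < length as \<and> (as ! i \<le> x) \<noteq> (as ! i \<le> y)}"
  have "finite D" by (simp add: D_def)
  moreover have "D \<noteq> {}"
    using spanned_eqI[OF assms(1-3)] assms(4) by (force simp: D_def in_set_conv_nth)
  ultimately have M: "Max D \<in> D" "\<And>j. j \<in> D \<Longrightarrow> j \<le> Max D" by simp_all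
  define m where "m = Max D"
  have "as ! j \<le> x \<longleftrightarrow> as ! j \<le> y" if "j < length as" "m < j" for j
    using M(2)[of j] that unfolding m_def[symmetric] unfolding D_def by auto
  moreover have "m < length as" "(as ! m \<le> x) \<noteq> (as ! m \<le> y)"
    using M(1) unfolding m_def[symmetric] unfolding D_def by simp_all
  ultimately show ?thesis unfolding antilex_less_def by blast
qed

lemma antilex_less_irrefl: "\<not> antilex_less as x x"
  by (simp add: antilex_less_def)

lemma antilex_less_natural:
  assumes P: "bpartition (set as)"
    and xyz: "x \<in> spanned (set as)" "y \<in> spanned (set as)" "z \<in> spanned (set as)"
    and r: "\<And>x y. x \<in> spanned (set as) \<Longrightarrow> y \<in> spanned (set as) \<Longrightarrow> r (x, y) \<longleftrightarrow> antilex_less as x y"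
  shows "natural_at r x y z"
proof -
  have le: "as ! i \<le> u - v \<longleftrightarrow> as ! i \<le> u \<and> \<not> as ! i \<le> v" "\<not> as ! i \<le> bot"
    "as ! i \<le> sup v w \<longleftrightarrow> as ! i \<le> v \<or> as ! i \<le> w"
    if "i < length as" "v \<in> spanned (set as)" for i u v w
    using partition_le_simps[OF P nth_mem[OF that(1)]] that(2) by blast+
  have "antilex_less as bot x" if "x \<noteq> bot"
    using antilex_less_total[OF P _ xyz(1), of bot] that spanned_closed(1) le(2)[OF _ xyz(1)]
    unfolding antilex_less_def by blast
  moreover have "antilex_less as x y \<longleftrightarrow> antilex_less as (x - y) (y - x)"
    unfolding antilex_less_def using le(1) xyz by (auto 0 3)
  moreover have "antilex_less as (sup x z) y"
    if d: "inf x y = bot" "inf z y = bot" and l: "antilex_less as x y" "antilex_less as z y"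
  proof -
    obtain i where i: "i < length as" "as ! i \<le> y" "\<not> as ! i \<le> x"
      "\<And>j. j < length as \<Longrightarrow> i < j \<Longrightarrow> as ! j \<le> x \<longleftrightarrow> as ! j \<le> y"
      using l(1) unfolding antilex_less_def by blast
    obtain i' where i': "i' < length as" "as ! i' \<le> y" "\<not> as ! i' \<le> z"
      "\<And>j. j < length as \<Longrightarrow> i' < j \<Longrightarrow> as ! j \<le> z \<longleftrightarrow> as ! j \<le> y"
      using l(2) unfolding antilex_less_def by blast
    have no: "\<not> (as ! j \<le> x \<and> as ! j \<le> y)" "\<not> (as ! j \<le> z \<and> as ! j \<le> y)" if "j < length as" for j
      using le(2)[OF that xyz(1)] d by (metis inf.boundedI)+
    \<comment> \<open>Disjointness from \<open>y\<close> makes both \<open>i\<close> and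
      \<open>i'\<close> the index of the largest atom below \<open>y\<close>.\<close>
    have "i = i'" using i i' no by (metis linorder_neqE_nat)
    then show ?thesis unfolding antilex_less_def
      using i i' le(3)[OF _ xyz(1)] by (intro exI[of _ i]) auto
  qed
  ultimately show ?thesis
    unfolding natural_at_def
    using antilex_less_total[OF P xyz(1,2)] antilex_less_trans[of as x y z] antilex_less_irrefl
    by (simp add: r xyz spanned_closed)
qed

lemma sorted_enumeration:
  assumes "finite P" "\<And>x y. x \<noteq> y \<Longrightarrow> R x y \<or> R y x" "\<And>x y z. R x y \<Longrightarrow> R y z \<Longrightarrow> R x z"
  shows "\<exists>as. distinct as \<and> set as = P \<and> sorted_wrt R as"
  using assms(1)
proof (induction P rule: finite_induct)
  case empty
  show ?case by (rule exI[of _ "[]"]) simp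
next
  case (insert x P)
  then obtain as where as: "distinct as" "set as = P" "sorted_wrt R as" by blast
  let ?bs = "filter (\<lambda>y. R y x) as @ x # filter (\<lambda>y. \<not> R y x) as"
  have "distinct ?bs" "set ?bs = insert x P" using as insert.hyps by auto
  moreover have "sorted_wrt R ?bs"
  proof -
    have less: "R x y" if "y \<in> set as" "\<not> R y x" for y
      using assms(2) as(2) insert.hyps(2) that by metis
    then have "R y z" if "y \<in> set as" "z \<in> set as" "R y x" "\<not> R z x" for y z
      using assms(3) that by blast
    with less show ?thesis using as(3) by (auto simp: sorted_wrt_append sorted_wrt_filter)
  qed
  ultimately show ?case by blast
qed

lemma natural_atD:
  assumes "\<And>x y z. natural_at r x y z"
  shows "\<not> r (x, x)" "x \<noteq> y \<Longrightarrow> r (x, y) \<or> r (y, x)" "r (x, y) \<Longrightarrow> r (y, z) \<Longrightarrow> r (x, z)"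
    "x \<noteq> bot \<Longrightarrow> r (bot, x)" "r (x, y) \<longleftrightarrow> r (x - y, y - x)"
    "inf x y = bot \<Longrightarrow> inf z y = bot \<Longrightarrow> r (x, y) \<Longrightarrow> r (z, y) \<Longrightarrow> r (sup x z, y)"
  using assms[of x y z] unfolding natural_at_def by blast+

text \<open>The antilexicographic principle: applied to one piece after another, the join clause of
  \<open>natural_at\<close> lets a single \<open>a\<close> dominate everything built from pieces
  that it dominates.\<close>

lemma natural_at_join_less:
  assumes r: "\<And>x y z. natural_at r x y z" and P: "bpartition P"
    and "u \<in> spanned P" "a \<noteq> bot" "inf u a = bot" "\<And>p. p \<in> P \<Longrightarrow> p \<le> u \<Longrightarrow> r (p, a)"
  shows "r (u, a)"
  using assms(3,5,6)
proof (induction "card {p \<in> P. p \<le> u}" arbitrary: u rule: less_induct)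
  case less
  show ?case
  proof (cases "u = bot")
    case True
    then show ?thesis using natural_atD(4)[OF r \<open>a \<noteq> bot\<close>] by simp
  next
    case False
    then obtain p where p: "p \<in> P" "p \<le> u"
      using spanned_le_iff[OF P less.prems(1), of bot] by (auto simp: bot_unique)
    have u: "u - p \<in> spanned P" "u - p \<le> u"
      using less.prems(1) p partition_in_spanned[OF P] by (auto simp: spanned_closed diff_eq)
    have "{q \<in> P. q \<le> u - p} \<subset> {q \<in> P. q \<le> u}"
      using p u(2) partition_le_simps(5)[OF P p(1) partition_in_spanned[OF P p(1)], of u]
      by (auto intro: order_trans)
    then have "card {q \<in> P. q \<le> u - p} < card {q \<in> P. q \<le> u}"
      using bpartitionD(1)[OF P] by (intro psubset_card_mono) auto
    moreover have "inf (u - p) a = bot" "inf p a = bot"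
      using less.prems(2) u(2) p(2) by (auto simp: inf_shunt intro: order_trans)
    ultimately have "r (sup (u - p) p, a)"
      using less u p by (intro natural_atD(6)[OF r]) (auto intro: order_trans)
    moreover have "sup (u - p) p = u"
      using p(2) by (simp add: diff_eq sup_inf_distrib2 sup_absorb1)
    ultimately show ?thesis by simp
  qed
qed

text \<open>Let \<open>a\<close> be the largest atom on which \<open>x\<close> and \<open>y\<close>
  differ. All pieces of \<open>x - y\<close> are smaller than \<open>a\<close>, and \<open>a\<close>
  lies below \<open>y - x\<close>, so \<open>x - y\<close> precedes \<open>y - x\<close>, and the
  difference clause of \<open>natural_at\<close> restores the common part. The converse follows by
  totality.\<close>

lemma natural_iff_antilex:
  assumes r: "\<And>x y z. natural_at r x y z" and P: "bpartition (set as)"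
    and sorted: "sorted_wrt (\<lambda>x y. r (x, y)) as"
    and xy: "x \<in> spanned (set as)" "y \<in> spanned (set as)"
  shows "r (x, y) \<longleftrightarrow> antilex_less as x y"
proof -
  have imp: "r (x, y)" if xy: "x \<in> spanned (set as)" "y \<in> spanned (set as)" and l: "antilex_less as x y" for x y
  proof -
    obtain i where i: "i < length as" "as ! i \<le> y" "\<not> as ! i \<le> x"
      "\<And>j. j < length as \<Longrightarrow> i < j \<Longrightarrow> as ! j \<le> x \<longleftrightarrow> as ! j \<le> y"
      using l unfolding antilex_less_def by blast
    define a where "a = as ! i"
    have a: "a \<in> set as" "a \<noteq> bot" using i(1) bpartitionD(2)[OF P] by (auto simp: a_def)
    have av: "a \<le> y - x" using partition_le_simps(5)[OF P a(1) xy(1)] i by (simp add: a_def)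
    have "r (x - y, a)"
    proof (rule natural_at_join_less[OF r P])
      show "x - y \<in> spanned (set as)" using xy by (simp add: spanned_closed)
      show "a \<noteq> bot" by (rule a(2))
      show "inf (x - y) a = bot"
        using i(2) by (simp add: a_def diff_eq inf_shunt le_infI2)
      fix p assume p: "p \<in> set as" "p \<le> x - y"
      then obtain j where j: "j < length as" "p = as ! j" by (auto simp: in_set_conv_nth)
      have "p \<le> x" "\<not> p \<le> y" using p partition_le_simps(5)[OF P p(1) xy(2)] by auto
      then have "j < i" using i j by (metis linorder_neqE_nat)
      then show "r (p, a)" using sorted i(1) j by (simp add: a_def sorted_wrt_iff_nth_less)
    qed
    moreover have "a = y - x \<or> r (a, y - x)"
    proof (cases "y - x - a = bot")
      case True
      then have "y - x \<le> a" by (simp add: diff_eq inf_shunt)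
      then show ?thesis using av by simp
    next
      case False
      then have "r (bot, y - x - a)" by (rule natural_atD(4)[OF r])
      moreover have "a - (y - x) = bot" using av by (simp add: diff_eq inf_shunt)
      ultimately have "r (a - (y - x), y - x - a)" by (simp only:)
      then show ?thesis using natural_atD(5)[OF r, of a "y - x"] by blast
    qed
    ultimately have "r (x - y, y - x)" using natural_atD(3)[OF r] by metis
    then show "r (x, y)" using natural_atD(5)[OF r] by blast
  qed
  show ?thesis
    using imp[OF xy] imp[OF xy(2,1)] antilex_less_total[OF P xy] natural_atD(1,3)[OF r] by metis
qed

text \<open>Every instance of \<open>natural_at\<close> involves three elements, which lie in a
  common finite subalgebra; conversely, sorting the atoms of a finite subalgebra by \<open>r\<close>
  gives the list that \<open>natural_on\<close> asks for.\<close>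

lemma natural_orderings_eq:
  "natural_orderings = {r :: 'b::boolean_algebra \<times> 'b \<Rightarrow> bool. \<forall>x y z. natural_at r x y z}"
proof (rule Set.set_eqI, rule iffI)
  fix r :: "'b \<times> 'b \<Rightarrow> bool"
  assume r: "r \<in> natural_orderings"
  have "natural_at r x y z" for x y z
  proof -
    obtain P where P: "bpartition P" "{x, y, z} \<subseteq> spanned P"
      using partition_refine[of "{x, y, z}"] by auto
    then have "natural_on (spanned P) r"
      using r finite_spanned boolean_subalgebra_spanned by (auto simp: natural_orderings_def)
    then obtain as where as: "set as = P"
      "\<And>x y. x \<in> spanned P \<Longrightarrow> y \<in> spanned P \<Longrightarrow> r (x, y) \<longleftrightarrow> antilex_less as x y"
      unfolding natural_on_def atoms_of_spanned[OF P(1)] by blast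
    then show ?thesis using P by (intro antilex_less_natural[of as]) auto
  qed
  then show "r \<in> {r. \<forall>x y z. natural_at r x y z}" by blast
next
  fix r :: "'b \<times> 'b \<Rightarrow> bool"
  assume "r \<in> {r. \<forall>x y z. natural_at r x y z}"
  then have r: "natural_at r x y z" for x y z by blast
  have "strict_linear_order_on UNIV (Collect r)"
    unfolding strict_linear_order_on_def
    using natural_atD(1,2)[OF r] natural_atD(3)[OF r]
    by (auto simp: irrefl_def total_on_def intro!: transI)
  moreover have "natural_on S r" if S: "finite S" "boolean_subalgebra S" for S
  proof -
    note P = bpartition_atoms_of[OF S]
    obtain as where as: "distinct as" "set as = atoms_of S" "sorted_wrt (\<lambda>x y. r (x, y)) as"
      using sorted_enumeration[OF bpartitionD(1)[OF P(1)], of "\<lambda>x y. r (x, y)"]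
        natural_atD(2,3)[OF r] by metis
    have "r (x, y) \<longleftrightarrow> antilex_less as x y" if "x \<in> S" "y \<in> S" for x y
      using natural_iff_antilex[OF r _ as(3)] P as(2) that by auto
    then show ?thesis using as unfolding natural_on_def by blast
  qed
  ultimately show "r \<in> natural_orderings" by (simp add: natural_orderings_def)
qed

lemma natural_orderings_natural_at: "r \<in> natural_orderings \<Longrightarrow> natural_at r x y z"
  by (simp add: natural_orderings_eq)

section \<open>The compact space of natural orderings\<close>

lemma openin_pointwise_iff:
  "openin (product_topology (\<lambda>_. discrete_topology UNIV) UNIV) U \<longleftrightarrow>
     (\<forall>f\<in>U. \<exists>F. finite F \<and> (\<forall>f'. (\<forall>x\<in>F. f' x = f x) \<longrightarrow> f' \<in> U))"
  (is "?L \<longleftrightarrow> ?R")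
proof
  assume ?L
  show ?R
  proof
    fix f assume "f \<in> U"
    then obtain V where V: "finite {i. V i \<noteq> UNIV}" "f \<in> Pi\<^sub>E UNIV V" "Pi\<^sub>E UNIV V \<subseteq> U"
      using \<open>?L\<close> unfolding openin_product_topology_alt by auto
    have "f' \<in> U" if "\<forall>x\<in>{i. V i \<noteq> UNIV}. f' x = f x" for f'
    proof -
      have "f' x \<in> V x" for x using that V(2) by (cases "V x = UNIV") (auto simp: PiE_iff)
      then show ?thesis using V(3) by auto
    qed
    then show "\<exists>F. finite F \<and> (\<forall>f'. (\<forall>x\<in>F. f' x = f x) \<longrightarrow> f' \<in> U)" using V(1) by blast
  qed
next
  assume R: ?R
  show ?L unfolding openin_product_topology_alt
  proof
    fix f assume "f \<in> U"
    then obtain F where F: "finite F" "\<And>f'. (\<forall>x\<in>F. f' x = f x) \<Longrightarrow> f' \<in> U" using R by blast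
    let ?V = "\<lambda>i. if i \<in> F then {f i} else UNIV"
    have "{i \<in> UNIV. ?V i \<noteq> topspace (discrete_topology UNIV)} \<subseteq> F" by auto
    then have "finite {i \<in> UNIV. ?V i \<noteq> topspace (discrete_topology UNIV)}"
      using F(1) by (rule finite_subset)
    moreover have "Pi\<^sub>E UNIV ?V \<subseteq> U" using F(2) by (auto simp: PiE_iff split: if_splits)
    moreover have "f \<in> Pi\<^sub>E UNIV ?V" by auto
    ultimately show "\<exists>V. finite {i \<in> UNIV. V i \<noteq> topspace (discrete_topology UNIV)} \<and>
        (\<forall>i\<in>UNIV. openin (discrete_topology UNIV) (V i)) \<and> f \<in> Pi\<^sub>E UNIV V \<and> Pi\<^sub>E UNIV V \<subseteq> U"
      by (intro exI[of _ ?V]) auto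
  qed
qed

lemma closedin_pointwise:
  assumes "finite F" "\<And>f f'. (\<forall>x\<in>F. f x = f' x) \<Longrightarrow> f \<in> S \<Longrightarrow> f' \<in> S"
  shows "closedin (product_topology (\<lambda>_. discrete_topology UNIV) UNIV) S"
proof -
  have "openin (product_topology (\<lambda>_. discrete_topology UNIV) UNIV) (- S)"
    unfolding openin_pointwise_iff
  proof
    fix f assume "f \<in> - S"
    then have "\<forall>f'. (\<forall>x\<in>F. f' x = f x) \<longrightarrow> f' \<in> - S" using assms(2) by auto
    then show "\<exists>F. finite F \<and> (\<forall>f'. (\<forall>x\<in>F. f' x = f x) \<longrightarrow> f' \<in> - S)" using assms(1) by blast
  qed
  then show ?thesis by (simp add: closedin_def Compl_eq_Diff_UNIV)
qed

text \<open>Monotonicity places \<open>D\<close> of a union inside any finite intersection. The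
  compactness arguments below all satisfy infinitely many conditions by satisfying every finite set
  of them.\<close>

lemma compact_space_directed:
  assumes "compact_space X" "\<And>F. finite F \<Longrightarrow> closedin X (D F)" "\<And>F. finite F \<Longrightarrow> D F \<noteq> {}"
    "\<And>F F'. F \<subseteq> F' \<Longrightarrow> D F' \<subseteq> D F"
  shows "\<exists>z\<in>topspace X. \<forall>F. finite F \<longrightarrow> z \<in> D F"
proof -
  let ?U = "D ` Collect finite"
  have "\<Inter> V \<noteq> {}" if V: "finite V" "V \<subseteq> ?U" for V
  proof -
    obtain Q where Q: "Q \<subseteq> Collect finite" "finite Q" "V = D ` Q"
      using finite_subset_image[OF V] by blast
    then have "finite (\<Union> Q)" by auto
    moreover have "D (\<Union> Q) \<subseteq> \<Inter> V" unfolding Q(3) using assms(4) by blast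
    ultimately show ?thesis using assms(3) by blast
  qed
  moreover have "\<forall>C\<in>?U. closedin X C" using assms(2) by blast
  ultimately have "(\<forall>C\<in>?U. closedin X C) \<and> (\<forall>V. finite V \<and> V \<subseteq> ?U \<longrightarrow> \<Inter> V \<noteq> {})" by blast
  then have "\<Inter> ?U \<noteq> {}" by (rule assms(1)[unfolded compact_space_fip, THEN spec, THEN mp])
  then obtain z where z: "\<And>F. finite F \<Longrightarrow> z \<in> D F" by blast
  moreover have "z \<in> topspace X" using z[of "{}"] closedin_subset[OF assms(2)[of "{}"]] by auto
  ultimately show ?thesis by blast
qed

lemma closedin_natural_at:
  "closedin (product_topology (\<lambda>_. discrete_topology UNIV) UNIV) {r. natural_at r x y z}"
  by (rule closedin_pointwise[of "{(x, x), (x, y), (y, x), (y, z), (x, z), (bot, x),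
        (x - y, y - x), (z, y), (sup x z, y)}"]) (auto simp: natural_at_def)

lemma topspace_NO [simp]: "topspace NO_topology = natural_orderings"
  by (simp add: NO_topology_def)

lemma compact_space_NO: "compact_space (NO_topology :: ('b::boolean_algebra \<times> 'b \<Rightarrow> bool) topology)"
proof -
  let ?T = "product_topology (\<lambda>_. discrete_topology UNIV) UNIV :: ('b \<times> 'b \<Rightarrow> bool) topology"
  have "natural_orderings = (\<Inter>(x, y, z). {r. natural_at r x y (z :: 'b)})"
    by (auto simp: natural_orderings_eq)
  moreover have "closedin ?T (\<Inter>(x, y, z). {r. natural_at r x y (z :: 'b)})"
    by (rule closedin_Inter) (auto intro: closedin_natural_at)
  ultimately have "closedin ?T natural_orderings" by (simp only:)
  moreover have "compact_space ?T"
    by (simp add: compact_space_product_topology compact_space_discrete_topology)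
  ultimately show ?thesis
    unfolding NO_topology_def by (intro compact_space_subtopology closedin_compact_space)
qed

lemma Hausdorff_space_NO: "Hausdorff_space NO_topology"
  unfolding NO_topology_def
  by (intro Hausdorff_space_subtopology) (simp add: Hausdorff_space_product_topology)

text \<open>Finitely many instances of \<open>natural_at\<close> live in the span of one finite
  partition, where any enumeration of the pieces yields a suitable antilexicographic order;
  compactness does the rest.\<close>

lemma natural_orderings_nonempty: "(natural_orderings :: ('b::boolean_algebra \<times> 'b \<Rightarrow> bool) set) \<noteq> {}"
proof -
  let ?T = "product_topology (\<lambda>_. discrete_topology UNIV) UNIV :: ('b \<times> 'b \<Rightarrow> bool) topology"
  define D :: "('b \<times> 'b \<times> 'b) set \<Rightarrow> ('b \<times> 'b \<Rightarrow> bool) set"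
    where "D F = {r. \<forall>(x, y, z)\<in>F. natural_at r x y z}" for F
  have "\<exists>r\<in>topspace ?T. \<forall>F. finite F \<longrightarrow> r \<in> D F"
  proof (rule compact_space_directed)
    show "compact_space ?T"
      by (simp add: compact_space_product_topology compact_space_discrete_topology)
    show "closedin ?T (D F)" if "finite F" for F
    proof -
      have "D F = \<Inter> (insert (topspace ?T) ((\<lambda>(x, y, z). {r. natural_at r x y z}) ` F))"
        by (auto simp: D_def)
      moreover have "closedin ?T \<dots>"
        using closedin_natural_at closedin_topspace by (intro closedin_Inter) fast+
      ultimately show ?thesis by metis
    qed
    show "D F \<noteq> {}" if "finite F" for F
    proof -
      let ?X = "\<Union>(x, y, z)\<in>F. {x, y, z}"
      have "finite ?X" using that by auto
      then obtain P where P: "bpartition P" "?X \<subseteq> spanned P" using partition_refine by meson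
      then obtain as where as: "set as = P" using finite_list[OF bpartitionD(1)[OF P(1)]] by blast
      have "natural_at (\<lambda>(x, y). antilex_less as x y) x y z" if "(x, y, z) \<in> F" for x y z
      proof (rule antilex_less_natural[of as])
        show "bpartition (set as)" using P as by simp
        show "x \<in> spanned (set as)" "y \<in> spanned (set as)" "z \<in> spanned (set as)"
          using P(2) that as by blast+
      qed simp
      then show ?thesis unfolding D_def by blast
    qed
    show "D F' \<subseteq> D F" if "F \<subseteq> F'" for F F' using that by (auto simp: D_def)
  qed
  then obtain r where r: "\<And>F. finite F \<Longrightarrow> r \<in> D F" by blast
  have "natural_at r x y z" for x y z using r[of "{(x, y, z)}"] by (simp add: D_def)
  then show ?thesis by (auto simp: natural_orderings_eq)
qed

section \<open>Density of normal subgroups\<close>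

lemma automorphismD:
  assumes "f \<in> boolean_automorphisms"
  shows "f (inf x y) = inf (f x) (f y)" "f (sup x y) = sup (f x) (f y)" "f (- x) = - f x"
    "f bot = bot" "f top_class.top = top_class.top" "f (x - y) = f x - f y"
    "inv_into UNIV f (f x) = x" "f (inv_into UNIV f x) = x" "f x = f y \<longleftrightarrow> x = y" "f x \<le> f y \<longleftrightarrow> x \<le> y"
    "f x = bot \<longleftrightarrow> x = bot"
proof -
  have f: "bij f" "\<And>x y. f (inf x y) = inf (f x) (f y)" "\<And>x y. f (sup x y) = sup (f x) (f y)"
    "\<And>x. f (- x) = - f x" "f bot = bot" "f top_class.top = top_class.top"
    using assms by (auto simp: boolean_automorphisms_def)
  then show "f (inf x y) = inf (f x) (f y)" "f (sup x y) = sup (f x) (f y)" "f (- x) = - f x"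
    "f bot = bot" "f top_class.top = top_class.top" by blast+
  show "f (x - y) = f x - f y" by (simp add: diff_eq f)
  show "inv_into UNIV f (f x) = x" "f (inv_into UNIV f x) = x"
    using f(1) by (simp_all add: bij_is_inj bij_is_surj surj_f_inv_f)
  show inj: "f x = f y \<longleftrightarrow> x = y" for x y by (rule inj_eq[OF bij_is_inj[OF f(1)]])
  show "f x \<le> f y \<longleftrightarrow> x \<le> y" unfolding le_iff_inf f(2)[symmetric] inj ..
  show "f x = bot \<longleftrightarrow> x = bot" using inj[of x bot] f(5) by simp
qed

lemma mult_aut_group [simp]: "f \<otimes>\<^bsub>aut_group\<^esub> g = f \<circ> g"
  and one_aut_group [simp]: "\<one>\<^bsub>aut_group\<^esub> = id"
  and carrier_aut_group [simp]: "carrier aut_group = boolean_automorphisms"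
  by (simp_all add: aut_group_def)

lemma inv_aut_group:
  assumes "f \<in> boolean_automorphisms"
  shows "inv\<^bsub>aut_group\<^esub> f = inv_into UNIV f"
proof -
  have f: "f \<in> carrier aut_group" using assms by simp
  have "f \<circ> inv\<^bsub>aut_group\<^esub> f = id"
    using group.r_inv[OF group_aut_group f] by simp
  then have "inv_into UNIV f \<circ> (f \<circ> inv\<^bsub>aut_group\<^esub> f) = inv_into UNIV f" by simp
  then show ?thesis by (simp add: fun_eq_iff automorphismD(7)[OF assms])
qed

locale automorphism_subgroup =
  fixes N :: "('b::boolean_algebra \<Rightarrow> 'b) set"
  assumes subgroup: "subgroup N aut_group"
begin

lemma aut: "f \<in> N \<Longrightarrow> f \<in> boolean_automorphisms"
  using subgroup.subset[OF subgroup] by auto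

lemma id_mem: "id \<in> N"
  using subgroup.one_closed[OF subgroup] by simp

lemma comp_mem: "f \<in> N \<Longrightarrow> g \<in> N \<Longrightarrow> f \<circ> g \<in> N"
  using subgroup.m_closed[OF subgroup, of f g] by simp

lemma inv_mem: "f \<in> N \<Longrightarrow> inv_into UNIV f \<in> N"
  using subgroup.m_inv_closed[OF subgroup, of f] inv_aut_group[OF aut] by simp

end

text \<open>\<open>as\<close> partitions the complement of \<open>c\<close>.\<close>

fun pieces :: "'b::boolean_algebra \<Rightarrow> 'b list \<Rightarrow> bool" where
  "pieces c [] \<longleftrightarrow> c = top_class.top"
| "pieces c (a # as) \<longleftrightarrow> a \<noteq> bot \<and> inf c a = bot \<and> pieces (sup c a) as"

lemma inf_sup_bot_iff: "inf (sup c a) x = bot \<longleftrightarrow> inf c x = bot \<and> inf a x = (bot :: 'b::boolean_algebra)"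
  by (simp add: inf_sup_distrib2 sup_eq_bot_iff)

lemma pieces_iff:
  "pieces c as \<longleftrightarrow> distinct as \<and> bot \<notin> set as \<and> (\<forall>a\<in>set as. inf c a = bot) \<and>
     (\<forall>p\<in>set as. \<forall>q\<in>set as. p \<noteq> q \<longrightarrow> inf p q = bot) \<and>
     (\<forall>x. inf c x = bot \<longrightarrow> (\<forall>p\<in>set as. inf p x = bot) \<longrightarrow> x = bot)"
proof (induction as arbitrary: c)
  case Nil
  have "c = top_class.top" if "\<forall>x. inf c x = bot \<longrightarrow> x = bot"
  proof -
    have "- c = bot" using spec[OF that, of "- c"] inf_compl_bot by blast
    then have "- (- c) = - bot" by (simp only:)
    then show ?thesis by (simp only: double_compl compl_bot_eq)
  qed
  moreover have "\<forall>x. inf top_class.top x = bot \<longrightarrow> x = (bot :: 'a)" by simp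
  ultimately show ?case by (simp only: pieces.simps distinct.simps list.set ball_empty empty_iff simp_thms) blast
next
  case (Cons a as)
  have 1: "distinct (a # as) \<longleftrightarrow> distinct as"
    "(\<forall>p\<in>set (a # as). \<forall>q\<in>set (a # as). p \<noteq> q \<longrightarrow> inf p q = bot) \<longleftrightarrow>
      (\<forall>p\<in>set as. \<forall>q\<in>set as. p \<noteq> q \<longrightarrow> inf p q = bot)"
    if "\<forall>x\<in>set as. inf a x = bot" "a \<noteq> bot"
  proof -
    have "a \<notin> set as" using that by force
    then show "distinct (a # as) \<longleftrightarrow> distinct as" by simp
    have "inf x a = bot" if "x \<in> set as" for x
      using bspec[OF \<open>\<forall>x\<in>set as. inf a x = bot\<close> that] by (subst inf_commute)
    then show "(\<forall>p\<in>set (a # as). \<forall>q\<in>set (a # as). p \<noteq> q \<longrightarrow> inf p q = bot) \<longleftrightarrow>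
      (\<forall>p\<in>set as. \<forall>q\<in>set as. p \<noteq> q \<longrightarrow> inf p q = bot)"
      using that(1) by fastforce
  qed
  have 2: "\<forall>x\<in>set as. inf a x = bot"
    if "distinct (a # as)" "\<forall>p\<in>set (a # as). \<forall>q\<in>set (a # as). p \<noteq> q \<longrightarrow> inf p q = bot"
    using that by fastforce
  have 3: "(\<forall>x. inf (sup c a) x = bot \<longrightarrow> (\<forall>p\<in>set as. inf p x = bot) \<longrightarrow> x = bot) \<longleftrightarrow>
      (\<forall>x. inf c x = bot \<longrightarrow> (\<forall>p\<in>set (a # as). inf p x = bot) \<longrightarrow> x = bot)"
    unfolding inf_sup_bot_iff by auto
  have 4: "(\<forall>x\<in>set as. inf (sup c a) x = bot) \<longleftrightarrow>
      (\<forall>x\<in>set as. inf c x = bot) \<and> (\<forall>x\<in>set as. inf a x = bot)"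
    by (auto simp: inf_sup_bot_iff)
  have 5: "bot \<notin> set (a # as) \<longleftrightarrow> a \<noteq> bot \<and> bot \<notin> set as"
    "(\<forall>x\<in>set (a # as). inf c x = bot) \<longleftrightarrow> inf c a = bot \<and> (\<forall>x\<in>set as. inf c x = bot)"
    by auto
  have aux: "A \<and> I \<and> D \<and> B \<and> (J \<and> H) \<and> P \<and> C \<longleftrightarrow> D' \<and> (A \<and> B) \<and> (I \<and> J) \<and> P' \<and> C"
    if "H \<Longrightarrow> A \<Longrightarrow> D' \<longleftrightarrow> D" "H \<Longrightarrow> A \<Longrightarrow> P' \<longleftrightarrow> P" "D' \<Longrightarrow> P' \<Longrightarrow> H"
    for A B C D H I J P D' P' :: bool
    using that by blast
  show ?case
    unfolding pieces.simps Cons.IH 3 4 5 by (rule aux) (fact 1 2)+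
qed

lemma pieces_bot_iff: "pieces bot as \<longleftrightarrow> distinct as \<and> bpartition (set as)"
  unfolding pieces_iff bpartition_def by auto

lemma pieces_map:
  assumes "f \<in> boolean_automorphisms"
  shows "pieces c as \<Longrightarrow> pieces (f c) (map f as)"
proof (induction as arbitrary: c)
  case (Cons a as)
  then have "pieces (f (sup c a)) (map f as)" "inf (f c) (f a) = f bot"
    by (simp_all add: automorphismD(1)[OF assms, symmetric])
  then show ?case using Cons.prems by (simp add: automorphismD[OF assms])
qed (simp add: automorphismD[OF assms])

section \<open>Moving partitions by permutations of the natural numbers\<close>

lemma infinite_bij_betw:
  fixes A B :: "nat set"
  assumes "infinite A" "infinite B"
  shows "\<exists>f. bij_betw f A B"
  using bij_betw_trans[OF to_nat_on_infinite bij_betw_from_nat_into, of A B] assms by blast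

lemma abs_eq_bot_iff: "abs_pow_mod_fin X = bot \<longleftrightarrow> finite X"
  by (simp add: bot_pow_mod_fin_def pow_mod_fin.abs_eq_iff eq_mod_fin_def)

lemma abs_le_iff: "abs_pow_mod_fin X \<le> abs_pow_mod_fin Y \<longleftrightarrow> finite (X - Y)"
  by (rule less_eq_pow_mod_fin.abs_eq)

lemma pow_mod_fin_rep_below:
  assumes "x \<le> abs_pow_mod_fin Y"
  obtains X where "x = abs_pow_mod_fin X" "X \<subseteq> Y"
proof -
  obtain Z where Z: "x = abs_pow_mod_fin Z" using pow_mod_fin.abs_induct[of "\<lambda>x. \<exists>Z. x = abs_pow_mod_fin Z" x] by blast
  then have "finite (Z - Y)" using assms abs_le_iff by simp
  moreover have "Z - Z \<inter> Y = Z - Y" "Z \<inter> Y - Z = {}" by auto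
  ultimately have "eq_mod_fin Z (Z \<inter> Y)"
    by (simp only: eq_mod_fin_def finite.emptyI simp_thms)
  then have "x = abs_pow_mod_fin (Z \<inter> Y)" using Z pow_mod_fin.abs_eq_iff by simp
  then show thesis by (rule that) simp
qed

lemma pow_mod_fin_rep:
  obtains X where "x = abs_pow_mod_fin X"
  using pow_mod_fin.abs_induct[of "\<lambda>x. \<exists>Z. x = abs_pow_mod_fin Z" x] by blast

lemma atomless:
  fixes x :: pow_mod_fin
  assumes "x \<noteq> bot"
  obtains u v where "u \<noteq> bot" "v \<noteq> bot" "inf u v = bot" "sup u v = x"
proof -
  obtain X where X: "x = abs_pow_mod_fin X" by (rule pow_mod_fin_rep)
  then have "infinite X" using assms abs_eq_bot_iff by simp
  then obtain g where g: "bij_betw g (UNIV :: nat set) X"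
    using infinite_bij_betw[OF infinite_UNIV_nat] by blast
  then have inj: "inj g" and im: "range g = X" by (auto simp: bij_betw_def)
  let ?U = "g ` range (\<lambda>n. 2 * n)" and ?V = "g ` range (\<lambda>n. Suc (2 * n))"
  have "infinite ?U" "infinite ?V"
    by (auto intro!: range_inj_infinite simp: image_image inj_on_def inj_eq[OF inj])
  moreover have "?U \<inter> ?V = {}"
    by (auto simp: inj_eq[OF inj]) presburger
  moreover have "?U \<union> ?V = X"
  proof -
    have "n \<in> range (\<lambda>n. 2 * n) \<or> n \<in> range (\<lambda>n. Suc (2 * n))" for n :: nat
      by (cases "even n") (auto elim!: evenE oddE)
    then show ?thesis using im by blast
  qed
  ultimately show thesis
    by (intro that[of "abs_pow_mod_fin ?U" "abs_pow_mod_fin ?V"])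
      (simp_all only: abs_eq_bot_iff inf_pow_mod_fin.abs_eq sup_pow_mod_fin.abs_eq X finite.emptyI not_False_eq_True)
qed

lemma T_omega_star_aut: "h \<in> T_omega_star \<Longrightarrow> h \<in> boolean_automorphisms"
  by (auto simp: T_omega_star_def T_omega_star_automorphism)

text \<open>Unless \<open>a\<close> and \<open>b\<close> both equal \<open>- c\<close>, a
  permutation is glued from the identity on \<open>C\<close>, a bijection from \<open>A\<close> to
  \<open>B\<close> and one between the remainders. The hypothesis on \<open>top\<close> makes both
  remainders infinite.\<close>

lemma T_omega_star_move:
  fixes a b c :: pow_mod_fin
  assumes ab: "a \<noteq> bot" "b \<noteq> bot" "inf c a = bot" "inf c b = bot"
    and top: "sup c a = top_class.top \<longleftrightarrow> sup c b = top_class.top"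
  shows "\<exists>h\<in>T_omega_star. h a = b \<and> (\<forall>x\<le>c. h x = x)"
proof (cases "sup c a = top_class.top")
  case True
  then have "a = - c" "b = - c"
    using ab top by (metis compl_unique inf_commute sup_commute)+
  moreover have "id \<in> T_omega_star"
    using subgroup.one_closed[OF subgroup_T_omega_star] by simp
  ultimately show ?thesis by (intro bexI[of _ id]) auto
next
  case False
  obtain C where C: "c = abs_pow_mod_fin C" by (rule pow_mod_fin_rep)
  have neg: "- c = abs_pow_mod_fin (- C)" by (simp add: C uminus_pow_mod_fin.abs_eq)
  have "a \<le> abs_pow_mod_fin (- C)" "b \<le> abs_pow_mod_fin (- C)"
    using ab(3,4) unfolding neg[symmetric] by (simp_all add: inf_shunt[symmetric] inf_commute)
  \<comment> \<open>Representatives inside \<open>- C\<close> are strictly disjoint from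
    \<open>C\<close>, not just modulo finite sets, so the three bijections fit together
    exactly.\<close>
  then obtain A B where A: "a = abs_pow_mod_fin A" "A \<subseteq> - C" and B: "b = abs_pow_mod_fin B" "B \<subseteq> - C"
    by (meson pow_mod_fin_rep_below)
  let ?A = "- (C \<union> A)" and ?B = "- (C \<union> B)"
  have inf: "infinite A" "infinite B" using ab(1,2) A B abs_eq_bot_iff by simp_all
  have top_iff: "abs_pow_mod_fin X = top_class.top \<longleftrightarrow> finite (- X)" for X
    by (simp add: top_pow_mod_fin_def pow_mod_fin.abs_eq_iff eq_mod_fin_def Compl_eq_Diff_UNIV)
  have inf': "infinite ?A" "infinite ?B"
    using False top unfolding C A(1) B(1) sup_pow_mod_fin.abs_eq top_iff by blast+
  obtain f g where f: "bij_betw f A B" and g: "bij_betw g ?A ?B"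
    using infinite_bij_betw inf inf' by metis
  define k where "k n = (if n \<in> C then n else if n \<in> A then f n else g n)" for n
  have "k n = n" if "n \<in> C" for n using that by (simp add: k_def)
  then have kC: "bij_betw k C C" using bij_betw_cong[of C k id C] bij_betw_id[of C] by simp
  have "k n = f n" if "n \<in> A" for n using that A(2) by (auto simp: k_def)
  then have kA: "bij_betw k A B" using bij_betw_cong[of A k f B] f by simp
  have "k n = g n" if "n \<in> ?A" for n using that by (simp add: k_def)
  then have kA': "bij_betw k ?A ?B" using bij_betw_cong[of ?A k g ?B] g by simp
  have disj: "C \<inter> B = {}" "(C \<union> B) \<inter> ?B = {}" using B(2) by auto
  have "bij_betw k (C \<union> A \<union> ?A) (C \<union> B \<union> ?B)"
    by (rule bij_betw_combine[OF bij_betw_combine[OF kC kA disj(1)] kA' disj(2)])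
  then have "bij_betw k UNIV UNIV" by (simp only: Compl_partition)
  then have T: "(UNIV, k) \<in> T_omega" unfolding T_omega_def by (auto intro!: exI[of _ UNIV])
  have im: "k ` A = B" using kA by (rule bij_betw_imp_surj_on)
  have "induced_map (UNIV, k) x = x" if xc: "x \<le> c" for x
  proof -
    obtain X where X: "x = abs_pow_mod_fin X" "X \<subseteq> C"
      by (rule pow_mod_fin_rep_below[OF xc[unfolded C]])
    have "k ` X = X" using X(2) by (force simp: k_def)
    then show ?thesis by (simp add: X induced_map_abs)
  qed
  moreover have "induced_map (UNIV, k) a = b" using im by (simp add: A(1) B(1) induced_map_abs)
  ultimately show ?thesis using T by (auto simp: T_omega_star_def)
qed

text \<open>The pieces are moved one at a time. Each later map fixes everything below
  \<open>sup c b\<close> and so does not disturb the pieces already in place.\<close>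

lemma T_omega_star_pieces:
  assumes "pieces c as" "pieces c bs" "length as = length (bs :: pow_mod_fin list)"
  shows "\<exists>h\<in>T_omega_star. map h as = bs \<and> (\<forall>x\<le>c. h x = x)"
  using assms
proof (induction bs arbitrary: c as)
  case Nil
  have "id \<in> T_omega_star" using subgroup.one_closed[OF subgroup_T_omega_star] by simp
  then show ?case using Nil by (intro bexI[of _ id]) auto
next
  case (Cons b bs)
  then obtain a as' where as: "as = a # as'" by (cases as) auto
  have ne: "sup c a \<noteq> top_class.top" if "pieces (sup c a) as" "as \<noteq> []" for a c and as :: "pow_mod_fin list"
    using that by (cases as) auto
  have "sup c a = top_class.top \<longleftrightarrow> sup c b = top_class.top"
  proof (cases "bs = []")
    case True
    then show ?thesis using Cons.prems as by simp
  next
    case False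
    then have "as' \<noteq> []" using Cons.prems as by auto
    then show ?thesis using Cons.prems as False ne by auto
  qed
  then obtain h where h: "h \<in> T_omega_star" "h a = b" "\<And>x. x \<le> c \<Longrightarrow> h x = x"
    using T_omega_star_move[of a b c] Cons.prems as by auto
  note aut = T_omega_star_aut[OF h(1)]
  have "pieces (h (sup c a)) (map h as')" using Cons.prems(1) as by (simp add: pieces_map[OF aut])
  moreover have "h (sup c a) = sup c b" using h(2,3) by (simp add: automorphismD[OF aut])
  ultimately have "pieces (sup c b) (map h as')" by simp
  then obtain h' where h': "h' \<in> T_omega_star" "map h' (map h as') = bs" "\<And>x. x \<le> sup c b \<Longrightarrow> h' x = x"
    using Cons.IH[of "sup c b" "map h as'"] Cons.prems as by auto
  have "h' \<circ> h \<in> T_omega_star"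
    using subgroup.m_closed[OF subgroup_T_omega_star h'(1) h(1)] by simp
  moreover have "map (h' \<circ> h) as = b # bs" using h(2) h'(2,3) as by simp
  moreover have "(h' \<circ> h) x = x" if "x \<le> c" for x using that h(3) h'(3) by (simp add: le_supI1)
  ultimately show ?case by (intro bexI[of _ "h' \<circ> h"] conjI allI impI)
qed


section \<open>Transitivity of normalized subgroups on partitions\<close>

text \<open>Use \<open>y - f y\<close> or, if that is \<open>bot\<close>, \<open>f y - y\<close>: in
  both cases \<open>f y\<close> separates the element from its image.\<close>

lemma automorphism_moves_disjoint:
  assumes f: "f \<in> boolean_automorphisms" "f \<noteq> id"
  shows "\<exists>x. x \<noteq> bot \<and> inf x (f x) = bot"
proof -
  obtain y where y: "f y \<noteq> y" using f(2) by (metis eq_id_iff)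
  show ?thesis
  proof (cases "y \<le> f y")
    case False
    have "f (y - f y) \<le> f y" by (simp add: automorphismD(10)[OF f(1)] diff_eq)
    then have "inf (y - f y) (f (y - f y)) \<le> inf (- f y) (f y)"
      by (intro inf_mono) (simp_all add: diff_eq)
    then have "inf (y - f y) (f (y - f y)) = bot" by (simp add: bot_unique)
    moreover have "y - f y \<noteq> bot" using False by (simp add: diff_eq inf_shunt)
    ultimately show ?thesis by blast
  next
    case True
    then have "\<not> f y \<le> y" using y by (metis order_antisym)
    let ?z = "f y - y"
    have "f y \<le> f (f y)" using True automorphismD(10)[OF f(1)] by blast
    have "inf ?z (f ?z) \<le> inf (f y) (- f y)"
      unfolding automorphismD(6)[OF f(1)] by (intro inf_mono) (simp_all add: diff_eq)
    then have "inf ?z (f ?z) = bot" by (simp add: bot_unique)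
    moreover have "?z \<noteq> bot" using \<open>\<not> f y \<le> y\<close> by (simp add: diff_eq inf_shunt)
    ultimately show ?thesis by blast
  qed
qed

text \<open>What the two kinds of normality have in common: a nontrivial group of automorphisms that
  is normalized by \<open>T_omega_star\<close>, whether or not it lies inside it.\<close>

locale normalized_subgroup = automorphism_subgroup N for N :: "(pow_mod_fin \<Rightarrow> pow_mod_fin) set" +
  assumes conj_mem: "\<And>t f. t \<in> T_omega_star \<Longrightarrow> f \<in> N \<Longrightarrow> t \<circ> f \<circ> inv_into UNIV t \<in> N"
    and nontrivial: "N \<noteq> {id}"
begin

text \<open>Some nontrivial element moves some \<open>z\<close> off itself; conjugating by a
  \<open>t\<close> with \<open>t z = x\<close> transports this to \<open>x\<close>. Such a
  \<open>z\<close> cannot be \<open>top\<close>, so \<open>t\<close> exists.\<close>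

lemma disjoint_mover:
  assumes "x \<noteq> bot" "x \<noteq> top_class.top"
  shows "\<exists>f\<in>N. inf x (f x) = bot"
proof -
  obtain f where f: "f \<in> N" "f \<noteq> id" using nontrivial id_mem by blast
  obtain z where z: "z \<noteq> bot" "inf z (f z) = bot"
    using automorphism_moves_disjoint[OF aut[OF f(1)] f(2)] by blast
  have "z \<noteq> top_class.top" using z automorphismD(5)[OF aut[OF f(1)]] by auto
  then obtain t where t: "t \<in> T_omega_star" "t z = x"
    using T_omega_star_move[of z x bot] z(1) assms by auto
  note ta = T_omega_star_aut[OF t(1)]
  have "(t \<circ> f \<circ> inv_into UNIV t) x = t (f z)" using t(2) automorphismD(7)[OF ta, of z] by simp
  moreover have "inf (t z) (t (f z)) = bot"
    unfolding automorphismD(1)[OF ta, symmetric] z(2) by (rule automorphismD(4)[OF ta])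
  ultimately show ?thesis using conj_mem[OF t(1) f(1)] t(2) by (intro bexI) auto
qed

text \<open>The commutator of \<open>h\<close> with an element moving \<open>x\<close> off itself agrees with \<open>h\<close> below \<open>x\<close>.\<close>

lemma local_agreement:
  assumes "x \<noteq> bot" "x \<noteq> top_class.top" and h: "h \<in> T_omega_star" "\<And>z. z \<le> - x \<Longrightarrow> h z = z"
  shows "\<exists>k\<in>N. \<forall>z\<le>x. k z = h z"
proof -
  obtain f where f: "f \<in> N" "inf x (f x) = bot" using disjoint_mover[OF assms(1,2)] by blast
  note ha = T_omega_star_aut[OF h(1)] and fa = aut[OF f(1)]
  let ?f' = "inv_into UNIV f" and ?h' = "inv_into UNIV h"
  have "(h \<circ> f \<circ> ?h') \<circ> ?f' \<in> N" by (intro comp_mem conj_mem inv_mem h f)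
  moreover have "((h \<circ> f \<circ> ?h') \<circ> ?f') z = h z" if "z \<le> x" for z
  proof -
    \<comment> \<open>As \<open>f\<close> moves \<open>x\<close> off itself, \<open>?f' z\<close>
      lies below \<open>- x\<close>, where \<open>?h'\<close> is the identity; then \<open>f\<close>
      undoes \<open>?f'\<close>.\<close>
    have "f (inf (?f' z) x) = inf z (f x)" by (simp add: automorphismD[OF fa])
    also have "\<dots> \<le> inf x (f x)" using that by (intro inf_mono) simp_all
    finally have "f (inf (?f' z) x) = bot" using f(2) by (simp add: bot_unique)
    then have "inf (?f' z) x = bot" by (simp add: automorphismD(11)[OF fa])
    then have "?f' z \<le> - x" by (simp add: inf_shunt)
    then have "?h' (?f' z) = ?f' z" using h(2) automorphismD(7)[OF ha] by metis
    then show ?thesis by (simp add: automorphismD(8)[OF fa])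
  qed
  ultimately show ?thesis by blast
qed

text \<open>The element \<open>k\<close> of \<open>local_agreement\<close> agrees with \<open>h\<close> only below \<open>- q\<close> and is uncontrolled below \<open>q\<close>.
  Its commutator with some \<open>t\<close> that is the identity below \<open>q\<close> and moves \<open>- u\<close> to \<open>p\<close> removes the
  uncontrolled part.\<close>

lemma transitive_overlapping:
  assumes as: "pieces bot (a # as)" and bs: "pieces bot (b # bs)" and len: "length as = length bs"
    and overlap: "inf a b \<noteq> bot"
  shows "\<exists>g\<in>N. map g (a # as) = b # bs"
proof -
  \<comment> \<open>\<open>u\<close> is to be kept fixed; \<open>w\<close> stays behind in
    \<open>a - u\<close> and in \<open>b - u\<close>, so neither is \<open>bot\<close>.\<close>
  obtain u w where uw: "u \<noteq> bot" "w \<noteq> bot" "inf u w = bot" "sup u w = inf a b"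
    using atomless[OF overlap] by blast
  obtain p q where pq: "p \<noteq> bot" "q \<noteq> bot" "inf p q = bot" "sup p q = u"
    using atomless[OF uw(1)] by blast
  have le: "u \<le> a" "u \<le> b" "w \<le> a" "w \<le> b" "p \<le> u" "q \<le> u" "w \<le> - u"
  proof -
    have "sup u w \<le> a" "sup u w \<le> b" unfolding uw(4) by simp_all
    then show "u \<le> a" "u \<le> b" "w \<le> a" "w \<le> b" by (simp_all only: le_sup_iff)
    show "p \<le> u" "q \<le> u" unfolding pq(4)[symmetric] by simp_all
    show "w \<le> - u" using uw(3) by (simp only: inf_shunt[symmetric] inf_commute[of w])
  qed
  have minus: "a - u \<noteq> bot" if "w \<le> a" for a
  proof
    assume "a - u = bot"
    then have "w \<le> u" using that by (simp add: diff_eq inf_shunt order_trans)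
    then show False using uw(2,3) le_inf_bot[of w u] by (simp add: inf_commute)
  qed
  have split: "pieces u ((a - u) # as)" if "pieces bot (a # as)" "u \<le> a" "w \<le> a" for a as
  proof -
    have "inf u (a - u) = bot" by (simp add: diff_eq inf_left_commute)
    moreover have "sup u (a - u) = a" using that(2) by (simp add: diff_eq sup_inf_distrib1 sup_absorb2)
    ultimately show ?thesis using that minus by simp
  qed
  obtain h where h: "h \<in> T_omega_star" "map h ((a - u) # as) = (b - u) # bs" "\<And>x. x \<le> u \<Longrightarrow> h x = x"
    using T_omega_star_pieces[OF split[OF as le(1,3)] split[OF bs le(2,4)]] len by auto
  note ha = T_omega_star_aut[OF h(1)]
  have ne: "- q \<noteq> bot" "- q \<noteq> top_class.top" "- u \<noteq> bot"
  proof -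
    have "p \<le> - q" using pq(3) by (simp add: inf_shunt)
    then show "- q \<noteq> bot" using pq(1) by (auto simp: bot_unique)
    show "- q \<noteq> top_class.top" using pq(2) by (metis compl_top_eq double_compl)
    show "- u \<noteq> bot" using le(7) uw(2) by (auto simp: bot_unique)
  qed
  obtain k where k: "k \<in> N" "\<And>z. z \<le> - q \<Longrightarrow> k z = h z"
    using local_agreement[OF ne(1,2) h(1)] h(3) le(6) by (metis double_compl order_trans)
  note ka = aut[OF k(1)]
  have qu: "inf q (- u) = bot" "inf q p = bot" using le(6) pq(3) by (simp_all add: inf_shunt inf_commute)
  have supq: "sup q (- u) \<noteq> top_class.top"
  proof
    assume "sup q (- u) = top_class.top"
    then have "p \<le> sup q (- u)" by simp
    moreover have "inf p (sup q (- u)) = bot"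
      using pq(3) le(5) by (simp add: inf_sup_distrib1 inf_shunt)
    ultimately show False using pq(1) le_inf_bot by blast
  qed
  have "sup q p \<noteq> top_class.top" using pq(4) ne(3) by (auto simp: sup_commute)
  then obtain t where t: "t \<in> T_omega_star" "t (- u) = p" "\<And>x. x \<le> q \<Longrightarrow> t x = x"
    using T_omega_star_move[OF ne(3) pq(1) qu] supq by blast
  note ta = T_omega_star_aut[OF t(1)]
  have "- q = sup (- u) p"
  proof -
    have "sup (- u) p = sup p (inf (- p) (- q))" unfolding pq(4)[symmetric] compl_sup by (rule sup_commute)
    also have "\<dots> = inf (sup p (- p)) (sup p (- q))" by (rule sup_inf_distrib1)
    also have "\<dots> = sup p (- q)" by (simp only: sup_compl_top inf_top_left)
    also have "\<dots> = - q" using pq(3) by (simp add: inf_shunt sup_absorb2)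
    finally show ?thesis ..
  qed
  note q_compl = this
  have "- t q = t (- q)" by (rule automorphismD(3)[OF ta, symmetric])
  also have "\<dots> = sup (t (- u)) (t p)" unfolding q_compl by (rule automorphismD(2)[OF ta])
  finally have sup_tp: "sup p (t p) = - q" using t(2) t(3)[OF order_refl] by (simp only:)
  have "inf (t p) (t (- u)) = t (inf p (- u))" by (rule automorphismD(1)[OF ta, symmetric])
  also have "inf p (- u) = bot" using le(5) by (simp only: inf_shunt double_compl)
  finally have "inf (t p) p = bot" unfolding t(2) automorphismD(4)[OF ta] .
  then have le_tp: "t p \<le> - p" by (simp only: inf_shunt)
  \<comment> \<open>\<open>- u\<close>, \<open>p\<close> and \<open>q\<close> partition
    \<open>top\<close>; \<open>t\<close> fixes \<open>q\<close> and sends \<open>- u\<close> to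
    \<open>p\<close>, so only \<open>- u\<close> is left as the image of \<open>p\<close>.\<close>
  have tp: "t p = - u"
  proof -
    have "- u = inf (- p) (- q)" unfolding pq(4)[symmetric] by (rule compl_sup)
    also have "\<dots> = sup (inf (- p) p) (inf (- p) (t p))"
      unfolding sup_tp[symmetric] by (rule inf_sup_distrib1)
    also have "\<dots> = t p" using le_tp by (simp add: inf_absorb2)
    finally show ?thesis ..
  qed
  let ?k' = "inv_into UNIV k" and ?t' = "inv_into UNIV t"
  \<comment> \<open>Below \<open>- u\<close> the factor \<open>?t'\<close> leads into
    \<open>p\<close>, where \<open>k\<close> is the identity, so \<open>g\<close> acts as
    \<open>h\<close>. On \<open>u\<close> it is enough that \<open>g\<close> fixes the two elements
    \<open>p\<close> and \<open>q\<close>, whose join is \<open>u\<close>.\<close>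
  define g where "g = k \<circ> (t \<circ> ?k' \<circ> ?t')"
  have gN: "g \<in> N" unfolding g_def by (intro comp_mem conj_mem inv_mem t k)
  note ga = aut[OF gN]
  have inv: "?t' z = y" if "t y = z" for y z using automorphismD(7)[OF ta] that by blast
  have invk: "?k' z = y" if "k y = z" for y z using automorphismD(7)[OF ka] that by blast
  have uq: "- u \<le> - q" "p \<le> - q" using le(6) pq(3) by (simp_all add: inf_shunt)
  have gh: "g z = h z" if "z \<le> - u" for z
  proof -
    have "t (?t' z) \<le> t p" using that tp by (simp add: automorphismD(8)[OF ta])
    then have "?t' z \<le> p" by (simp add: automorphismD(10)[OF ta])
    then have "k (?t' z) = ?t' z" using k(2) h(3) uq(2) le(5) by (metis order_trans)
    then have "?k' (?t' z) = ?t' z" by (rule invk)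
    then have "g z = k z" by (simp add: g_def automorphismD(8)[OF ta])
    also have "\<dots> = h z" using that uq(1) by (intro k(2)) (rule order_trans)
    finally show ?thesis .
  qed
  have hu: "h u = u" "h q = q" "h p = p" using h(3) le(5,6) by auto
  have "k (- u) = - u" using k(2)[OF uq(1)] hu(1) by (simp add: automorphismD(3)[OF ha])
  moreover have "k p = p" using k(2)[OF uq(2)] hu(3) by simp
  ultimately have gp: "g p = p" using inv[OF t(2)] invk[of "- u" "- u"] t(2) by (simp add: g_def)
  have "k (- q) = - q" using k(2)[of "- q"] hu(2) by (simp add: automorphismD(3)[OF ha])
  then have "k q = q" using automorphismD(3)[OF ka, of q] by (metis double_compl)
  moreover have "t q = q" using t(3) by simp
  ultimately have gq: "g q = q" using inv[of q q] invk[of q q] by (simp add: g_def)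
  have gu: "g u = u" using gp gq pq(4) automorphismD(2)[OF ga, of p q] by simp
  have "g a = b"
  proof -
    have "g a = sup (g (a - u)) (g u)"
      using le(1) by (simp add: automorphismD(2)[OF ga, symmetric] diff_eq sup_inf_distrib2 sup_absorb1)
    also have "g (a - u) = b - u" using h(2) gh[of "a - u"] by (simp add: diff_eq)
    also have "sup (b - u) (g u) = b"
      using le(2) gu by (simp add: diff_eq sup_inf_distrib2 sup_absorb1)
    finally show ?thesis .
  qed
  moreover have gh_as: "g c = h c" if "c \<in> set as" for c
  proof (rule gh)
    have "pieces a as" using as by simp
    then have "inf a c = bot" using that unfolding pieces_iff by blast
    then have "inf u c \<le> bot" using inf_mono[OF le(1) order_refl, of c] by (simp only:)
    then have "inf c u = bot" by (simp only: bot_unique inf_commute)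
    then show "c \<le> - u" by (simp only: inf_shunt)
  qed
  ultimately have "map g (a # as) = b # bs" using h(2) by (auto cong: map_cong)
  then show ?thesis using gN by (intro bexI[of _ g])
qed

text \<open>If the first pieces are disjoint, the way leads through a partition starting with
  \<open>sup u b\<close>, where \<open>u\<close> is one part of \<open>a\<close>: it meets both
  \<open>a\<close> and \<open>b\<close>, and the other part \<open>v\<close> of \<open>a\<close>
  keeps it from being \<open>top\<close>. Its remaining pieces are images under some
  \<open>h\<close> in \<open>T_omega_star\<close>.\<close>

lemma transitive:
  assumes as: "pieces bot as" and bs: "pieces bot bs" and len: "length as = length bs"
  shows "\<exists>g\<in>N. map g as = bs"
proof (cases as)
  case Nil
  then show ?thesis using len id_mem by (intro bexI[of _ id]) auto
next
  case (Cons a as')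
  then obtain b bs' where b: "bs = b # bs'" using len by (cases bs) auto
  show ?thesis
  proof (cases "inf a b = bot")
    case False
    then show ?thesis using transitive_overlapping as bs len Cons b by simp
  next
    case True
    have ne: "a \<noteq> bot" "b \<noteq> bot" using as bs Cons b by auto
    obtain u v where uv: "u \<noteq> bot" "v \<noteq> bot" "inf u v = bot" "sup u v = a" using atomless[OF ne(1)] by blast
    have "u \<le> a" "v \<le> a" using uv(4) by auto
    then have vb: "inf v b = bot" using True by (metis bot_unique inf_mono order_refl)
    have "sup u b \<noteq> top_class.top"
    proof
      assume "sup u b = top_class.top"
      then have "v \<le> sup u b" by simp
      moreover have "inf v (sup u b) = bot" using uv(3) vb by (simp add: inf_sup_distrib1 inf_commute)
      ultimately show False using uv(2) le_inf_bot by blast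
    qed
    moreover have "a \<noteq> top_class.top" using True ne by auto
    ultimately obtain h where h: "h \<in> T_omega_star" "h a = sup u b"
      using T_omega_star_move[of a "sup u b" bot] ne by auto
    have c: "pieces bot (sup u b # map h as')"
      using pieces_map[OF T_omega_star_aut[OF h(1)] as] h(2) Cons
      by (simp add: automorphismD(4)[OF T_omega_star_aut[OF h(1)]])
    have "inf a (sup u b) = u"
      using \<open>u \<le> a\<close> True by (simp add: inf_sup_distrib1 inf_absorb2)
    then obtain g where g: "g \<in> N" "map g (a # as') = sup u b # map h as'"
      using transitive_overlapping[OF as[unfolded Cons] c] uv(1) by auto
    have "inf (sup u b) b = b" by (simp add: inf_absorb2)
    then obtain g' where g': "g' \<in> N" "map g' (sup u b # map h as') = b # bs'"
      using transitive_overlapping[OF c bs[unfolded b]] ne(2) len Cons b by auto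
    have "map (g' \<circ> g) as = bs" unfolding Cons b g'(2)[symmetric] g(2)[symmetric] by simp
    then show ?thesis using comp_mem[OF g'(1) g(1)] by blast
  qed
qed

end

lemma normal_normalized_subgroup:
  assumes "N \<lhd> (aut_group\<lparr>carrier := T_omega_star\<rparr>) \<or> N \<lhd> aut_group" "N \<noteq> {id}"
  shows "normalized_subgroup N"
proof -
  have "subgroup N aut_group \<and> (\<forall>t\<in>T_omega_star. \<forall>f\<in>N. t \<circ> f \<circ> inv_into UNIV t \<in> N)"
    using assms(1)
  proof
    assume n: "N \<lhd> (aut_group\<lparr>carrier := T_omega_star\<rparr>)"
    have "t \<circ> f \<circ> inv_into UNIV t \<in> N" if "t \<in> T_omega_star" "f \<in> N" for t f
      using normal.inv_op_closed2[OF n, of t f] that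
        group.m_inv_consistent[OF group_aut_group subgroup_T_omega_star that(1)]
        inv_aut_group[OF T_omega_star_aut[OF that(1)]]
      by (simp add: aut_group_def)
    moreover have "subgroup N aut_group"
      by (rule group.incl_subgroup[OF group_aut_group subgroup_T_omega_star])
        (use n in \<open>simp add: normal_def\<close>)
    ultimately show ?thesis by blast
  next
    assume n: "N \<lhd> aut_group"
    have "t \<circ> f \<circ> inv_into UNIV t \<in> N" if "t \<in> T_omega_star" "f \<in> N" for t f
      using normal.inv_op_closed2[OF n, of t f] that T_omega_star_aut[OF that(1)]
        inv_aut_group[OF T_omega_star_aut[OF that(1)]]
      by simp
    then show ?thesis using n by (simp add: normal_def)
  qed
  then show ?thesis
    using assms(2)
    unfolding normalized_subgroup_def normalized_subgroup_axioms_def automorphism_subgroup_def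
    by blast
qed

section \<open>Coarsenings of partitions\<close>

text \<open>Words code coarsenings: position \<open>j\<close> of \<open>w\<close> holds the number
  of the class into which \<open>C ! j\<close> is merged. Substitution of words then becomes
  repeated coarsening, see \<open>block_block\<close>.\<close>

definition block :: "nat list \<Rightarrow> 'b::boolean_algebra list \<Rightarrow> nat \<Rightarrow> 'b" where
  "block w C i = fsup {C ! j | j. j < length C \<and> w ! j = i}"

lemma finite_block_set: "finite {C ! j | j. j < length C \<and> w ! j = i}"
  by (rule finite_subset[of _ "set C"]) auto

lemma pieces_bpartition: "pieces bot C \<Longrightarrow> bpartition (set C)"
  by (simp add: pieces_bot_iff)

lemma block_spanned:
  assumes "pieces bot C"
  shows "block w C i \<in> spanned (set C)"
  unfolding block_def
  by (rule fsup_spanned[OF finite_block_set])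
    (use partition_in_spanned[OF pieces_bpartition[OF assms]] in auto)

lemma le_block_iff:
  assumes C: "pieces bot C" and j: "j < length C"
  shows "C ! j \<le> block w C i \<longleftrightarrow> w ! j = i"
proof -
  note P = pieces_bpartition[OF C]
  have sub: "{C ! j | j. j < length C \<and> w ! j = i} \<subseteq> set C" by auto
  have "C ! j \<le> block w C i \<longleftrightarrow> (\<exists>a\<in>{C ! j | j. j < length C \<and> w ! j = i}. C ! j \<le> a)"
    unfolding block_def using sub partition_in_spanned[OF P] j
    by (intro partition_le_fsup[OF P _ finite_block_set]) auto
  also have "\<dots> \<longleftrightarrow> (\<exists>j'. j' < length C \<and> w ! j' = i \<and> C ! j \<le> C ! j')" by blast
  also have "\<dots> \<longleftrightarrow> w ! j = i"
  proof -
    have "C ! j \<le> C ! j' \<longleftrightarrow> j = j'" if "j' < length C" for j'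
      using partition_le_simps(6)[OF P nth_mem[OF j] nth_mem[OF that]]
        nth_eq_iff_index_eq[of C j j'] C j that by (simp add: pieces_bot_iff)
    then show ?thesis using j by metis
  qed
  finally show ?thesis .
qed

lemma block_eqI:
  assumes "pieces bot C" "x \<in> spanned (set C)" "\<And>j. j < length C \<Longrightarrow> C ! j \<le> x \<longleftrightarrow> w ! j = i"
  shows "x = block w C i"
  using assms by (intro spanned_eqI[OF pieces_bpartition[OF assms(1)]])
    (auto simp: block_spanned le_block_iff in_set_conv_nth)

lemma param_word_supset: "param_word a k w \<Longrightarrow> {a..<a + k} \<subseteq> set w"
proof (induction a k w rule: param_word.induct)
  case (2 a k x w)
  then consider "param_word a k w" "{a..<a + k} \<subseteq> set w"
    | "x = a" "0 < k" "{Suc a..<Suc a + (k - 1)} \<subseteq> set w" by auto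
  then show ?case
  proof cases
    case 2
    then have "{a..<a + k} = insert a {Suc a..<Suc a + (k - 1)}" by auto
    then show ?thesis using 2 by auto
  qed auto
qed simp

lemma pieces_blocks:
  assumes C: "pieces bot C" and w: "length w = length C" "param_word 0 k w"
  shows "pieces bot (map (block w C) [0..<k])"
proof -
  note P = pieces_bpartition[OF C]
  have occ: "\<exists>j<length C. w ! j = i" if "i < k" for i
  proof -
    have "i \<in> set w" using param_word_supset[OF w(2)] that by auto
    then show ?thesis using w(1) by (auto simp: in_set_conv_nth)
  qed
  have disj: "inf (block w C i) (block w C i') = bot" if "i \<noteq> i'" for i i'
  proof (rule spanned_eqI[OF P])
    show "inf (block w C i) (block w C i') \<in> spanned (set C)"
      by (intro spanned_closed block_spanned C)
    show "bot \<in> spanned (set C)" by (rule spanned_closed)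
    fix p assume "p \<in> set C"
    then obtain j where j: "j < length C" "p = C ! j" by (auto simp: in_set_conv_nth)
    then have "\<not> p \<le> bot" using partition_le_simps(1)[OF P \<open>p \<in> set C\<close>] by simp
    moreover have "\<not> p \<le> inf (block w C i) (block w C i')"
      using le_block_iff[OF C j(1)] j(2) that by simp
    ultimately show "p \<le> inf (block w C i) (block w C i') \<longleftrightarrow> p \<le> bot" by blast
  qed
  have ne: "block w C i \<noteq> bot" if i: "i < k" for i
  proof -
    obtain j where j: "j < length C" "w ! j = i" using occ[OF i] by blast
    then have "C ! j \<le> block w C i" using le_block_iff[OF C] by blast
    then show ?thesis using partition_le_simps(1)[OF P nth_mem[OF j(1)]] by auto
  qed
  have inj: "i = i'" if "block w C i = block w C i'" "i < k" for i i'
    using disj[of i i'] ne[OF that(2)] that(1) by auto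
  have "distinct (map (block w C) [0..<k])"
    by (auto simp: distinct_map intro!: inj_onI dest: inj)
  moreover have "bpartition (set (map (block w C) [0..<k]))"
    unfolding bpartition_def
  proof (intro conjI ballI impI allI)
    show "bot \<notin> set (map (block w C) [0..<k])"
    proof
      assume "bot \<in> set (map (block w C) [0..<k])"
      then obtain i where "i < k" "block w C i = bot" by auto
      then show False using ne by blast
    qed
    show "inf p q = bot" if pq: "p \<in> set (map (block w C) [0..<k])" "q \<in> set (map (block w C) [0..<k])"
      "p \<noteq> q" for p q
    proof -
      obtain i i' where "p = block w C i" "q = block w C i'" using pq by auto
      then show ?thesis using disj[of i i'] pq(3) by auto
    qed
    fix x assume x: "\<forall>p\<in>set (map (block w C) [0..<k]). inf p x = bot"
    show "x = bot"
    proof (rule bpartitionD(4)[OF P])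
      fix p assume "p \<in> set C"
      then obtain j where j: "j < length C" "p = C ! j" by (auto simp: in_set_conv_nth)
      have "w ! j < k" using param_word_set[OF w(2)] j(1) w(1) nth_mem[of j w] by (auto simp del: nth_mem)
      then have "inf (block w C (w ! j)) x = bot" using x by simp
      moreover have "p \<le> block w C (w ! j)" using le_block_iff[OF C j(1)] j(2) by simp
      ultimately show "inf p x = bot" by (metis bot_unique inf_mono order_refl)
    qed
  qed simp
  ultimately show ?thesis by (simp add: pieces_bot_iff)
qed

text \<open>The piece \<open>C ! j\<close> lies in class \<open>t ! j\<close> of the first
  coarsening, hence in class \<open>s ! (t ! j)\<close> of the second. This turns the Ramsey theorem
  on words into one on partitions.\<close>

lemma block_block:
  assumes C: "pieces bot C" and t: "length t = length C" "param_word 0 m t" and s: "length s = m"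
  shows "block s (map (block t C) [0..<m]) i = block (plug 0 s t) C i"
proof (rule block_eqI[OF C])
  let ?B = "map (block t C) [0..<m]"
  note P = pieces_bpartition[OF C]
  have sub: "{?B ! j | j. j < length ?B \<and> s ! j = i} \<subseteq> spanned (set C)"
    using block_spanned[OF C] by auto
  show "block s ?B i \<in> spanned (set C)"
    unfolding block_def by (rule fsup_spanned[OF finite_block_set sub[unfolded block_def]])
  fix j assume j: "j < length C"
  have tj: "t ! j < m" using param_word_set[OF t(2)] j t(1) nth_mem[of j t] by (auto simp del: nth_mem)
  have "C ! j \<le> block s ?B i \<longleftrightarrow> (\<exists>a\<in>{?B ! j | j. j < length ?B \<and> s ! j = i}. C ! j \<le> a)"
    unfolding block_def[of s] by (rule partition_le_fsup[OF P nth_mem[OF j] finite_block_set sub])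
  also have "\<dots> \<longleftrightarrow> (\<exists>l<m. s ! l = i \<and> C ! j \<le> block t C l)" by auto
  also have "\<dots> \<longleftrightarrow> s ! (t ! j) = i" using le_block_iff[OF C j] tj by auto
  also have "\<dots> \<longleftrightarrow> plug 0 s t ! j = i" using j t(1) by (simp add: plug_0)
  finally show "C ! j \<le> block s ?B i \<longleftrightarrow> plug 0 s t ! j = i" .
qed

lemma automorphism_fsup:
  assumes "f \<in> boolean_automorphisms" "finite A"
  shows "f (fsup A) = fsup (f ` A)"
  using assms(2)
  by (induction A rule: finite_induct)
    (simp_all add: fsup_insert automorphismD(2,4)[OF assms(1)])

lemma automorphism_block:
  assumes "f \<in> boolean_automorphisms"
  shows "f (block s b i) = block s (map f b) i"
proof -
  have "f ` {b ! j | j. j < length b \<and> s ! j = i} = {map f b ! j | j. j < length (map f b) \<and> s ! j = i}"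
    by (auto simp: image_iff) (metis nth_map)
  then show ?thesis unfolding block_def automorphism_fsup[OF assms finite_block_set] by simp
qed

text \<open>A criterion by positions, for words that are read off from a partition and not built
  letter by letter. By the third assumption the first letter cannot exceed \<open>a\<close>, which
  settles each step of the recursion.\<close>

lemma param_wordI:
  "set s \<subseteq> {..<a + k} \<Longrightarrow> {a..<a + k} \<subseteq> set s \<Longrightarrow>
    (\<And>i j. j < length s \<Longrightarrow> a \<le> i \<Longrightarrow> i < s ! j \<Longrightarrow> \<exists>j'<j. s ! j' = i) \<Longrightarrow> param_word a k s"
proof (induction s arbitrary: a k)
  case (Cons x s)
  have tail: "\<exists>j'<j. s ! j' = i" if "j < length s" "a \<le> i" "i < s ! j" "i \<noteq> x" for i j
  proof -
    have "\<exists>j'<Suc j. (x # s) ! j' = i"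
      by (rule Cons.prems(3)) (use that in simp_all)
    then obtain j' where j': "j' < Suc j" "(x # s) ! j' = i" by blast
    then have "j' \<noteq> 0" using that(4) by (cases j') auto
    then show ?thesis using j' by (cases j') auto
  qed
  have "x \<le> a" using Cons.prems(3)[of 0 a] by force
  then consider "x < a" | "x = a" by linarith
  then show ?case
  proof cases
    case 1
    have "set s \<subseteq> {..<a + k}" "{a..<a + k} \<subseteq> set s" using Cons.prems(1,2) 1 by auto
    then have "param_word a k s"
    proof (rule Cons.IH)
      show "\<exists>j'<j. s ! j' = i" if "j < length s" "a \<le> i" "i < s ! j" for i j
        using tail[OF that] 1 that(2) by simp
    qed
    with 1 show ?thesis by simp
  next
    case 2
    then have k: "0 < k" using Cons.prems(1) by auto
    have "{Suc a..<Suc a + (k - 1)} \<subseteq> {a..<a + k} - {a}" using k by auto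
    then have "set s \<subseteq> {..<Suc a + (k - 1)}" "{Suc a..<Suc a + (k - 1)} \<subseteq> set s"
      using Cons.prems(1,2) 2 k by auto
    then have "param_word (Suc a) (k - 1) s"
    proof (rule Cons.IH)
      show "\<exists>j'<j. s ! j' = i" if "j < length s" "Suc a \<le> i" "i < s ! j" for i j
        using tail[OF that(1) _ that(3)] 2 that(2) by simp
    qed
    with 2 k show ?thesis by simp
  qed
qed simp

text \<open>A descending list of blocks of a descending partition lists them by first occurrence,
  since the antilexicographic order compares disjoint elements by their largest atom.\<close>

lemma descending_word:
  assumes as: "distinct as" "bpartition (set as)"
    and r: "\<And>x y. x \<in> spanned (set as) \<Longrightarrow> y \<in> spanned (set as) \<Longrightarrow> r (x, y) \<longleftrightarrow> antilex_less as x y"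
    and p: "pieces bot p" "set p \<subseteq> spanned (set as)" "sorted_wrt (\<lambda>u v. r (v, u)) p"
  shows "\<exists>s. length s = length as \<and> param_word 0 (length p) s \<and>
    (\<forall>i<length p. p ! i = block s (rev as) i)"
proof -
  let ?b = "rev as" and ?m = "length as"
  have b: "pieces bot ?b" using as by (simp add: pieces_bot_iff)
  note P = as(2) and Q = pieces_bpartition[OF p(1)]
  have mem: "p ! i \<in> spanned (set as)" if "i < length p" for i using p(2) that by auto
  have ex: "\<exists>i<length p. q \<le> p ! i" if q: "q \<in> set as" for q
  proof (rule ccontr)
    assume no: "\<not> ?thesis"
    have "inf x q = bot" if x: "x \<in> set p" for x
    proof -
      have "\<not> q \<le> x" using no x by (auto simp: in_set_conv_nth)
      moreover have "x \<in> spanned (set as)" using x p(2) by blast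
      ultimately have "inf q x = bot" using q by (auto simp: spanned_def)
      then show ?thesis by (simp only: inf_commute)
    qed
    then have "q = bot" by (rule bpartitionD(4)[OF Q])
    then show False using bpartitionD(2)[OF P q] by blast
  qed
  have uniq: "i = i'" if "q \<in> set as" "i < length p" "i' < length p" "q \<le> p ! i" "q \<le> p ! i'" for q i i'
  proof (rule ccontr)
    assume "i \<noteq> i'"
    then have "p ! i \<noteq> p ! i'" using p(1) that(2,3) by (simp add: pieces_bot_iff nth_eq_iff_index_eq)
    then have "inf (p ! i) (p ! i') = bot" using bpartitionD(3)[OF Q] that(2,3) by simp
    moreover have "q \<le> inf (p ! i) (p ! i')" using that(4,5) by simp
    ultimately have "q \<le> bot" by simp
    then show False using partition_le_simps(1)[OF P that(1)] by blast
  qed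
  define f where "f q = (SOME i. i < length p \<and> q \<le> p ! i)" for q
  have f: "f q < length p" "q \<le> p ! f q" if "q \<in> set as" for q
    using someI_ex[OF ex[OF that]] unfolding f_def by blast+
  define s where "s = map f ?b"
  have bj: "?b ! j \<in> set as" if "j < ?m" for j using nth_mem[of j ?b] that by simp
  have sj: "s ! j = f (?b ! j)" if "j < ?m" for j using that by (simp add: s_def)
  have le: "?b ! j \<le> p ! i \<longleftrightarrow> s ! j = i" if "j < ?m" "i < length p" for i j
    using f[OF bj[OF that(1)]] uniq[OF bj[OF that(1)]] that sj[OF that(1)] by metis
  have "p ! i = block s ?b i" if "i < length p" for i
    by (rule block_eqI[OF b]) (use mem le that in auto)
  moreover have "param_word 0 (length p) s"
  proof (rule param_wordI)
    show "set s \<subseteq> {..<0 + length p}" using f(1) by (auto simp: s_def)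
    show "{0..<0 + length p} \<subseteq> set s"
    proof
      fix i assume "i \<in> {0..<0 + length p}"
      then have i: "i < length p" by simp
      then have "p ! i \<noteq> bot" using bpartitionD(2)[OF Q] by simp
      then obtain q where q: "q \<in> set as" "q \<le> p ! i"
        using spanned_le_iff[OF P mem[OF i], of bot] by (auto simp: bot_unique)
      then have "f q = i" using f[OF q(1)] uniq[OF q(1)] i by blast
      then show "i \<in> set s" using q(1) by (auto simp: s_def)
    qed
    fix i j assume ij: "j < length s" "i < s ! j"
    then have j: "j < ?m" by (simp add: s_def)
    let ?i' = "s ! j"
    have i': "?i' < length p" using f(1)[OF bj[OF j]] sj[OF j] by simp
    have i: "i < length p" using ij i' by simp
    have "r (p ! ?i', p ! i)" using p(3) ij(2) i' by (simp add: sorted_wrt_iff_nth_less)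
    then have "antilex_less as (p ! ?i') (p ! i)" using r mem i i' by simp
    then obtain l where l: "l < ?m" "as ! l \<le> p ! i"
      "\<And>l'. l' < ?m \<Longrightarrow> l < l' \<Longrightarrow> as ! l' \<le> p ! ?i' \<longleftrightarrow> as ! l' \<le> p ! i"
      unfolding antilex_less_def by blast
    define j' where "j' = ?m - Suc l"
    have j': "j' < ?m" "?b ! j' = as ! l" using l(1) by (auto simp: j'_def rev_nth)
    have sj': "s ! j' = i" using le[OF j'(1) i] j'(2) l(2) by simp
    \<comment> \<open>Otherwise \<open>?b ! j\<close> would be an atom larger than
      \<open>as ! l\<close> on which \<open>p ! ?i'\<close> and \<open>p ! i\<close> differ,
      although \<open>l\<close> marks the largest such atom.\<close>
    moreover have "j' < j"
    proof (rule ccontr)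
      assume "\<not> j' < j"
      moreover have "j \<noteq> j'" using sj' ij(2) by auto
      ultimately have "l < ?m - Suc j" using j l(1) unfolding j'_def by linarith
      moreover have "as ! (?m - Suc j) = ?b ! j" using j by (simp add: rev_nth)
      ultimately have "?b ! j \<le> p ! ?i' \<longleftrightarrow> ?b ! j \<le> p ! i" using l(3)[of "?m - Suc j"] j by simp
      then show False using le[OF j i] le[OF j i'] ij(2) by simp
    qed
    ultimately show "\<exists>j'<j. s ! j' = i" by blast
  qed
  ultimately show ?thesis by (intro exI[of _ s]) (simp add: s_def)
qed

section \<open>The flow of natural orderings\<close>

lemma NO_action_apply:
  "r \<in> natural_orderings \<Longrightarrow> NO_action g r (a, b) = r (inv_into UNIV g a, inv_into UNIV g b)"
  by (simp add: NO_action_def)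

lemma natural_at_automorphism:
  assumes h: "h \<in> boolean_automorphisms" and "natural_at r (h x) (h y) (h z)"
    and r': "\<And>a b. r' (a, b) = r (h a, h b)"
  shows "natural_at r' x y z"
  using assms(2)
  unfolding natural_at_def r' automorphismD(2,4,6,9,11)[OF h] automorphismD(1)[OF h, symmetric] .

context automorphism_subgroup
begin

abbreviation "G \<equiv> aut_group\<lparr>carrier := N\<rparr>"
abbreviation "T \<equiv> subtopology pointwise_topology N"

lemma G_simps [simp]: "carrier G = N" "f \<otimes>\<^bsub>G\<^esub> g = f \<circ> g" "\<one>\<^bsub>G\<^esub> = id"
  by (simp_all add: aut_group_def)

lemma topspace_T [simp]: "topspace T = N"
  by (simp add: pointwise_topology_def)

lemma topspace_pointwise_topology [simp]: "topspace pointwise_topology = UNIV"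
  by (simp add: pointwise_topology_def)

lemma inv_comp_apply: "f \<in> N \<Longrightarrow> g \<in> N \<Longrightarrow> inv_into UNIV (f \<circ> g) x = inv_into UNIV g (inv_into UNIV f x)"
  using automorphismD(7)[OF aut[OF comp_mem[of f g]], of "inv_into UNIV g (inv_into UNIV f x)"]
  by (simp add: automorphismD(8)[OF aut])

lemma NO_action_mem:
  assumes g: "g \<in> N" and r: "r \<in> natural_orderings"
  shows "NO_action g r \<in> natural_orderings"
  unfolding natural_orderings_eq
  by (intro CollectI allI natural_at_automorphism[OF aut[OF inv_mem[OF g]]
        natural_orderings_natural_at[OF r] NO_action_apply[OF r]])

lemma NO_action_comp:
  assumes "f \<in> N" "g \<in> N" "r \<in> natural_orderings"
  shows "NO_action (f \<circ> g) r = NO_action f (NO_action g r)"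
  using assms by (auto simp: fun_eq_iff NO_action_apply NO_action_mem inv_comp_apply)

lemma NO_action_id: "r \<in> natural_orderings \<Longrightarrow> NO_action id r = r"
  by (auto simp: fun_eq_iff NO_action_apply)

lemma inv_comp_id: "g \<in> N \<Longrightarrow> inv_into UNIV g \<circ> g = id" "g \<in> N \<Longrightarrow> g \<circ> inv_into UNIV g = id"
  by (auto simp: fun_eq_iff automorphismD[OF aut])

lemma group_G: "group G"
  by (rule subgroup.subgroup_is_group[OF subgroup group_aut_group])

lemma NO_action_Bij:
  assumes g: "g \<in> N"
  shows "NO_action g \<in> Bij natural_orderings"
proof -
  have "bij_betw (NO_action g) natural_orderings natural_orderings"
    by (rule bij_betw_byWitness[where f' = "NO_action (inv_into UNIV g)"])
      (auto simp: NO_action_mem inv_mem g NO_action_comp[symmetric] inv_comp_id NO_action_id)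
  then show ?thesis by (simp add: Bij_def NO_action_def)
qed

lemma group_action_NO: "group_action G natural_orderings NO_action"
  unfolding group_action_def
proof (intro group_hom.intro group_hom_axioms.intro group_G group_BijGroup homI)
  show "NO_action g \<in> carrier (BijGroup natural_orderings)" if "g \<in> carrier G" for g
    using that NO_action_Bij by (simp add: BijGroup_def)
  show "NO_action (f \<otimes>\<^bsub>G\<^esub> g) = NO_action f \<otimes>\<^bsub>BijGroup natural_orderings\<^esub> NO_action g"
    if fg: "f \<in> carrier G" "g \<in> carrier G" for f g
  proof -
    have fg': "f \<in> N" "g \<in> N" using fg by simp_all
    have "NO_action (f \<circ> g) r = compose natural_orderings (NO_action f) (NO_action g) r" for r
    proof (cases "r \<in> natural_orderings")
      case True
      then show ?thesis using NO_action_comp[OF fg'] by (simp add: compose_def)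
    next
      case False
      then show ?thesis by (simp add: compose_def NO_action_def)
    qed
    then show ?thesis using NO_action_Bij fg' by (simp add: BijGroup_def fun_eq_iff)
  qed
qed

lemma openin_T_cylinder:
  assumes "finite F"
  shows "openin T {g \<in> N. \<forall>x\<in>F. g x = f x}"
proof -
  have "openin pointwise_topology {g. \<forall>x\<in>F. g x = f x}"
    unfolding pointwise_topology_def openin_pointwise_iff using assms by fastforce
  then show ?thesis unfolding openin_subtopology by blast
qed

lemma openin_NO_cylinder:
  assumes "finite F"
  shows "openin NO_topology {r \<in> natural_orderings. \<forall>x\<in>F. r x = r' x}"
proof -
  have "openin (product_topology (\<lambda>_. discrete_topology UNIV) UNIV) {r. \<forall>x\<in>F. r x = r' x}"
    unfolding openin_pointwise_iff using assms by fastforce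
  then show ?thesis unfolding NO_topology_def openin_subtopology by blast
qed

lemma openin_NO_D:
  assumes "openin NO_topology U" "r \<in> U"
  shows "\<exists>F. finite F \<and> (\<forall>r'\<in>natural_orderings. (\<forall>x\<in>F. r' x = r x) \<longrightarrow> r' \<in> U)"
proof -
  obtain V where V: "openin (product_topology (\<lambda>_. discrete_topology UNIV) UNIV) V"
    "U = V \<inter> natural_orderings"
    using assms(1) unfolding NO_topology_def openin_subtopology by blast
  then obtain F where "finite F" "\<forall>r'. (\<forall>x\<in>F. r' x = r x) \<longrightarrow> r' \<in> V"
    using assms(2) unfolding openin_pointwise_iff by blast
  then show ?thesis using V(2) by blast
qed

lemma openin_T_D:
  assumes "openin T U" "g \<in> U"
  shows "\<exists>F. finite F \<and> (\<forall>g'\<in>N. (\<forall>x\<in>F. g' x = g x) \<longrightarrow> g' \<in> U)"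
proof -
  obtain V where V: "openin (product_topology (\<lambda>_. discrete_topology UNIV) UNIV) V" "U = V \<inter> N"
    using assms(1) unfolding pointwise_topology_def openin_subtopology by blast
  then obtain F where "finite F" "\<forall>g'. (\<forall>x\<in>F. g' x = g x) \<longrightarrow> g' \<in> V"
    using assms(2) unfolding openin_pointwise_iff by blast
  then show ?thesis using V(2) by blast
qed

text \<open>The action involves the inverse of \<open>g\<close>, but agreement of \<open>g'\<close>
  with \<open>g\<close> at the preimages of \<open>a\<close> and \<open>b\<close> already forces the
  same preimages under \<open>g'\<close>. So two values of \<open>g\<close> and one of
  \<open>r\<close> control a coordinate.\<close>

lemma continuous_NO_action:
  "continuous_map (prod_topology T NO_topology) NO_topology (\<lambda>(g, r). NO_action g r)"
proof -
  have "continuous_map (prod_topology T NO_topology) (discrete_topology UNIV) (\<lambda>z. NO_action (fst z) (snd z) c)" for c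
    unfolding continuous_map_def
  proof (intro conjI allI impI)
    fix U :: "bool set"
    let ?S = "{z \<in> topspace (prod_topology T NO_topology). NO_action (fst z) (snd z) c \<in> U}"
    obtain a b where c: "c = (a, b)" by fastforce
    show "openin (prod_topology T NO_topology) ?S"
      unfolding openin_prod_topology_alt
    proof (intro allI impI)
      fix g r assume ramsey_for: "(g, r) \<in> ?S"
      then have g: "g \<in> N" and r: "r \<in> natural_orderings" and U: "NO_action g r c \<in> U" by auto
      let ?a = "inv_into UNIV g a" and ?b = "inv_into UNIV g b"
      let ?V = "{g' \<in> N. \<forall>x\<in>{?a, ?b}. g' x = g x}"
      let ?W = "{r' \<in> natural_orderings. \<forall>x\<in>{(?a, ?b)}. r' x = r x}"
      have "openin T ?V" "openin NO_topology ?W"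
        by (rule openin_T_cylinder, simp, rule openin_NO_cylinder, simp)
      moreover have "?V \<times> ?W \<subseteq> ?S"
      proof (intro subsetI, elim SigmaE)
        fix z g' r' assume z: "z = (g', r')" "g' \<in> ?V" "r' \<in> ?W"
        then have g': "g' \<in> N" "g' ?a = a" "g' ?b = b" using automorphismD(8)[OF aut[OF g]] by auto
        then have "inv_into UNIV g' a = ?a" "inv_into UNIV g' b = ?b"
          using automorphismD(7)[OF aut[OF g'(1)]] by metis+
        moreover have r': "r' \<in> natural_orderings" "r' (?a, ?b) = r (?a, ?b)" using z(3) by auto
        ultimately have "NO_action g' r' c = NO_action g r c"
          unfolding c NO_action_apply[OF r] NO_action_apply[OF r'(1)] by simp
        then show "z \<in> ?S" using z(1) g'(1) r'(1) U by simp
      qed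
      ultimately show "\<exists>V W. openin T V \<and> openin NO_topology W \<and> g \<in> V \<and> r \<in> W \<and> V \<times> W \<subseteq> ?S"
        using g r by (intro exI[of _ ?V] exI[of _ ?W]) simp
    qed
  qed simp
  then have "continuous_map (prod_topology T NO_topology) (product_topology (\<lambda>_. discrete_topology UNIV) UNIV)
      (\<lambda>z. NO_action (fst z) (snd z))"
    unfolding continuous_map_componentwise_UNIV by blast
  then have "continuous_map (prod_topology T NO_topology) NO_topology (\<lambda>z. NO_action (fst z) (snd z))"
    unfolding NO_topology_def continuous_map_in_subtopology
    by (auto simp: NO_action_mem image_subset_iff simp flip: NO_topology_def)
  then show ?thesis by (simp add: case_prod_unfold)
qed

lemma is_flow_NO: "is_flow G T NO_topology NO_action"
  unfolding is_flow_def
  using compact_space_NO Hausdorff_space_NO group_action_NO continuous_NO_action by simp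

end

section \<open>Universality\<close>

lemma automorphism_spanned:
  assumes "f \<in> boolean_automorphisms"
  shows "inv_into UNIV f x \<in> spanned (set as) \<longleftrightarrow> x \<in> spanned (set (map f as))"
proof -
  have "p \<le> inv_into UNIV f x \<longleftrightarrow> f p \<le> x" "inf p (inv_into UNIV f x) = bot \<longleftrightarrow> inf (f p) x = bot" for p
  proof -
    show "p \<le> inv_into UNIV f x \<longleftrightarrow> f p \<le> x"
      using automorphismD(10)[OF assms, of p "inv_into UNIV f x"] by (simp only: automorphismD(8)[OF assms])
    have "f (inf p (inv_into UNIV f x)) = inf (f p) x"
      by (simp only: automorphismD(1,8)[OF assms])
    then show "inf p (inv_into UNIV f x) = bot \<longleftrightarrow> inf (f p) x = bot"
      using automorphismD(11)[OF assms] by metis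
  qed
  then show ?thesis by (simp add: spanned_def)
qed

lemma antilex_less_automorphism:
  assumes "f \<in> boolean_automorphisms"
  shows "antilex_less as (inv_into UNIV f x) (inv_into UNIV f y) \<longleftrightarrow> antilex_less (map f as) x y"
proof -
  have "p \<le> inv_into UNIV f x \<longleftrightarrow> f p \<le> x" for p x
    using automorphismD(10)[OF assms, of p "inv_into UNIV f x"] by (simp only: automorphismD(8)[OF assms])
  then show ?thesis by (simp add: antilex_less_def cong: conj_cong)
qed

lemma automorphism_fixes_spanned:
  assumes f: "f \<in> boolean_automorphisms" and P: "bpartition P" "\<And>p. p \<in> P \<Longrightarrow> f p = p"
    and x: "x \<in> spanned P"
  shows "f x = x"
proof (rule spanned_eqI[OF P(1) _ x])
  have le: "p \<le> f x \<longleftrightarrow> p \<le> x" if "p \<in> P" for p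
    using automorphismD(10)[OF f, of p x] P(2)[OF that] by simp
  show "f x \<in> spanned P"
    unfolding spanned_def
  proof (intro CollectI ballI)
    fix p assume p: "p \<in> P"
    have "inf p (f x) = f (inf p x)" using P(2)[OF p] by (simp add: automorphismD(1)[OF f])
    moreover have "p \<le> x \<or> inf p x = bot" using x p by (auto simp: spanned_def)
    ultimately show "p \<le> f x \<or> inf p (f x) = bot" using le[OF p] automorphismD(4)[OF f] by metis
  qed
  show "p \<le> f x \<longleftrightarrow> p \<le> x" if "p \<in> P" for p by (rule le[OF that])
qed

lemma natural_ordering_enumeration:
  assumes "r \<in> natural_orderings" "bpartition P"
  shows "\<exists>as. distinct as \<and> set as = P \<and> sorted_wrt (\<lambda>x y. r (x, y)) as \<and>
    (\<forall>x\<in>spanned P. \<forall>y\<in>spanned P. r (x, y) \<longleftrightarrow> antilex_less as x y)"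
proof -
  note r = natural_orderings_natural_at[OF assms(1)]
  obtain as where as: "distinct as" "set as = P" "sorted_wrt (\<lambda>x y. r (x, y)) as"
    using sorted_enumeration[OF bpartitionD(1)[OF assms(2)], of "\<lambda>x y. r (x, y)"]
      natural_atD(2,3)[OF r] by metis
  then show ?thesis using natural_iff_antilex[OF r _ as(3)] assms(2) by blast
qed

text \<open>Universality rests on these properties alone. \<open>splitting\<close> supplies
  partitions with any positive number of pieces, as required by the uncontrolled length
  \<open>n\<close> in the Ramsey theorem.\<close>

locale homogeneous_subgroup = automorphism_subgroup N for N :: "('b::boolean_algebra \<Rightarrow> 'b) set" +
  assumes homogeneous:
      "\<And>as bs. pieces bot as \<Longrightarrow> pieces bot bs \<Longrightarrow> length as = length bs \<Longrightarrow> \<exists>g\<in>N. map g as = bs"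
    and splitting: "\<And>x :: 'b. x \<noteq> bot \<Longrightarrow> \<exists>u v. u \<noteq> bot \<and> v \<noteq> bot \<and> inf u v = bot \<and> sup u v = x"
    and nondegenerate: "(bot :: 'b) \<noteq> top_class.top"
begin

lemma pieces_exist:
  assumes "0 < n"
  shows "\<exists>C :: 'b list. length C = n \<and> pieces bot C"
  using assms
proof (induction n rule: nat_induct_non_zero)
  case 1
  show ?case using nondegenerate by (intro exI[of _ "[top_class.top]"]) simp
next
  case (Suc n)
  then obtain C0 :: "'b list" where C0: "length C0 = n" "pieces bot C0" by blast
  then obtain a C where C: "C0 = a # C" using Suc.hyps by (cases C0) auto
  then have "a \<noteq> bot" "pieces a C" using C0(2) by simp_all
  from splitting[OF this(1)] obtain u v where uv: "u \<noteq> bot" "v \<noteq> bot" "inf u v = bot" "sup u v = a"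
    by blast
  then have "pieces bot (u # v # C)" using \<open>pieces a C\<close> by simp
  moreover have "length (u # v # C) = Suc n" using C0(1) C by simp
  ultimately show ?case by blast
qed

text \<open>The coordinates in \<open>F\<close> lie in the span of one partition; \<open>r\<close>
  and \<open>r'\<close> list it in two orders, and an element of \<open>N\<close> that takes the
  first list to the second takes \<open>r\<close> to \<open>r'\<close> there.\<close>

lemma dense_orbit:
  assumes r: "r \<in> natural_orderings" "r' \<in> natural_orderings" and F: "finite F"
  shows "\<exists>g\<in>N. \<forall>p\<in>F. NO_action g r p = r' p"
proof -
  have fin: "finite (fst ` F \<union> snd ` F)" using F by simp
  obtain P where P: "bpartition P" "fst ` F \<union> snd ` F \<subseteq> spanned P"
    using partition_refine[OF fin] by blast
  obtain as where as: "distinct as" "set as = P" "sorted_wrt (\<lambda>x y. r (x, y)) as"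
    "\<And>x y. x \<in> spanned P \<Longrightarrow> y \<in> spanned P \<Longrightarrow> r (x, y) \<longleftrightarrow> antilex_less as x y"
    using natural_ordering_enumeration[OF r(1) P(1)] by blast
  obtain bs where bs: "distinct bs" "set bs = P" "sorted_wrt (\<lambda>x y. r' (x, y)) bs"
    "\<And>x y. x \<in> spanned P \<Longrightarrow> y \<in> spanned P \<Longrightarrow> r' (x, y) \<longleftrightarrow> antilex_less bs x y"
    using natural_ordering_enumeration[OF r(2) P(1)] by blast
  have "length as = length bs" using as(1,2) bs(1,2) by (metis distinct_card)
  then obtain g where g: "g \<in> N" "map g as = bs"
    using homogeneous[of as bs] as(1,2) bs(1,2) P(1) by (auto simp: pieces_bot_iff)
  note ga = aut[OF g(1)]
  have "NO_action g r p = r' p" if p: "p \<in> F" for p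
  proof -
    obtain x y where pxy: "p = (x, y)" by (cases p)
    have "fst p \<in> spanned P" "snd p \<in> spanned P" using p P(2) by blast+
    then have xy: "x \<in> spanned P" "y \<in> spanned P" by (simp_all add: pxy)
    have "inv_into UNIV g z \<in> spanned P" if "z \<in> spanned P" for z
      using automorphism_spanned[OF ga, of z as] that g(2) bs(2) as(2) by simp
    then have "r (inv_into UNIV g x, inv_into UNIV g y) \<longleftrightarrow> antilex_less bs x y"
      using as(4) xy antilex_less_automorphism[OF ga, of as x y] g(2) by simp
    then show ?thesis using bs(4)[OF xy] NO_action_apply[OF r(1), of g x y] by (simp only: pxy)
  qed
  then have "\<forall>p\<in>F. NO_action g r p = r' p" by blast
  then show ?thesis using g(1) by (intro bexI[of _ g])
qed

lemma minimal_flow_NO: "minimal_flow G T NO_topology NO_action"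
  unfolding minimal_flow_def
proof (intro conjI allI impI is_flow_NO)
  show "topspace NO_topology \<noteq> ({} :: ('b \<times> 'b \<Rightarrow> bool) set)"
    using natural_orderings_nonempty by simp
  fix C :: "('b \<times> 'b \<Rightarrow> bool) set"
  assume C: "closedin NO_topology C \<and> C \<noteq> {} \<and> (\<forall>g\<in>carrier G. NO_action g ` C \<subseteq> C)"
  then obtain r where r: "r \<in> C" by blast
  have sub: "C \<subseteq> natural_orderings" using C closedin_subset by fastforce
  have "r' \<in> C" if r': "r' \<in> natural_orderings" for r'
  proof (rule ccontr)
    assume "r' \<notin> C"
    moreover have "openin NO_topology (natural_orderings - C)" using C by (auto simp: closedin_def)
    ultimately obtain F where F: "finite F"
      "\<And>q. q \<in> natural_orderings \<Longrightarrow> \<forall>x\<in>F. q x = r' x \<Longrightarrow> q \<in> natural_orderings - C"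
      using openin_NO_D[of "natural_orderings - C" r'] r' by blast
    obtain g where g: "g \<in> N" "\<forall>p\<in>F. NO_action g r p = r' p"
      using dense_orbit[OF _ r' F(1), of r] r sub by blast
    then have "NO_action g r \<in> natural_orderings - C" using r sub by (intro F(2) NO_action_mem) auto
    moreover have "NO_action g r \<in> C" using C g(1) r by auto
    ultimately show False by blast
  qed
  then show "C = topspace NO_topology" using sub by auto
qed

end

section \<open>Approximate colourings from a minimal flow\<close>

text \<open>Equal values mean a common interval of length 1/10. The cap \<open>min 10\<close> keeps
  colours below 11 even for functions with values above 1, because a colouring has to be bounded on
  all arguments.\<close>

lemma floor_eq_dist:
  fixes x y :: real
  assumes "0 \<le> x" "x \<le> 1" "0 \<le> y" "y \<le> 1"
    and "min 10 (nat \<lfloor>10 * x\<rfloor>) = min 10 (nat \<lfloor>10 * y\<rfloor>)"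
  shows "\<bar>x - y\<bar> \<le> 1 / 10"
proof -
  have le: "nat \<lfloor>10 * z\<rfloor> \<le> 10" "0 \<le> \<lfloor>10 * z\<rfloor>" if "0 \<le> z" "z \<le> 1" for z :: real
    using that by linarith+
  have "nat \<lfloor>10 * x\<rfloor> = nat \<lfloor>10 * y\<rfloor>"
    using assms(5) le(1)[OF assms(1,2)] le(1)[OF assms(3,4)] by (simp only: min.absorb2)
  then have "\<lfloor>10 * x\<rfloor> = \<lfloor>10 * y\<rfloor>"
    using le(2)[OF assms(1,2)] le(2)[OF assms(3,4)] by (simp only: eq_nat_nat_iff)
  then show ?thesis by linarith
qed

locale minimal_flow_target = homogeneous_subgroup N for N :: "('b::boolean_algebra \<Rightarrow> 'b) set" +
  fixes Y :: "'y topology" and \<psi> :: "('b \<Rightarrow> 'b) \<Rightarrow> 'y \<Rightarrow> 'y" and r0 :: "'b \<times> 'b \<Rightarrow> bool"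
  assumes minimal: "minimal_flow G T Y \<psi>" and r0: "r0 \<in> natural_orderings"
begin

lemma compact_Y: "compact_space Y" and Hausdorff_Y: "Hausdorff_space Y"
  and action_Y: "group_action G (topspace Y) \<psi>"
  and continuous_Y: "continuous_map (prod_topology T Y) Y (\<lambda>(g, x). \<psi> g x)"
  and nonempty_Y: "topspace Y \<noteq> {}"
  using minimal unfolding minimal_flow_def is_flow_def by blast+

lemma psi_mem: "g \<in> N \<Longrightarrow> z \<in> topspace Y \<Longrightarrow> \<psi> g z \<in> topspace Y"
  using group_action.element_image[OF action_Y] by simp

lemma psi_comp: "f \<in> N \<Longrightarrow> g \<in> N \<Longrightarrow> z \<in> topspace Y \<Longrightarrow> \<psi> (f \<circ> g) z = \<psi> f (\<psi> g z)"
  using group_action.composition_rule[OF action_Y, of z f g] by simp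

lemma psi_id: "z \<in> topspace Y \<Longrightarrow> \<psi> id z = z"
  using group_action.id_eq_one[OF action_Y] by (metis G_simps(3) restrict_apply')

lemma continuous_psi: "g \<in> N \<Longrightarrow> continuous_map Y Y (\<psi> g)"
  using continuous_map_compose[OF continuous_map_pairedI[of Y T "\<lambda>_. g" Y "\<lambda>z. z"] continuous_Y]
  by (simp add: comp_def)

lemma uniform_local:
  assumes f: "continuous_map Y euclideanreal f" and z: "z \<in> topspace Y"
  shows "\<exists>F V. finite F \<and> openin Y V \<and> z \<in> V \<and>
    (\<forall>s\<in>N. \<forall>z'\<in>V. (\<forall>x\<in>F. s x = x) \<longrightarrow> \<bar>f (\<psi> s z') - f z\<bar> < 1 / 20)"
proof -
  let ?S = "{x \<in> topspace (prod_topology T Y). (f \<circ> (\<lambda>(g, x). \<psi> g x)) x \<in> ball (f z) (1 / 20)}"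
  have "openin (prod_topology T Y) ?S"
    by (rule openin_continuous_map_preimage[OF continuous_map_compose[OF continuous_Y f]]) simp
  moreover have "(id, z) \<in> ?S" using id_mem z psi_id by simp
  ultimately obtain U V where UV: "openin T U" "openin Y V" "id \<in> U" "z \<in> V" "U \<times> V \<subseteq> ?S"
    unfolding openin_prod_topology_alt by meson
  obtain F where F: "finite F" "\<And>g'. g' \<in> N \<Longrightarrow> \<forall>x\<in>F. g' x = id x \<Longrightarrow> g' \<in> U"
    using openin_T_D[OF UV(1,3)] by blast
  have "\<bar>f (\<psi> s z') - f z\<bar> < 1 / 20" if s: "s \<in> N" "z' \<in> V" "\<forall>x\<in>F. s x = x" for s z'
  proof -
    have "s \<in> U" by (rule F(2)) (use s in simp_all)
    then have "(s, z') \<in> ?S" using UV(5) s(2) by blast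
    then show ?thesis by (simp add: dist_real_def abs_minus_commute)
  qed
  then show ?thesis using F(1) UV(2,4) by blast
qed

text \<open>By compactness finitely many neighbourhoods from \<open>uniform_local\<close> cover
  \<open>Y\<close>, and one partition spans their finite sets. Both \<open>f (\<psi> s z)\<close>
  and \<open>f z\<close> are within 1/20 of the value at the centre \<open>c\<close>, which gives
  1/10.\<close>

lemma uniform_partition:
  assumes f: "continuous_map Y euclideanreal f"
  shows "\<exists>P. bpartition P \<and> (\<forall>s\<in>N. (\<forall>x\<in>P. s x = x) \<longrightarrow>
    (\<forall>z\<in>topspace Y. \<bar>f (\<psi> s z) - f z\<bar> \<le> 1 / 10))"
proof -
  obtain F V where FV: "\<And>z. z \<in> topspace Y \<Longrightarrow> finite (F z) \<and> openin Y (V z) \<and> z \<in> V z \<and>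
    (\<forall>s\<in>N. \<forall>z'\<in>V z. (\<forall>x\<in>F z. s x = x) \<longrightarrow> \<bar>f (\<psi> s z') - f z\<bar> < 1 / 20)"
    using uniform_local[OF f] by metis
  let ?U = "V ` topspace Y"
  have "(\<forall>U\<in>?U. openin Y U) \<and> topspace Y \<subseteq> \<Union>?U" using FV by blast
  then obtain W where W: "finite W" "W \<subseteq> ?U" "topspace Y \<subseteq> \<Union>W"
    using compact_Y unfolding compact_space_alt by meson
  obtain Z where Z: "Z \<subseteq> topspace Y" "finite Z" "W = V ` Z"
    using finite_subset_image[OF W(1,2)] by blast
  have "finite (\<Union>z\<in>Z. F z)" using Z FV by blast
  then obtain P where P: "bpartition P" "(\<Union>z\<in>Z. F z) \<subseteq> spanned P" using partition_refine by blast
  have "\<bar>f (\<psi> s z) - f z\<bar> \<le> 1 / 10" if s: "s \<in> N" "\<forall>x\<in>P. s x = x" and z: "z \<in> topspace Y" for s z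
  proof -
    obtain c where c: "c \<in> Z" "z \<in> V c" using z W(3) Z(3) by blast
    then have cY: "c \<in> topspace Y" using Z(1) by blast
    have "s x = x" if "x \<in> F c" for x
      by (rule automorphism_fixes_spanned[OF aut[OF s(1)] P(1)]) (use s(2) that c(1) P(2) in blast)+
    then have "\<bar>f (\<psi> s z) - f c\<bar> < 1 / 20" using FV[OF cY] s(1) c(2) by blast
    moreover have "\<bar>f (\<psi> id z) - f c\<bar> < 1 / 20" using FV[OF cY] id_mem c(2) by simp
    ultimately show ?thesis unfolding psi_id[OF z] by linarith
  qed
  then show ?thesis using P(1) by blast
qed

text \<open>\<open>tame f a\<close>: the value \<open>f (g z)\<close> is determined up to \<open>1/10\<close> by the preimage of \<open>a\<close> under \<open>g\<close>.\<close>

definition tame :: "('y \<Rightarrow> real) \<Rightarrow> 'b list \<Rightarrow> bool" where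
  "tame f a \<longleftrightarrow> continuous_map Y euclideanreal f \<and> (\<forall>z\<in>topspace Y. 0 \<le> f z \<and> f z \<le> 1) \<and>
     pieces bot a \<and> (\<forall>s\<in>N. (\<forall>x\<in>set a. s x = x) \<longrightarrow>
       (\<forall>z\<in>topspace Y. \<bar>f (\<psi> s z) - f z\<bar> \<le> 1 / 10))"

definition descending :: "('b \<times> 'b \<Rightarrow> bool) \<Rightarrow> 'b list \<Rightarrow> bool" where
  "descending r a \<longleftrightarrow> sorted_wrt (\<lambda>u v. r (v, u)) a"

text \<open>Descending for both orderings means that \<open>g r0\<close> and \<open>g' r0\<close>
  agree on the span of \<open>a\<close>.\<close>

definition valid_test :: "('y \<Rightarrow> real) \<times> 'b list \<times> ('b \<Rightarrow> 'b) \<times> ('b \<Rightarrow> 'b) \<Rightarrow> bool" where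
  "valid_test q \<longleftrightarrow> (case q of (f, a, g, g') \<Rightarrow> tame f a \<and> g \<in> N \<and> g' \<in> N \<and>
     descending (NO_action g r0) a \<and> descending (NO_action g' r0) a)"

text \<open>The bound has to cover the total error 3/10 of \<open>finite_tests\<close> and, in
  \<open>limit_unique\<close>, to stay below 1 after two errors of 1/8 are added.\<close>

definition passes_test :: "('y \<Rightarrow> real) \<times> 'b list \<times> ('b \<Rightarrow> 'b) \<times> ('b \<Rightarrow> 'b) \<Rightarrow> 'y \<Rightarrow> bool" where
  "passes_test q y \<longleftrightarrow> (case q of (f, a, g, g') \<Rightarrow> \<bar>f (\<psi> g y) - f (\<psi> g' y)\<bar> \<le> 1 / 2)"

lemma closedin_passes:
  assumes "valid_test q"
  shows "closedin Y {y \<in> topspace Y. passes_test q y}"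
proof -
  obtain f a g g' where q: "q = (f, a, g, g')" by (cases q)
  have g: "g \<in> N" "g' \<in> N" "continuous_map Y euclideanreal f"
    using assms by (auto simp: q valid_test_def tame_def)
  have "continuous_map Y euclideanreal (\<lambda>y. f (\<psi> g y))" "continuous_map Y euclideanreal (\<lambda>y. f (\<psi> g' y))"
    using continuous_map_compose[OF continuous_psi g(3)] g(1,2) by (simp_all add: comp_def)
  then have "continuous_map Y euclideanreal (\<lambda>y. f (\<psi> g y) - f (\<psi> g' y))"
    by (rule continuous_map_diff)
  then have "closedin Y {y \<in> topspace Y. f (\<psi> g y) - f (\<psi> g' y) \<in> cball 0 (1 / 2)}"
    by (rule closedin_continuous_map_preimage) simp
  then show ?thesis by (simp add: q passes_test_def)
qed

text \<open>Pulled back by \<open>h\<close>, the list \<open>a\<close> becomes a coarsening of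
  \<open>as\<close> that is descending for \<open>r0\<close> itself, so
  \<open>descending_word\<close> applies. The word varies with \<open>h\<close>, but its number of
  parameters is always \<open>length a\<close>, and in the end only this number decides the
  colour.\<close>

lemma test_word:
  assumes as: "distinct as" "bpartition (set as)"
    "\<And>x y. x \<in> spanned (set as) \<Longrightarrow> y \<in> spanned (set as) \<Longrightarrow> r0 (x, y) \<longleftrightarrow> antilex_less as x y"
    and a: "pieces bot a" and h: "h \<in> N" "descending (NO_action h r0) a"
    and sub: "inv_into UNIV h ` set a \<subseteq> spanned (set as)"
  shows "\<exists>s. length s = length as \<and> param_word 0 (length a) s \<and>
    (\<forall>i<length a. a ! i = h (block s (rev as) i))"
proof -
  let ?p = "map (inv_into UNIV h) a"
  have "inv_into UNIV h bot = bot" using automorphismD(4)[OF aut[OF inv_mem[OF h(1)]]] .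
  then have "pieces bot ?p" using pieces_map[OF aut[OF inv_mem[OF h(1)]] a] by simp
  moreover have "set ?p \<subseteq> spanned (set as)" using sub by simp
  moreover have "sorted_wrt (\<lambda>u v. r0 (v, u)) ?p"
    using h(2) unfolding descending_def sorted_wrt_map NO_action_apply[OF r0] .
  ultimately obtain s where s: "length s = length as" "param_word 0 (length ?p) s"
    "\<forall>i<length ?p. ?p ! i = block s (rev as) i"
    using descending_word[OF as, of ?p] by blast
  have "a ! i = h (block s (rev as) i)" if "i < length a" for i
    using s(3) that automorphismD(8)[OF aut[OF h(1)], of "a ! i"] by simp
  then show ?thesis using s(1,2) by auto
qed

end

context minimal_flow_target
begin

text \<open>A word is coloured by the value of \<open>f\<close> at \<open>h y0\<close>, rounded to a tenth, where \<open>h\<close> maps the partition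
  coded by the word to \<open>a\<close>; the choice of \<open>h\<close> changes the value by at most a tenth.\<close>

definition color :: "'b list \<Rightarrow> 'y \<Rightarrow> ('y \<Rightarrow> real) \<times> 'b list \<times> ('b \<Rightarrow> 'b) \<times> ('b \<Rightarrow> 'b) \<Rightarrow> nat list \<Rightarrow> nat" where
  "color C y0 q w = (case q of (f, a, _, _) \<Rightarrow>
     min 10 (nat \<lfloor>10 * f (\<psi> (SOME h. h \<in> N \<and> map h (map (block w C) [0..<length a]) = a) y0)\<rfloor>))"

text \<open>The preimages of all lists in the tests lie in the span of one partition
  \<open>P\<close> of \<open>m\<close> pieces. An arbitrary partition \<open>C\<close> of
  \<open>n\<close> pieces is coarsened by the Ramsey theorem to \<open>?B\<close>, where the colour
  of a further coarsening depends only on its number of pieces. An element \<open>k\<close> moves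
  \<open>P\<close> onto \<open>?B\<close>, and \<open>?k'\<close> applied to an arbitrary
  \<open>y0\<close> carries the conclusion back to \<open>P\<close>.\<close>

lemma finite_tests:
  assumes I: "finite I" "\<And>q. q \<in> I \<Longrightarrow> valid_test q"
  shows "\<exists>y\<in>topspace Y. \<forall>q\<in>I. passes_test q y"
proof -
  obtain y0 where y0: "y0 \<in> topspace Y" using nonempty_Y by blast
  define F where "F = (\<Union>(f, a, g, g')\<in>I. inv_into UNIV g ` set a \<union> inv_into UNIV g' ` set a)"
  have "finite F" unfolding F_def using I(1) by auto
  then obtain P where P: "bpartition P" "F \<subseteq> spanned P" using partition_refine[of F] by blast
  obtain as where as: "distinct as" "set as = P"
    "\<And>x y. x \<in> spanned P \<Longrightarrow> y \<in> spanned P \<Longrightarrow> r0 (x, y) \<longleftrightarrow> antilex_less as x y"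
    using natural_ordering_enumeration[OF r0 P(1)] by blast
  define b m where "b = rev as" and "m = length as"
  have b: "pieces bot b" "length b = m" using as P(1) by (simp_all add: b_def m_def pieces_bot_iff)
  have "as \<noteq> []"
  proof
    assume "as = []"
    then have "(bot :: 'b) = top_class.top" using b by (simp add: b_def)
    then show False using nondegenerate by simp
  qed
  then have m: "0 < m" by (simp add: m_def)
  have "finite ((\<lambda>q. length (fst (snd q))) ` I)" using I(1) by simp
  then obtain K where K: "\<And>q. q \<in> I \<Longrightarrow> length (fst (snd q)) \<le> K"
    unfolding finite_nat_set_iff_bounded_le by blast
  obtain n where n: "\<And>c. (\<forall>w. c w < 11 ^ card I) \<Longrightarrow> (\<exists>t. length t = n \<and> param_word 0 m t \<and>
    (\<forall>k\<le>K. \<forall>s s'. length s = m \<and> length s' = m \<and> param_word 0 k s \<and> param_word 0 k s' \<longrightarrow>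
      c (plug 0 s t) = (c (plug 0 s' t) :: nat)))"
    using graham_rothschild_upto[of "11 ^ card I" m K] by blast
  have "0 < n"
  proof -
    have "\<forall>w. (\<lambda>_. 0) w < (11 ^ card I :: nat)" by simp
    from n[OF this] obtain t where "length t = n" "param_word 0 m t" by blast
    then show ?thesis using m by (cases t) auto
  qed
  \<comment> \<open>\<open>C\<close> has no relation to \<open>r0\<close>; only the number of its
    pieces matters.\<close>
  then obtain C :: "'b list" where C: "length C = n" "pieces bot C" using pieces_exist by blast
  have color_less: "color C y0 q w < 11" for q w
    by (cases q) (simp add: color_def min_less_iff_disj)
  define d where "d = joint_color I 11 (color C y0)"
  have d: "\<forall>w. d w < 11 ^ card I"
    unfolding d_def by (intro allI joint_color_less[OF I(1)] color_less)
  obtain t where t: "length t = n" "param_word 0 m t"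
    "\<And>k s s'. k \<le> K \<Longrightarrow> length s = m \<Longrightarrow> length s' = m \<Longrightarrow> param_word 0 k s \<Longrightarrow> param_word 0 k s' \<Longrightarrow>
      d (plug 0 s t) = d (plug 0 s' t)"
    using n[OF d] by blast
  let ?B = "map (block t C) [0..<m]"
  have "pieces bot ?B" using pieces_blocks[OF C(2)] t(1,2) C(1) by simp
  then obtain k where k: "k \<in> N" "map k b = ?B" using homogeneous[OF b(1)] b(2) by fastforce
  let ?k' = "inv_into UNIV k"
  let ?y = "\<psi> ?k' y0"
  have y: "?y \<in> topspace Y" by (rule psi_mem[OF inv_mem[OF k(1)] y0])
  have "passes_test q ?y" if q: "q \<in> I" for q
  proof -
    obtain f a g g' where qe: "q = (f, a, g, g')" by (cases q)
    have tq: "tame f a" "g \<in> N" "g' \<in> N" "descending (NO_action g r0) a" "descending (NO_action g' r0) a"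
      using I(2)[OF q] unfolding qe valid_test_def by auto
    have f: "\<And>z. z \<in> topspace Y \<Longrightarrow> 0 \<le> f z \<and> f z \<le> 1" "pieces bot a"
      "\<And>s z. s \<in> N \<Longrightarrow> \<forall>x\<in>set a. s x = x \<Longrightarrow> z \<in> topspace Y \<Longrightarrow> \<bar>f (\<psi> s z) - f z\<bar> \<le> 1 / 10"
      using tq(1) unfolding tame_def by blast+
    define H where "H w = (SOME h. h \<in> N \<and> map h (map (block w C) [0..<length a]) = a)" for w
    have near: "\<bar>f (\<psi> h ?y) - f (\<psi> (H (plug 0 s t)) y0)\<bar> \<le> 1 / 10 \<and> H (plug 0 s t) \<in> N"
      if h: "h \<in> N" and s: "length s = m" "\<And>i. i < length a \<Longrightarrow> a ! i = h (block s b i)" for h s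
    proof -
      let ?w = "plug 0 s t" and ?e = "h \<circ> ?k'"
      have e: "?e \<in> N" by (intro comp_mem h inv_mem k)
      have blk: "block ?w C i = k (block s b i)" for i
        using block_block[OF C(2) _ t(2) s(1), of i] t(1) C(1)
          automorphism_block[OF aut[OF k(1)], of s b i] k(2) by simp
      have ea: "map ?e (map (block ?w C) [0..<length a]) = a"
        by (rule nth_equalityI) (simp_all add: blk automorphismD(7)[OF aut[OF k(1)]] s(2))
      have H: "H ?w \<in> N" "map (H ?w) (map (block ?w C) [0..<length a]) = a"
        using someI[of "\<lambda>h. h \<in> N \<and> map h (map (block ?w C) [0..<length a]) = a" ?e] e ea
        unfolding H_def by blast+
      \<comment> \<open>Both \<open>?e\<close> and \<open>H ?w\<close> map the coded partition to
        \<open>a\<close>, so they differ by an element fixing the pieces of \<open>a\<close>, and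
        \<open>tame\<close> bounds the effect by 1/10.\<close>
      let ?s = "?e \<circ> inv_into UNIV (H ?w)"
      have sN: "?s \<in> N" by (intro comp_mem e inv_mem H(1))
      have fix_a: "\<forall>x\<in>set a. ?s x = x"
      proof
        fix x assume "x \<in> set a"
        then obtain i where i: "i < length a" "x = a ! i" by (auto simp: in_set_conv_nth)
        have "H ?w (block ?w C i) = x" using arg_cong[OF H(2), of "\<lambda>l. l ! i"] i by simp
        moreover have "?e (block ?w C i) = x" using arg_cong[OF ea, of "\<lambda>l. l ! i"] i by simp
        ultimately show "?s x = x" using automorphismD(7)[OF aut[OF H(1)], of "block ?w C i"] by simp
      qed
      have "?s \<circ> H ?w = ?e" using inv_comp_id(1)[OF H(1)] by (simp add: comp_assoc)
      then have "\<psi> ?s (\<psi> (H ?w) y0) = \<psi> ?e y0" using psi_comp[OF sN H(1) y0] by simp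
      also have "\<dots> = \<psi> h ?y" by (rule psi_comp[OF h inv_mem[OF k(1)] y0])
      finally have "\<psi> h ?y = \<psi> ?s (\<psi> (H ?w) y0)" by simp
      then show ?thesis using f(3)[OF sN fix_a psi_mem[OF H(1) y0]] H(1) by (simp only: simp_thms)
    qed
    have sub: "inv_into UNIV g ` set a \<subseteq> spanned (set as)" "inv_into UNIV g' ` set a \<subseteq> spanned (set as)"
    proof -
      have "inv_into UNIV g ` set a \<union> inv_into UNIV g' ` set a \<subseteq> F" unfolding F_def using q qe by force
      then show "inv_into UNIV g ` set a \<subseteq> spanned (set as)" "inv_into UNIV g' ` set a \<subseteq> spanned (set as)"
        using P(2) as(2) by blast+
    qed
    have as': "bpartition (set as)"
      "\<And>x y. x \<in> spanned (set as) \<Longrightarrow> y \<in> spanned (set as) \<Longrightarrow> r0 (x, y) \<longleftrightarrow> antilex_less as x y"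
      using P(1) as(2,3) by simp_all
    obtain s where s: "length s = m" "param_word 0 (length a) s"
      "\<And>i. i < length a \<Longrightarrow> a ! i = g (block s b i)"
      using test_word[OF as(1) as' f(2) tq(2,4) sub(1)] unfolding m_def b_def by blast
    obtain s' where s': "length s' = m" "param_word 0 (length a) s'"
      "\<And>i. i < length a \<Longrightarrow> a ! i = g' (block s' b i)"
      using test_word[OF as(1) as' f(2) tq(3,5) sub(2)] unfolding m_def b_def by blast
    note n1 = near[OF tq(2) s(1,3)] and n2 = near[OF tq(3) s'(1,3)]
    have "length a \<le> K" using K[OF q] by (simp add: qe)
    then have "d (plug 0 s t) = d (plug 0 s' t)" using s s' by (intro t(3))
    then have "color C y0 q (plug 0 s t) = color C y0 q (plug 0 s' t)"
      unfolding d_def by (rule joint_color_eq[where c = "color C y0" and r = 11, OF I(1) color_less _ q])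
    then have "min 10 (nat \<lfloor>10 * f (\<psi> (H (plug 0 s t)) y0)\<rfloor>) = min 10 (nat \<lfloor>10 * f (\<psi> (H (plug 0 s' t)) y0)\<rfloor>)"
      by (simp only: color_def qe prod.case H_def)
    then have "\<bar>f (\<psi> (H (plug 0 s t)) y0) - f (\<psi> (H (plug 0 s' t)) y0)\<bar> \<le> 1 / 10"
      using f(1)[OF psi_mem[OF _ y0]] n1 n2 by (intro floor_eq_dist) blast+
    \<comment> \<open>Two errors of 1/10 for the choice of \<open>H\<close> and one for rounding add
      up to 3/10.\<close>
    then have "\<bar>f (\<psi> g ?y) - f (\<psi> g' ?y)\<bar> \<le> 1 / 2" using n1 n2 by linarith
    then show ?thesis by (simp add: passes_test_def qe)
  qed
  then show ?thesis using y by blast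
qed

lemma all_tests: "\<exists>y\<in>topspace Y. \<forall>q. valid_test q \<longrightarrow> passes_test q y"
proof -
  define D where "D I = {y \<in> topspace Y. \<forall>q\<in>I. valid_test q \<longrightarrow> passes_test q y}" for I
  have "\<exists>y\<in>topspace Y. \<forall>I. finite I \<longrightarrow> y \<in> D I"
  proof (rule compact_space_directed[OF compact_Y])
    fix I :: "(('y \<Rightarrow> real) \<times> 'b list \<times> ('b \<Rightarrow> 'b) \<times> ('b \<Rightarrow> 'b)) set" assume I: "finite I"
    have "D I = \<Inter> (insert (topspace Y) ((\<lambda>q. {y \<in> topspace Y. passes_test q y}) ` {q \<in> I. valid_test q}))"
      by (auto simp: D_def)
    moreover have "closedin Y (\<Inter> (insert (topspace Y) ((\<lambda>q. {y \<in> topspace Y. passes_test q y}) ` {q \<in> I. valid_test q})))"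
      by (rule closedin_Inter) (auto intro: closedin_passes)
    ultimately show "closedin Y (D I)" by (simp only:)
    have "finite {q \<in> I. valid_test q}" using I by simp
    then obtain y where "y \<in> topspace Y" "\<forall>q\<in>{q \<in> I. valid_test q}. passes_test q y"
      using finite_tests[of "{q \<in> I. valid_test q}"] by blast
    then have "y \<in> D I" unfolding D_def by blast
    then show "D I \<noteq> {}" by blast
  next
    fix I I' :: "(('y \<Rightarrow> real) \<times> 'b list \<times> ('b \<Rightarrow> 'b) \<times> ('b \<Rightarrow> 'b)) set" assume "I \<subseteq> I'"
    then show "D I' \<subseteq> D I" by (auto simp: D_def)
  qed
  then obtain y where y: "y \<in> topspace Y" "\<And>I. finite I \<Longrightarrow> y \<in> D I" by blast
  have "passes_test q y" if "valid_test q" for q using y(2)[of "{q}"] that by (simp add: D_def)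
  then show ?thesis using y(1) by blast
qed

section \<open>The limit map onto the minimal flow\<close>

definition base_point :: 'y where
  "base_point = (SOME y. y \<in> topspace Y \<and> (\<forall>q. valid_test q \<longrightarrow> passes_test q y))"

lemma base_point: "base_point \<in> topspace Y" "valid_test q \<Longrightarrow> passes_test q base_point"
  using someI_ex[of "\<lambda>y. y \<in> topspace Y \<and> (\<forall>q. valid_test q \<longrightarrow> passes_test q y)"] all_tests
  unfolding base_point_def by blast+

definition orbit_near :: "('b \<times> 'b \<Rightarrow> bool) \<Rightarrow> ('b \<times> 'b) set \<Rightarrow> 'y set" where
  "orbit_near r F = {\<psi> g base_point | g. g \<in> N \<and> (\<forall>p\<in>F. NO_action g r0 p = r p)}"

text \<open>\<open>z\<close> is a cluster point of the orbit points
  \<open>\<psi> g base_point\<close> as \<open>g r0\<close> tends to \<open>r\<close>.\<close>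

definition limit :: "('b \<times> 'b \<Rightarrow> bool) \<Rightarrow> 'y \<Rightarrow> bool" where
  "limit r z \<longleftrightarrow> z \<in> topspace Y \<and> (\<forall>F. finite F \<longrightarrow> z \<in> Y closure_of orbit_near r F)"

lemma orbit_near_mono: "F \<subseteq> F' \<Longrightarrow> orbit_near r F' \<subseteq> orbit_near r F"
  by (auto simp: orbit_near_def)

lemma orbit_near_nonempty:
  assumes "r \<in> natural_orderings" "finite F"
  shows "orbit_near r F \<noteq> {}"
  using dense_orbit[OF r0 assms] by (auto simp: orbit_near_def)

lemma orbit_near_subset: "orbit_near r F \<subseteq> topspace Y"
  using psi_mem base_point(1) by (auto simp: orbit_near_def)

lemma limit_exists:
  assumes "r \<in> natural_orderings"
  shows "\<exists>z. limit r z"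
proof -
  have "\<exists>z\<in>topspace Y. \<forall>F. finite F \<longrightarrow> z \<in> Y closure_of orbit_near r F"
  proof (rule compact_space_directed[OF compact_Y])
    show "closedin Y (Y closure_of orbit_near r F)" for F by simp
    show "Y closure_of orbit_near r F \<noteq> {}" if "finite F" for F
      using closure_of_subset[OF orbit_near_subset, of r F] orbit_near_nonempty[OF assms that] by blast
    show "Y closure_of orbit_near r F' \<subseteq> Y closure_of orbit_near r F" if "F \<subseteq> F'" for F F'
      by (rule closure_of_mono[OF orbit_near_mono[OF that]])
  qed
  then show ?thesis by (auto simp: limit_def)
qed

text \<open>A Urysohn function \<open>f\<close> with values 0 and 1 would separate two limits. Near
  each of them lies an orbit point whose group element orders the pieces of a partition for which
  \<open>f\<close> is tame in the way \<open>r\<close> does, so the two elements form a valid test;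
  but 1/8 + 1/2 + 1/8 < 1.\<close>

lemma limit_unique:
  assumes r: "r \<in> natural_orderings" and z: "limit r z" "limit r z'"
  shows "z = z'"
proof (rule ccontr)
  assume ne: "z \<noteq> z'"
  have zY: "z \<in> topspace Y" "z' \<in> topspace Y" using z by (simp_all add: limit_def)
  have normal: "normal_space Y"
    using compact_Hausdorff_or_regular_imp_normal_space[OF compact_Y] Hausdorff_Y by blast
  have closed: "closedin Y {z}" "closedin Y {z'}"
    using closedin_Hausdorff_singleton[OF Hausdorff_Y] zY by blast+
  have disj: "disjnt {z} {z'}" using ne by simp
  obtain f where f: "continuous_map Y (top_of_set {0..1 :: real}) f" "f ` {z} \<subseteq> {0}" "f ` {z'} \<subseteq> {1}"
    by (rule Urysohn_lemma[OF normal closed disj zero_le_one])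
  have fc: "continuous_map Y euclideanreal f" and f01: "f ` topspace Y \<subseteq> {0..1}"
    using f(1) unfolding continuous_map_in_subtopology by auto
  obtain P where P: "bpartition P" "\<forall>s\<in>N. (\<forall>x\<in>P. s x = x) \<longrightarrow>
    (\<forall>z\<in>topspace Y. \<bar>f (\<psi> s z) - f z\<bar> \<le> 1 / 10)"
    using uniform_partition[OF fc] by blast
  obtain as where as: "distinct as" "set as = P" "sorted_wrt (\<lambda>x y. r (x, y)) as"
    using natural_ordering_enumeration[OF r P(1)] by blast
  let ?a = "rev as"
  have a: "tame f ?a"
    unfolding tame_def
  proof (intro conjI)
    show "\<forall>z\<in>topspace Y. 0 \<le> f z \<and> f z \<le> 1" using f01 by auto
    show "pieces bot ?a" using as(1,2) P(1) by (simp add: pieces_bot_iff)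
    show "\<forall>s\<in>N. (\<forall>x\<in>set ?a. s x = x) \<longrightarrow> (\<forall>z\<in>topspace Y. \<bar>f (\<psi> s z) - f z\<bar> \<le> 1 / 10)"
      using P(2) unfolding set_rev as(2) .
  qed (fact fc)
  \<comment> \<open>Agreement with \<open>r\<close> on these pairs already fixes the descending list
    of \<open>P\<close>.\<close>
  let ?F = "P \<times> P"
  have desc: "descending (NO_action g r0) ?a" if "\<forall>p\<in>?F. NO_action g r0 p = r p" for g
  proof -
    have "sorted_wrt (\<lambda>x y. NO_action g r0 (x, y)) as"
      by (rule sorted_wrt_mono_rel[OF _ as(3)]) (use that as(2) in auto)
    then show ?thesis by (simp add: descending_def sorted_wrt_rev)
  qed
  have fin: "finite ?F" using bpartitionD(1)[OF P(1)] by simp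
  have approx: "\<exists>g. g \<in> N \<and> descending (NO_action g r0) ?a \<and> \<bar>f (\<psi> g base_point) - f x\<bar> < 1 / 8"
    if x: "limit r x" for x
  proof -
    let ?U = "{y \<in> topspace Y. f y \<in> ball (f x) (1 / 8)}"
    have cl: "x \<in> Y closure_of orbit_near r ?F" and "x \<in> topspace Y" using x fin by (simp_all add: limit_def)
    then have "x \<in> ?U \<and> openin Y ?U"
      by (intro conjI openin_continuous_map_preimage[OF fc]) simp_all
    with cl[unfolded in_closure_of, THEN conjunct2, THEN spec, THEN mp]
    have "\<exists>y. y \<in> orbit_near r ?F \<and> y \<in> ?U" .
    then obtain y where y: "y \<in> orbit_near r ?F" "f y \<in> ball (f x) (1 / 8)" by blast
    then obtain g where g: "y = \<psi> g base_point" "g \<in> N" "\<forall>p\<in>?F. NO_action g r0 p = r p"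
      unfolding orbit_near_def by blast
    then show ?thesis using desc[OF g(3)] y(2) by (auto simp: dist_real_def abs_minus_commute)
  qed
  obtain g where g: "g \<in> N" "descending (NO_action g r0) ?a" "\<bar>f (\<psi> g base_point) - f z\<bar> < 1 / 8"
    using approx[OF z(1)] by blast
  obtain g' where g': "g' \<in> N" "descending (NO_action g' r0) ?a" "\<bar>f (\<psi> g' base_point) - f z'\<bar> < 1 / 8"
    using approx[OF z(2)] by blast
  have "valid_test (f, ?a, g, g')" using a g g' by (simp add: valid_test_def)
  then have "passes_test (f, ?a, g, g') base_point" by (rule base_point(2))
  then have "\<bar>f (\<psi> g base_point) - f (\<psi> g' base_point)\<bar> \<le> 1 / 2" by (simp only: passes_test_def prod.case)
  moreover have "f z = 0" "f z' = 1" using f(2,3) by auto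
  ultimately show False using g(3) g'(3) by linarith
qed

definition limit_map :: "('b \<times> 'b \<Rightarrow> bool) \<Rightarrow> 'y" where
  "limit_map r = (SOME z. limit r z)"

lemma limit_limit_map: "r \<in> natural_orderings \<Longrightarrow> limit r (limit_map r)"
  unfolding limit_map_def by (rule someI_ex[OF limit_exists])

lemma limit_map_eq: "r \<in> natural_orderings \<Longrightarrow> limit r z \<Longrightarrow> limit_map r = z"
  by (rule limit_unique[OF _ limit_limit_map])

lemma limit_map_mem: "r \<in> natural_orderings \<Longrightarrow> limit_map r \<in> topspace Y"
  using limit_limit_map by (auto simp: limit_def)

text \<open>Otherwise compactness would yield a limit of \<open>r\<close> outside \<open>V\<close>,
  against uniqueness.\<close>

lemma limit_map_neighbourhood:
  assumes r: "r \<in> natural_orderings" and V: "openin Y V" "limit_map r \<in> V"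
  shows "\<exists>F. finite F \<and> Y closure_of orbit_near r F \<subseteq> V"
proof (rule ccontr)
  assume no: "\<not> ?thesis"
  have "\<exists>z\<in>topspace Y. \<forall>F. finite F \<longrightarrow> z \<in> Y closure_of orbit_near r F - V"
  proof (rule compact_space_directed[OF compact_Y])
    show "closedin Y (Y closure_of orbit_near r F - V)" for F
      using V(1) by (intro closedin_diff) simp_all
    show "Y closure_of orbit_near r F - V \<noteq> {}" if "finite F" for F using no that by blast
    show "Y closure_of orbit_near r F' - V \<subseteq> Y closure_of orbit_near r F - V" if "F \<subseteq> F'" for F F'
      using closure_of_mono[OF orbit_near_mono[OF that], of Y r] by blast
  qed
  then obtain z where z: "z \<in> topspace Y" "\<And>F. finite F \<Longrightarrow> z \<in> Y closure_of orbit_near r F - V" by blast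
  then have "limit r z" by (auto simp: limit_def)
  then have "z \<in> V" using limit_map_eq[OF r] V(2) by simp
  then show False using z(2)[of "{}"] by blast
qed

lemma continuous_limit_map: "continuous_map NO_topology Y limit_map"
  unfolding continuous_map_def
proof (intro conjI allI impI)
  show "limit_map \<in> topspace NO_topology \<rightarrow> topspace Y" using limit_map_mem by simp
  fix V assume V: "openin Y V"
  let ?S = "{r \<in> topspace NO_topology. limit_map r \<in> V}"
  have "\<exists>U. openin NO_topology U \<and> r \<in> U \<and> U \<subseteq> ?S" if r: "r \<in> ?S" for r
  proof -
    have rN: "r \<in> natural_orderings" "limit_map r \<in> V" using r by simp_all
    obtain F where F: "finite F" "Y closure_of orbit_near r F \<subseteq> V"
      using limit_map_neighbourhood[OF rN(1) V rN(2)] by blast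
    have "limit_map r' \<in> V" if r': "r' \<in> natural_orderings" "\<forall>x\<in>F. r' x = r x" for r'
    proof -
      \<comment> \<open>\<open>orbit_near\<close> sees its ordering only at the pairs in
        \<open>F\<close>, so one \<open>F\<close> serves a whole neighbourhood of
        \<open>r\<close>.\<close>
      have "orbit_near r' F = orbit_near r F" using r'(2) by (simp add: orbit_near_def)
      moreover have "limit_map r' \<in> Y closure_of orbit_near r' F"
        using limit_limit_map[OF r'(1)] F(1) by (simp add: limit_def)
      ultimately show ?thesis using F(2) by auto
    qed
    then show ?thesis using openin_NO_cylinder[OF F(1), of r] rN(1)
      by (intro exI[of _ "{r' \<in> natural_orderings. \<forall>x\<in>F. r' x = r x}"]) auto
  qed
  then show "openin NO_topology ?S" by (subst openin_subopen) blast
qed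

text \<open>By uniqueness it suffices that \<open>\<psi> k\<close> sends the limit at
  \<open>r\<close> to a limit at \<open>k r\<close>. The pairs in \<open>F\<close> are pulled back
  by \<open>?k'\<close>, because the action on orderings works through inverses; continuity of
  \<open>\<psi> k\<close> handles the closures.\<close>

lemma limit_map_equivariant:
  assumes k: "k \<in> N" and r: "r \<in> natural_orderings"
  shows "limit_map (NO_action k r) = \<psi> k (limit_map r)"
proof (rule limit_map_eq[OF NO_action_mem[OF k r]])
  let ?k' = "inv_into UNIV k"
  have "\<psi> k (limit_map r) \<in> Y closure_of orbit_near (NO_action k r) F" if F: "finite F" for F
  proof -
    let ?F = "(\<lambda>(x, y). (?k' x, ?k' y)) ` F"
    have "\<psi> k ` orbit_near r ?F \<subseteq> orbit_near (NO_action k r) F"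
    proof
      fix y assume "y \<in> \<psi> k ` orbit_near r ?F"
      then obtain g where g: "y = \<psi> k (\<psi> g base_point)" "g \<in> N" "\<forall>p\<in>?F. NO_action g r0 p = r p"
        unfolding orbit_near_def by blast
      have "NO_action (k \<circ> g) r0 p = NO_action k r p" if p: "p \<in> F" for p
      proof -
        obtain u v where uv: "p = (u, v)" by (cases p)
        have "(?k' u, ?k' v) \<in> ?F" using p uv by force
        then have "NO_action g r0 (?k' u, ?k' v) = r (?k' u, ?k' v)" using g(3) by blast
        then show ?thesis
          unfolding NO_action_comp[OF k g(2) r0] uv NO_action_apply[OF r]
            NO_action_apply[OF NO_action_mem[OF g(2) r0]] .
      qed
      moreover have "y = \<psi> (k \<circ> g) base_point" using psi_comp[OF k g(2) base_point(1)] g(1) by simp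
      ultimately show "y \<in> orbit_near (NO_action k r) F"
        unfolding orbit_near_def using comp_mem[OF k g(2)] by blast
    qed
    then have "Y closure_of (\<psi> k ` orbit_near r ?F) \<subseteq> Y closure_of orbit_near (NO_action k r) F"
      by (rule closure_of_mono)
    moreover have "\<psi> k ` (Y closure_of orbit_near r ?F) \<subseteq> Y closure_of (\<psi> k ` orbit_near r ?F)"
      by (rule continuous_map_image_closure_subset[OF continuous_psi[OF k]])
    moreover have "limit_map r \<in> Y closure_of orbit_near r ?F"
      using limit_limit_map[OF r] F by (simp add: limit_def)
    ultimately show ?thesis by blast
  qed
  then show "limit (NO_action k r) (\<psi> k (limit_map r))"
    using psi_mem[OF k limit_map_mem[OF r]] by (simp add: limit_def)
qed

text \<open>The image is compact, hence closed, and invariant by equivariance; surjectivity is then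
  the minimality of \<open>Y\<close>.\<close>

lemma limit_map_image: "limit_map ` natural_orderings = topspace Y"
proof -
  let ?C = "limit_map ` natural_orderings"
  have "compactin NO_topology (natural_orderings :: ('b \<times> 'b \<Rightarrow> bool) set)"
    using compact_space_NO unfolding compact_space_def topspace_NO .
  then have "closedin Y ?C"
    by (intro compactin_imp_closedin[OF Hausdorff_Y] image_compactin[OF _ continuous_limit_map])
  moreover have "?C \<noteq> {}" using natural_orderings_nonempty by simp
  moreover have "\<psi> g ` ?C \<subseteq> ?C" if g: "g \<in> carrier G" for g
  proof
    fix y assume "y \<in> \<psi> g ` ?C"
    then obtain r where r: "r \<in> natural_orderings" "y = \<psi> g (limit_map r)" by blast
    have gN: "g \<in> N" using g by simp
    have "y = limit_map (NO_action g r)" using limit_map_equivariant[OF gN r(1)] r(2) by simp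
    then show "y \<in> ?C" using NO_action_mem[OF gN r(1)] by blast
  qed
  ultimately have "closedin Y ?C \<and> ?C \<noteq> {} \<and> (\<forall>g\<in>carrier G. \<psi> g ` ?C \<subseteq> ?C)" by blast
  then show ?thesis
    by (rule minimal[unfolded minimal_flow_def, THEN conjunct2, THEN conjunct2, THEN spec, THEN mp])
qed

end

context homogeneous_subgroup
begin

lemma universal_minimal_flow_NO:
  "universal_minimal_flow TYPE('y) G T (NO_topology :: ('b \<times> 'b \<Rightarrow> bool) topology) NO_action"
  unfolding universal_minimal_flow_def
proof (intro conjI minimal_flow_NO allI impI)
  fix Y :: "'y topology" and \<psi>
  assume Y: "minimal_flow G T Y \<psi>"
  obtain r0 :: "'b \<times> 'b \<Rightarrow> bool" where r0: "r0 \<in> natural_orderings"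
    using natural_orderings_nonempty by blast
  interpret minimal_flow_target N Y \<psi> r0 by unfold_locales (fact Y, fact r0)
  show "\<exists>h. continuous_map NO_topology Y h \<and> h ` topspace NO_topology = topspace Y \<and>
      (\<forall>g\<in>carrier G. \<forall>r\<in>topspace NO_topology. h (NO_action g r) = \<psi> g (h r))"
    using continuous_limit_map limit_map_image limit_map_equivariant
    by (intro exI[of _ limit_map]) simp
qed

end

lemma (in normalized_subgroup) homogeneous_subgroup_normalized: "homogeneous_subgroup N"
proof unfold_locales
  show "\<exists>g\<in>N. map g as = bs" if "pieces bot as" "pieces bot bs" "length as = length bs" for as bs
    using that by (rule transitive)
  show "\<exists>u v. u \<noteq> bot \<and> v \<noteq> bot \<and> inf u v = bot \<and> sup u v = x" if "x \<noteq> bot" for x :: pow_mod_fin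
    using atomless[OF that] by blast
  show "(bot :: pow_mod_fin) \<noteq> top_class.top"
    using abs_eq_bot_iff[of UNIV] by (simp add: top_pow_mod_fin_def)
qed

text \<open>The trivial subgroup is excluded because its minimal flows are single points, while
  there is more than one natural ordering. All other cases share the properties collected in
  \<open>normalized_subgroup\<close>.\<close>

theorem corollary2:
  fixes N :: "(pow_mod_fin \<Rightarrow> pow_mod_fin) set"
  assumes "N \<lhd> (aut_group\<lparr>carrier := T_omega_star\<rparr>) \<or> N \<lhd> aut_group"
    and "N \<noteq> {id}"
  shows "universal_minimal_flow TYPE('y) (aut_group\<lparr>carrier := N\<rparr>)
           (subtopology pointwise_topology N)
           (NO_topology :: (pow_mod_fin \<times> pow_mod_fin \<Rightarrow> bool) topology) NO_action"
  by (rule homogeneous_subgroup.universal_minimal_flow_NO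
      [OF normalized_subgroup.homogeneous_subgroup_normalized[OF normal_normalized_subgroup[OF assms]]])

end
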